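(* Let $\alpha=\alpha_0,\alpha_1,\dots,\alpha_N$ be skew-symmetric forms on $\mathbb R^n$ with $\alpha$ a calibration $k$-form, and let $\mathrm{G}\subset\mathrm{SO}(n)$ be their common stabilizer. Assume that $\mathrm{G}$ acts transitively on the $\alpha$-calibrated Grassmannian $\mathrm{Gr}_\alpha=\mathrm{G}/\mathrm{H}$, and suppose $\alpha$ is compliant. If $\mathrm{G}$ is connected, then $\mathrm{Gr}_\alpha=\mathrm{G}/\mathrm{H}$ is a locally symmetric space. If, furthermore, $\mathrm{Gr}_\alpha$ is simply-connected, then it is a symmetric space.
   Context: $\mathbb R^n$ has its standard inner product and orientation; vectors and covectors are identified, so $\Lambda^2(\mathbb R^n)=\mathfrak{so}(n)$, with its standard $\mathrm{Ad}$-invariant inner product. For $1\le k\le n-1$, $\alpha\in\Lambda^k(\mathbb R^n)$ is a calibration if $\alpha|_W\le\mathrm{vol}_W$ for every oriented $k$-plane $W$, with equality for at least one $W$; $W$ is $\alpha$-calibrated if $\alpha|_W=\mathrm{vol}_W$, and $\mathrm{Gr}_\alpha$ is the set of $\alpha$-calibrated oriented $k$-planes. $\mathrm{G}=\{P\in\mathrm{SO}(n):P^*\alpha_j=\alpha_j,\ 0\le j\le N\}$ (the $\alpha_j$ may have different degrees), with Lie algebra $\mathfrak g$. For $W\in\mathrm{Gr}_\alpha$, $\mathrm{H}=\mathrm{H}_W=\{P\in\mathrm{G}:P(W)=W\}$ (well defined up to conjugacy) has Lie algebra $\mathfrak h=\mathfrak g\cap(\Lambda^2W\oplus\Lambda^2W^\perp)$,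 and $\mathfrak h^{\perp_{\mathfrak g}}$ is its orthogonal complement in $\mathfrak g$. $\alpha$ is compliant if $\mathfrak h^{\perp_{\mathfrak g}}=\mathfrak g\cap(W\otimes W^\perp)$ (independent of the choice of $W\in\mathrm{Gr}_\alpha$ under transitivity), where $\mathfrak{so}(n)=(\Lambda^2W\oplus\Lambda^2W^\perp)\oplus(W\otimes W^\perp)$. The Riemannian metric on the homogeneous space $\mathrm{Gr}_\alpha=\mathrm{G}/\mathrm{H}$ is the one induced from the bi-invariant metric on $\mathrm{G}\subseteq\mathrm{SO}(n)$ given by the standard inner product on $\mathfrak{so}(n)$ (so that $\mathrm{G}\to\mathrm{G}/\mathrm{H}$ is a Riemannian submersion). "(Locally) symmetric" is meant in the usual Riemannian sense. *)

theory Defs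
  imports "HOL-Analysis.Analysis"
begin

text \<open>Forms and \<open>k\<close>-vectors. A form of degree \<open>k\<close> is a real function on lists, of which only the
  values on lists of length \<open>k\<close> matter.

  The exterior algebra of \<open>real ^ 'n\<close> is the type \<open>real ^ ('n set)\<close>: the coordinate \<open>I\<close> of a
  multivector is its coefficient at \<open>e\<^bsub>i1\<^esub> \<and> \<dots> \<and> e\<^bsub>ik\<^esub>\<close>, where \<open>i1 < \<dots> < ik\<close> are the elements of \<open>I\<close>.
  The linear order on \<open>'n\<close> is the order of the standard basis. The inner product of this type is
  the standard one on the exterior algebra.\<close>

type_synonym 'n rvec = "(real, 'n) vec"
type_synonym 'n rmat = "((real, 'n) vec, 'n) vec"
type_synonym 'n multivector = "(real, 'n set) vec"

definition skew_form :: "nat \<Rightarrow> ('n::finite rvec list \<Rightarrow> real) \<Rightarrow> bool" where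
  "skew_form k \<alpha> \<longleftrightarrow> (\<forall>vs. length vs = k \<longrightarrow>
     (\<forall>i<k. linear (\<lambda>v. \<alpha> (vs[i := v]))) \<and>
     (\<forall>i<k. \<forall>j<k. i \<noteq> j \<longrightarrow> \<alpha> (vs[i := vs ! j, j := vs ! i]) = - \<alpha> vs))"

text \<open>\<open>wedge [v1, \<dots>, vk]\<close> is \<open>v1 \<and> \<dots> \<and> vk\<close>; its coordinates are the \<open>k \<times> k\<close> minors, expanded by
  the Leibniz formula.\<close>

definition wedge :: "'n::{finite,linorder} rvec list \<Rightarrow> 'n multivector" where
  "wedge vs = (\<chi> I. if card I = length vs
     then \<Sum>p | p permutes {..<length vs}.
            of_int (sign p) * (\<Prod>i<length vs. (vs ! p i) $ (sorted_list_of_set I ! i))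
     else 0)"

text \<open>The algebra endomorphism of the exterior algebra induced by \<open>P\<close>, given on the basis by
  \<open>e\<^bsub>i1\<^esub> \<and> \<dots> \<and> e\<^bsub>ik\<^esub> \<mapsto> P e\<^bsub>i1\<^esub> \<and> \<dots> \<and> P e\<^bsub>ik\<^esub>\<close>. On oriented planes it is \<open>W \<mapsto> P(W)\<close>.\<close>

definition ext_map :: "'n::{finite,linorder} rmat \<Rightarrow> 'n multivector \<Rightarrow> 'n multivector" where
  "ext_map P \<xi> =
     (\<Sum>I\<in>UNIV. (\<xi> $ I) *\<^sub>R wedge (map (\<lambda>i. P *v axis i 1) (sorted_list_of_set I)))"

definition orthonormal_list :: "'n::finite rvec list \<Rightarrow> bool" where
  "orthonormal_list B \<longleftrightarrow>
     (\<forall>i<length B. \<forall>j<length B. B ! i \<bullet> B ! j = (if i = j then 1 else 0))"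

text \<open>An oriented \<open>k\<close>-plane is represented by the unit simple \<open>k\<close>-vector \<open>e1 \<and> \<dots> \<and> ek\<close> of any of its
  oriented orthonormal bases. This embeds the oriented Grassmannian in the exterior algebra.\<close>

definition oriented_planes :: "nat \<Rightarrow> 'n::{finite,linorder} multivector set" where
  "oriented_planes k = {wedge B | B. length B = k \<and> orthonormal_list B}"

definition plane :: "'n::{finite,linorder} multivector \<Rightarrow> 'n rvec set" where
  "plane W = {v. \<exists>B. orthonormal_list B \<and> wedge B = W \<and> v \<in> span (set B)}"

text \<open>For an oriented \<open>k\<close>-plane \<open>W\<close> and \<open>vs\<close> in \<open>plane W\<close>, this is the determinant of \<open>vs\<close> in an oriented
  orthonormal basis of \<open>W\<close>.\<close>

definition vol :: "'n::{finite,linorder} multivector \<Rightarrow> 'n rvec list \<Rightarrow> real" where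
  "vol W vs = W \<bullet> wedge vs"

definition calibrated ::
    "nat \<Rightarrow> ('n::{finite,linorder} rvec list \<Rightarrow> real) \<Rightarrow> 'n multivector \<Rightarrow> bool" where
  "calibrated k \<alpha> W \<longleftrightarrow> (\<forall>vs. length vs = k \<and> set vs \<subseteq> plane W \<longrightarrow> \<alpha> vs = vol W vs)"

definition calibrated_Grassmannian ::
    "nat \<Rightarrow> ('n::{finite,linorder} rvec list \<Rightarrow> real) \<Rightarrow> 'n multivector set" where
  "calibrated_Grassmannian k \<alpha> = {W \<in> oriented_planes k. calibrated k \<alpha> W}"

text \<open>The inequality between the top-degree forms \<open>\<alpha>|\<^sub>W\<close> and \<open>vol W\<close> on the oriented plane \<open>W\<close> means
  the inequality on positively oriented bases.\<close>

definition calibration :: "nat \<Rightarrow> ('n::{finite,linorder} rvec list \<Rightarrow> real) \<Rightarrow> bool" where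
  "calibration k \<alpha> \<longleftrightarrow> skew_form k \<alpha> \<and>
     (\<forall>W \<in> oriented_planes k. \<forall>vs. length vs = k \<and> set vs \<subseteq> plane W \<and> vol W vs > 0
        \<longrightarrow> \<alpha> vs \<le> vol W vs) \<and>
     (\<exists>W \<in> oriented_planes k. calibrated k \<alpha> W)"

text \<open>Smooth maps between arbitrary subsets of Euclidean spaces are those that locally extend to
  \<open>C\<^sup>\<infinity>\<close> maps on open sets; a smooth manifold is a subset locally diffeomorphic to open subsets of a
  fixed \<open>m\<close>-dimensional vector space (as in Milnor or Guillemin and Pollack).\<close>

fun Ck_on :: "nat \<Rightarrow> ('a::euclidean_space \<Rightarrow> 'b::euclidean_space) \<Rightarrow> 'a set \<Rightarrow> bool" where
  "Ck_on 0 f S = continuous_on S f"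
| "Ck_on (Suc r) f S \<longleftrightarrow> (\<forall>x\<in>S. f differentiable (at x)) \<and>
     (\<forall>v. Ck_on r (\<lambda>x. frechet_derivative f (at x) v) S)"

definition smooth_on :: "'a::euclidean_space set \<Rightarrow> ('a \<Rightarrow> 'b::euclidean_space) \<Rightarrow> bool" where
  "smooth_on S f \<longleftrightarrow> (\<forall>x\<in>S. \<exists>T F. open T \<and> x \<in> T \<and> (\<forall>r. Ck_on r F T) \<and>
     (\<forall>y \<in> S \<inter> T. F y = f y))"

definition diffeomorphism ::
    "'a::euclidean_space set \<Rightarrow> 'b::euclidean_space set \<Rightarrow> ('a \<Rightarrow> 'b) \<Rightarrow> bool" where
  "diffeomorphism S T f \<longleftrightarrow> bij_betw f S T \<and> smooth_on S f \<and> smooth_on T (inv_into S f)"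

definition smooth_manifold :: "nat \<Rightarrow> 'a::euclidean_space set \<Rightarrow> bool" where
  "smooth_manifold m M \<longleftrightarrow> (\<forall>p\<in>M. \<exists>U E V \<phi>. openin (top_of_set M) U \<and> p \<in> U \<and>
     subspace (E :: 'a set) \<and> dim E = m \<and> openin (top_of_set E) V \<and> diffeomorphism V U \<phi>)"

definition tangent_space :: "'a::euclidean_space set \<Rightarrow> 'a \<Rightarrow> 'a set" where
  "tangent_space M p = {v. \<exists>\<epsilon>>0. \<exists>\<gamma> :: real \<Rightarrow> 'a. smooth_on {-\<epsilon><..<\<epsilon>} \<gamma> \<and>
     \<gamma> ` {-\<epsilon><..<\<epsilon>} \<subseteq> M \<and> \<gamma> 0 = p \<and> (\<gamma> has_vector_derivative v) (at 0)}"

text \<open>A metric \<open>g\<close> is only meaningful at \<open>g p u v\<close> for \<open>p \<in> M\<close> and \<open>u\<close>, \<open>v\<close> tangent to \<open>M\<close> at \<open>p\<close>.\<close>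

definition riemannian_metric ::
    "'a::euclidean_space set \<Rightarrow> ('a \<Rightarrow> 'a \<Rightarrow> 'a \<Rightarrow> real) \<Rightarrow> bool" where
  "riemannian_metric M g \<longleftrightarrow>
     (\<forall>p\<in>M. \<forall>u \<in> tangent_space M p. \<forall>v \<in> tangent_space M p. g p u v = g p v u) \<and>
     (\<forall>p\<in>M. \<forall>u \<in> tangent_space M p. \<forall>v \<in> tangent_space M p. \<forall>w \<in> tangent_space M p. \<forall>a b.
        g p (a *\<^sub>R u + b *\<^sub>R v) w = a * g p u w + b * g p v w) \<and>
     (\<forall>p\<in>M. \<forall>u \<in> tangent_space M p. u \<noteq> 0 \<longrightarrow> g p u u > 0) \<and>
     (\<forall>X Y. smooth_on M X \<and> smooth_on M Y \<and>
        (\<forall>p\<in>M. X p \<in> tangent_space M p \<and> Y p \<in> tangent_space M p)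
        \<longrightarrow> smooth_on M (\<lambda>p. g p (X p) (Y p)))"

definition riemannian_manifold ::
    "'a::euclidean_space set \<Rightarrow> ('a \<Rightarrow> 'a \<Rightarrow> 'a \<Rightarrow> real) \<Rightarrow> bool" where
  "riemannian_manifold M g \<longleftrightarrow> (\<exists>m. smooth_manifold m M) \<and> riemannian_metric M g"

text \<open>The derivative of a map within a manifold \<open>M\<close> is unique on the tangent space of \<open>M\<close>, where it is
  the differential of the map.\<close>

definition riemannian_isometry ::
    "'a::euclidean_space set \<Rightarrow> ('a \<Rightarrow> 'a \<Rightarrow> 'a \<Rightarrow> real) \<Rightarrow>
     'b::euclidean_space set \<Rightarrow> ('b \<Rightarrow> 'b \<Rightarrow> 'b \<Rightarrow> real) \<Rightarrow> ('a \<Rightarrow> 'b) \<Rightarrow> bool" where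
  "riemannian_isometry M g N h f \<longleftrightarrow> diffeomorphism M N f \<and>
     (\<forall>p\<in>M. \<exists>D. (f has_derivative D) (at p within M) \<and>
        (\<forall>u \<in> tangent_space M p. \<forall>v \<in> tangent_space M p. h (f p) (D u) (D v) = g p u v))"

text \<open>Symmetric and locally symmetric spaces are those with isometric point reflections globally,
  respectively on a neighbourhood of each point (as in Lee, Introduction to Riemannian Manifolds).
  A point reflection is determined near its centre: it is the geodesic symmetry.\<close>

definition point_reflection ::
    "'a::euclidean_space set \<Rightarrow> ('a \<Rightarrow> 'a \<Rightarrow> 'a \<Rightarrow> real) \<Rightarrow> 'a \<Rightarrow> ('a \<Rightarrow> 'a) \<Rightarrow> bool" where
  "point_reflection M g p f \<longleftrightarrow> riemannian_isometry M g M g f \<and> f p = p \<and>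
     (\<exists>D. (f has_derivative D) (at p within M) \<and> (\<forall>u \<in> tangent_space M p. D u = - u))"

definition locally_symmetric_space ::
    "'a::euclidean_space set \<Rightarrow> ('a \<Rightarrow> 'a \<Rightarrow> 'a \<Rightarrow> real) \<Rightarrow> bool" where
  "locally_symmetric_space M g \<longleftrightarrow> riemannian_manifold M g \<and>
     (\<forall>p\<in>M. \<exists>U. openin (top_of_set M) U \<and> p \<in> U \<and> (\<exists>f. point_reflection U g p f))"

definition symmetric_space ::
    "'a::euclidean_space set \<Rightarrow> ('a \<Rightarrow> 'a \<Rightarrow> 'a \<Rightarrow> real) \<Rightarrow> bool" where
  "symmetric_space M g \<longleftrightarrow> riemannian_manifold M g \<and> connected M \<and>
     (\<forall>p\<in>M. \<exists>f. point_reflection M g p f)"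

text \<open>The metric on the image \<open>\<pi> ` M\<close> for which \<open>\<pi>\<close>, assumed differentiable on the ambient space, is a
  Riemannian submersion, if there is one.\<close>

definition horizontal_space ::
    "'a::euclidean_space set \<Rightarrow> ('a \<Rightarrow> 'a \<Rightarrow> 'a \<Rightarrow> real) \<Rightarrow> ('a \<Rightarrow> 'b::euclidean_space) \<Rightarrow> 'a \<Rightarrow> 'a set"
  where
  "horizontal_space M g \<pi> P = {A \<in> tangent_space M P. \<forall>B \<in> tangent_space M P.
     frechet_derivative \<pi> (at P) B = 0 \<longrightarrow> g P A B = 0}"

definition submersion_metric ::
    "'a::euclidean_space set \<Rightarrow> ('a \<Rightarrow> 'a \<Rightarrow> 'a \<Rightarrow> real) \<Rightarrow> ('a \<Rightarrow> 'b::euclidean_space) \<Rightarrow>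
     'b \<Rightarrow> 'b \<Rightarrow> 'b \<Rightarrow> real" where
  "submersion_metric M g \<pi> q u v = (THE c. \<exists>P\<in>M. \<pi> P = q \<and>
     (\<exists>A \<in> horizontal_space M g \<pi> P. \<exists>B \<in> horizontal_space M g \<pi> P.
        frechet_derivative \<pi> (at P) A = u \<and> frechet_derivative \<pi> (at P) B = v \<and> c = g P A B))"

definition form_stabilizer ::
    "nat \<Rightarrow> (nat \<Rightarrow> nat) \<Rightarrow> (nat \<Rightarrow> 'n::finite rvec list \<Rightarrow> real) \<Rightarrow> 'n rmat set" where
  "form_stabilizer N d \<alpha> = {P. rotation_matrix P \<and>
     (\<forall>j\<le>N. \<forall>vs. length vs = d j \<longrightarrow> \<alpha> j (map (\<lambda>v. P *v v) vs) = \<alpha> j vs)}"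

text \<open>For \<open>W\<close> calibrated and \<open>P \<in> G\<close> this agrees with \<open>P(W) = W\<close> as unoriented planes, since \<open>P\<close>
  preserves \<open>\<alpha>|\<^sub>W = vol W\<close> and hence the orientation.\<close>

definition plane_stabilizer ::
    "'n::{finite,linorder} rmat set \<Rightarrow> 'n multivector \<Rightarrow> 'n rmat set" where
  "plane_stabilizer G W = {P \<in> G. ext_map P W = W}"

definition lie_algebra :: "'n::finite rmat set \<Rightarrow> 'n rmat set" where
  "lie_algebra G = tangent_space G (mat 1)"

text \<open>The factor makes the matrices of \<open>e\<^sub>i \<and> e\<^sub>j\<close> for \<open>i < j\<close> orthonormal in \<open>\<Lambda>\<^sup>2(\<real>\<^sup>n) = so(n)\<close>;
  \<open>\<bullet>\<close> on matrices is the trace form \<open>tr(X\<^sup>T Y)\<close>.\<close>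

definition so_inner :: "'n::finite rmat \<Rightarrow> 'n rmat \<Rightarrow> real" where
  "so_inner X Y = (X \<bullet> Y) / 2"

definition biinvariant_metric :: "'n::finite rmat \<Rightarrow> 'n rmat \<Rightarrow> 'n rmat \<Rightarrow> real" where
  "biinvariant_metric P A B = so_inner (transpose P ** A) (transpose P ** B)"

text \<open>\<open>w \<and> v\<close> in \<open>\<Lambda>\<^sup>2(\<real>\<^sup>n) = so(n)\<close> is the matrix \<open>w v\<^sup>T - v w\<^sup>T\<close>.\<close>

definition wedge2 :: "'n::finite rvec \<Rightarrow> 'n rvec \<Rightarrow> 'n rmat" where
  "wedge2 w v = (\<chi> i j. w $ i * v $ j - v $ i * w $ j)"

definition mixed_part :: "'n::finite rvec set \<Rightarrow> 'n rmat set" where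
  "mixed_part W = span {wedge2 w v | w v. w \<in> W \<and> v \<in> W\<^sup>\<bottom>}"

text \<open>Compliance at the base point \<open>W\<close>; if \<open>G\<close> is transitive, it does not depend on \<open>W\<close>.\<close>

definition compliant :: "'n::{finite,linorder} rmat set \<Rightarrow> 'n multivector \<Rightarrow> bool" where
  "compliant G W \<longleftrightarrow>
     {X \<in> lie_algebra G. \<forall>Y \<in> lie_algebra (plane_stabilizer G W). so_inner X Y = 0} =
     lie_algebra G \<inter> mixed_part (plane W)"

text \<open>The metric on \<open>G/H\<close>, transported to the orbit of \<open>W\<close> by \<open>P H \<mapsto> P(W)\<close>.\<close>

definition homogeneous_metric ::
    "'n::{finite,linorder} rmat set \<Rightarrow> 'n multivector \<Rightarrow>
     'n multivector \<Rightarrow> 'n multivector \<Rightarrow> 'n multivector \<Rightarrow> real" where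
  "homogeneous_metric G W = submersion_metric G biinvariant_metric (\<lambda>P. ext_map P W)"

end

theory Submission
  imports Defs
begin

text \<open>Let \<open>R\<close> be the orthogonal reflection in the calibrated plane \<open>W\<close>. It acts on \<open>so(n)\<close> by \<open>+1\<close> on
  \<open>\<Lambda>\<^sup>2W \<oplus> \<Lambda>\<^sup>2W\<^sup>\<bottom>\<close> and by \<open>-1\<close> on \<open>W \<otimes> W\<^sup>\<bottom>\<close>, so compliance says that conjugation by \<open>R\<close> preserves the Lie algebra
  of \<open>G\<close>, being \<open>+1\<close> on that of \<open>H\<close> and \<open>-1\<close> on its orthogonal complement. As \<open>G\<close> is connected,
  \<open>R\<close> normalizes \<open>G\<close>; it fixes \<open>W\<close>, hence acts on \<open>Gr = G/H\<close> as an isometry reflecting the tangent space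
  at \<open>W\<close>. Conjugating by elements of \<open>G\<close> gives a global isometric point reflection at every point of \<open>Gr\<close>.\<close>

section \<open>Calculus of \<open>C\<^sup>k\<close> maps\<close>

text \<open>The reflection \<open>R\<close> need not preserve the forms and may have determinant -1,
  so in general it is no element of G; it is treated as an outer symmetry that normalizes G and
  fixes W. The passage from the Lie algebra to G rests on one observation: G is the common level set
  through \<open>mat 1\<close> of a family of functions closed under right translation. Hence every
  solution of the linearized equations at \<open>mat 1\<close> exponentiates into G, and a
  compactness argument shows that products of such exponentials fill a neighbourhood of
  \<open>mat 1\<close> in G. As manifolds are subsets of Euclidean space, Gr is handled as the orbit
  of W in the exterior algebra. The delicate point is that this orbit is embedded: a chart built
  from group elements near \<open>mat 1\<close> could miss orbit points close to W, and compactness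
  of G rules this out. All metric statements are reduced to W by translating horizontal lifts back
  with elements of G; two choices of such an element differ by the stabilizer of W, which acts
  isometrically on the horizontal space.\<close>

lemma Ck_on_SucI:
  assumes "open S" "\<And>x. x \<in> S \<Longrightarrow> (f has_derivative f' x) (at x)"
    and "\<And>v. Ck_on r (\<lambda>x. f' x v) S"
    and cong: "\<And>f g :: 'a::euclidean_space \<Rightarrow> 'b::euclidean_space.
       Ck_on r f S \<Longrightarrow> (\<And>x. x \<in> S \<Longrightarrow> f x = g x) \<Longrightarrow> Ck_on r g S"
  shows "Ck_on (Suc r) (f :: 'a \<Rightarrow> 'b) S"
proof -
  have "frechet_derivative f (at x) = f' x" if "x \<in> S" for x
    using assms(2)[OF that] frechet_derivative_at by metis
  then have "Ck_on r (\<lambda>x. frechet_derivative f (at x) v) S" for v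
    by (intro cong[OF assms(3)[of v]]) auto
  then show ?thesis
    using assms(2) by (auto simp: differentiable_def)
qed

text \<open>\<open>Ck_on\<close> refers to \<open>frechet_derivative f (at x)\<close>, hence to
  values of \<open>f\<close> around \<open>x\<close>; openness of \<open>S\<close> makes agreement
  on \<open>S\<close> sufficient. The introduction rule \<open>Ck_on_SucI\<close> needs this
  congruence one order lower, so it has it as the premise \<open>cong\<close>, which the induction
  hypothesis discharges here.\<close>

lemma Ck_on_cong_imp:
  assumes "open S"
  shows "Ck_on r f S \<Longrightarrow> (\<And>x. x \<in> S \<Longrightarrow> f x = g x) \<Longrightarrow> Ck_on r g S"
proof (induction r arbitrary: f g)
  case 0
  then show ?case by (simp cong: continuous_on_cong)
next
  case (Suc r)
  show ?case
  proof (rule Ck_on_SucI[OF assms, where f' = "\<lambda>x. frechet_derivative f (at x)"])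
    fix x assume x: "x \<in> S"
    have "(f has_derivative frechet_derivative f (at x)) (at x)"
      using Suc.prems x by (auto simp: frechet_derivative_works)
    then show "(g has_derivative frechet_derivative f (at x)) (at x)"
      using has_derivative_transform_within_open[OF _ assms x] Suc.prems(2) by metis
  qed (use Suc in auto)
qed

lemma Ck_on_Suc_intro:
  assumes "open S" "\<And>x. x \<in> S \<Longrightarrow> (f has_derivative f' x) (at x)"
    and "\<And>v. Ck_on r (\<lambda>x. f' x v) S"
  shows "Ck_on (Suc r) f S"
  by (rule Ck_on_SucI[OF assms Ck_on_cong_imp[OF assms(1)]])

lemma Ck_on_Suc_has_derivative:
  "Ck_on (Suc r) f S \<Longrightarrow> x \<in> S \<Longrightarrow> (f has_derivative frechet_derivative f (at x)) (at x)"
  by (auto simp: frechet_derivative_works)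

lemma Ck_on_SucD: "Ck_on (Suc r) f S \<Longrightarrow> Ck_on r f S"
proof (induction r arbitrary: f)
  case 0
  then show ?case
    by (auto intro!: continuous_at_imp_continuous_on differentiable_imp_continuous_within)
next
  case (Suc r)
  then show ?case by (metis Ck_on.simps(2))
qed

lemma Ck_on_imp_continuous_on: "Ck_on r f S \<Longrightarrow> continuous_on S f"
proof (induction r)
  case (Suc r)
  then show ?case using Ck_on_SucD by blast
qed simp

lemma Ck_on_subset: "Ck_on r f S \<Longrightarrow> T \<subseteq> S \<Longrightarrow> Ck_on r f T"
  by (induction r arbitrary: f) (auto intro: continuous_on_subset)

lemma Ck_on_const: "open S \<Longrightarrow> Ck_on r (\<lambda>x. c) S"
proof (induction r arbitrary: c)
  case (Suc r)
  then show ?case by (intro Ck_on_Suc_intro[where f' = "\<lambda>x v. 0"]) auto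
qed auto

lemma Ck_on_linear_compose:
  assumes "open S" "bounded_linear L"
  shows "Ck_on r f S \<Longrightarrow> Ck_on r (\<lambda>x. L (f x)) S"
proof (induction r arbitrary: f)
  case 0
  then show ?case
    using assms(2) bounded_linear.continuous_on by auto
next
  case (Suc r)
  show ?case
    by (rule Ck_on_Suc_intro[OF assms(1),
          where f' = "\<lambda>x v. L (frechet_derivative f (at x) v)"])
      (use Suc Ck_on_Suc_has_derivative[OF Suc.prems] in
        \<open>auto intro!: bounded_linear.has_derivative[OF assms(2)]\<close>)
qed

lemma Ck_on_ident: "open S \<Longrightarrow> Ck_on r (\<lambda>x. x) S"
proof (cases r)
  case (Suc r')
  assume "open S"
  then show ?thesis
    unfolding Suc by (intro Ck_on_Suc_intro[where f' = "\<lambda>x v. v"] Ck_on_const) auto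
qed auto

lemma Ck_on_bounded_linear: "open S \<Longrightarrow> bounded_linear L \<Longrightarrow> Ck_on r L S"
  using Ck_on_linear_compose[OF _ _ Ck_on_ident, of S L r] by simp

lemma Ck_on_add:
  assumes "open S"
  shows "Ck_on r f S \<Longrightarrow> Ck_on r g S \<Longrightarrow> Ck_on r (\<lambda>x. f x + g x) S"
proof (induction r arbitrary: f g)
  case (Suc r)
  show ?case
    by (rule Ck_on_Suc_intro[OF assms, where f' =
          "\<lambda>x v. frechet_derivative f (at x) v + frechet_derivative g (at x) v"])
      (use Suc Ck_on_Suc_has_derivative[OF Suc.prems(1)] Ck_on_Suc_has_derivative[OF Suc.prems(2)]
        in \<open>auto intro!: has_derivative_add\<close>)
qed (auto intro: continuous_on_add)

lemma Ck_on_sum: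
  assumes "open S" "\<And>i. i \<in> I \<Longrightarrow> Ck_on r (f i) S"
  shows "Ck_on r (\<lambda>x. \<Sum>i\<in>I. f i x) S"
  using assms(2)
  by (induction I rule: infinite_finite_induct) (auto intro!: Ck_on_const Ck_on_add assms(1))

lemma Ck_on_bilinear:
  fixes prod :: "'b::euclidean_space \<Rightarrow> 'c::euclidean_space \<Rightarrow> 'd::euclidean_space"
  assumes "open S" "bounded_bilinear prod"
  shows "Ck_on r f S \<Longrightarrow> Ck_on r g S \<Longrightarrow> Ck_on r (\<lambda>x. prod (f x) (g x)) S"
proof (induction r arbitrary: f g)
  case 0
  then show ?case by (auto intro: bounded_bilinear.continuous_on[OF assms(2)])
next
  case (Suc r)
  show ?case
  proof (rule Ck_on_Suc_intro[OF assms(1), where f' =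
        "\<lambda>x v. prod (f x) (frechet_derivative g (at x) v) + prod (frechet_derivative f (at x) v) (g x)"])
    show "((\<lambda>x. prod (f x) (g x)) has_derivative (\<lambda>v. prod (f x) (frechet_derivative g (at x) v) +
        prod (frechet_derivative f (at x) v) (g x))) (at x)" if "x \<in> S" for x
      using that Suc.prems by (intro bounded_bilinear.FDERIV[OF assms(2)] Ck_on_Suc_has_derivative)
    show "Ck_on r (\<lambda>x. prod (f x) (frechet_derivative g (at x) v) +
        prod (frechet_derivative f (at x) v) (g x)) S" for v
      using Suc.prems Ck_on_SucD[OF Suc.prems(1)] Ck_on_SucD[OF Suc.prems(2)]
      by (intro Ck_on_add[OF assms(1)] Suc.IH) auto
  qed
qed

lemmas Ck_on_scaleR = Ck_on_bilinear[OF _ bounded_bilinear_scaleR]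
lemmas Ck_on_mult = Ck_on_bilinear[OF _ bounded_bilinear_mult]
lemmas Ck_on_inner = Ck_on_bilinear[OF _ bounded_bilinear_inner]

lemma Ck_on_prod:
  fixes f :: "'i \<Rightarrow> 'a::euclidean_space \<Rightarrow> real"
  assumes "open S" "\<And>i. i \<in> I \<Longrightarrow> Ck_on r (f i) S"
  shows "Ck_on r (\<lambda>x. \<Prod>i\<in>I. f i x) S"
  using assms(2)
  by (induction I rule: infinite_finite_induct) (auto intro!: Ck_on_const Ck_on_mult assms(1))

lemma Ck_on_componentwise:
  assumes "open S" "\<And>b. b \<in> Basis \<Longrightarrow> Ck_on r (\<lambda>x. f x \<bullet> b) S"
  shows "Ck_on r f S"
proof -
  have "Ck_on r (\<lambda>x. \<Sum>b\<in>Basis. (f x \<bullet> b) *\<^sub>R b) S"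
    using assms by (intro Ck_on_sum Ck_on_scaleR Ck_on_const)
  then show ?thesis by (simp add: euclidean_representation)
qed

lemma Ck_on_vec_lambda:
  fixes f :: "'a::euclidean_space \<Rightarrow> 'i::finite \<Rightarrow> 'b::euclidean_space"
  assumes "open S" "\<And>i. Ck_on r (\<lambda>x. f x i) S"
  shows "Ck_on r (\<lambda>x. \<chi> i. f x i) S"
proof (rule Ck_on_componentwise[OF assms(1)])
  fix b :: "'b ^ 'i" assume "b \<in> Basis"
  then obtain i c where "b = axis i c" "c \<in> Basis" by (auto simp: Basis_vec_def)
  then show "Ck_on r (\<lambda>x. (\<chi> i. f x i) \<bullet> b) S"
    using assms by (simp add: inner_axis Ck_on_inner Ck_on_const)
qed

lemma Ck_on_vec_nth: "open S \<Longrightarrow> Ck_on r f S \<Longrightarrow> Ck_on r (\<lambda>x. f x $ i) S"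
  for f :: "_ \<Rightarrow> 'b::euclidean_space ^ 'i::finite"
  by (rule Ck_on_linear_compose[OF _ bounded_linear_vec_nth])

text \<open>\<open>Ck_on\<close> controls the derivative only in fixed directions, while the chain
  rule feeds the moving vector Df(x)v into the derivative of \<open>g\<close>. Expanding that vector
  in \<open>Basis\<close> leaves fixed directions with scalar coefficients depending on
  \<open>x\<close>.\<close>

lemma Ck_on_compose:
  assumes "open S" "open T"
  shows "Ck_on r g T \<Longrightarrow> Ck_on r f S \<Longrightarrow> f ` S \<subseteq> T \<Longrightarrow> Ck_on r (\<lambda>x. g (f x)) S"
proof (induction r arbitrary: f g)
  case 0
  then show ?case using continuous_on_compose2 by auto
next
  case (Suc r)
  let ?f = "\<lambda>x. frechet_derivative f (at x)" and ?g = "\<lambda>x. frechet_derivative g (at x)"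
  have Dg: "(g has_derivative ?g (f x)) (at (f x))" if "x \<in> S" for x
    using Suc.prems that by (intro Ck_on_Suc_has_derivative) auto
  show ?case
  proof (rule Ck_on_Suc_intro[OF assms(1), where f' =
        "\<lambda>x v. \<Sum>b\<in>Basis. (?f x v \<bullet> b) *\<^sub>R ?g (f x) b"])
    fix x assume x: "x \<in> S"
    have *: "((\<lambda>x. g (f x)) has_derivative (\<lambda>v. ?g (f x) (?f x v))) (at x)"
      using Dg[OF x] Ck_on_Suc_has_derivative[OF Suc.prems(2) x] has_derivative_compose by blast
    have "?g (f x) w = (\<Sum>b\<in>Basis. (w \<bullet> b) *\<^sub>R ?g (f x) b)" for w
    proof -
      have "linear (?g (f x))"
        using Dg[OF x] has_derivative_bounded_linear bounded_linear.linear by blast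
      then show ?thesis
        by (subst (1) euclidean_representation[symmetric, of w]) (simp add: linear_sum linear_scale)
    qed
    then have "(\<lambda>v. ?g (f x) (?f x v)) = (\<lambda>v. \<Sum>b\<in>Basis. (?f x v \<bullet> b) *\<^sub>R ?g (f x) b)"
      by (intro ext)
    with * show "((\<lambda>x. g (f x)) has_derivative
        (\<lambda>v. \<Sum>b\<in>Basis. (?f x v \<bullet> b) *\<^sub>R ?g (f x) b)) (at x)"
      by simp
  next
    show "Ck_on r (\<lambda>x. \<Sum>b\<in>Basis. (?f x v \<bullet> b) *\<^sub>R ?g (f x) b) S" for v
      using Suc.prems Ck_on_SucD[OF Suc.prems(2)]
      by (intro Ck_on_sum Ck_on_scaleR Ck_on_inner Ck_on_const assms(1) Suc.IH) auto
  qed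
qed

lemma Ck_on_inverse:
  fixes f :: "'a::euclidean_space \<Rightarrow> real"
  assumes "open S" "Ck_on r f S" "\<And>x. x \<in> S \<Longrightarrow> f x \<noteq> 0"
  shows "Ck_on r (\<lambda>x. inverse (f x)) S"
proof -
  have *: "Ck_on r inverse (- {0::real})" for r
  proof (induction r)
    case 0
    show ?case by (auto intro!: continuous_intros)
  next
    case (Suc r)
    have o: "open (- {0::real})"
      by auto
    \<comment> \<open>The derivative of \<open>inverse\<close> is again a product of values of
      \<open>inverse\<close>, so the induction hypothesis yields one more order.\<close>
    have "Ck_on r (\<lambda>x. inverse x * v * inverse x) (- {0})" for v :: real
      by (rule Ck_on_mult[OF o Ck_on_mult[OF o Suc Ck_on_const[OF o]] Suc])
    from Ck_on_linear_compose[OF o bounded_linear_minus[OF bounded_linear_ident] this]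
    have "Ck_on r (\<lambda>x. - (inverse x * v * inverse x)) (- {0})" for v :: real .
    then show ?case
      by (intro Ck_on_Suc_intro[OF o has_derivative_inverse']) auto
  qed
  show ?thesis
    by (rule Ck_on_compose[OF assms(1) _ * assms(2)]) (use assms(3) in auto)
qed

lemma Ck_on_det:
  fixes A :: "'a::euclidean_space \<Rightarrow> 'm::finite rmat"
  assumes "open S" "Ck_on r A S"
  shows "Ck_on r (\<lambda>x. det (A x)) S"
  unfolding det_def
  using assms by (intro Ck_on_sum Ck_on_mult Ck_on_const Ck_on_prod Ck_on_vec_nth)

text \<open>Cramer's rule makes the solution a quotient of polynomials in the entries of
  \<open>A\<close>, so it inherits the regularity of \<open>A\<close> without any prior knowledge
  about \<open>u\<close>.\<close>

lemma Ck_on_matrix_solution: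
  fixes A :: "'a::euclidean_space \<Rightarrow> 'm::finite rmat"
  assumes S: "open S" and A: "Ck_on r A S" and "\<And>x. x \<in> S \<Longrightarrow> det (A x) \<noteq> 0"
    and u: "\<And>x. x \<in> S \<Longrightarrow> A x *v u x = v"
  shows "Ck_on r u S"
proof (rule Ck_on_cong_imp[OF S])
  let ?u = "\<lambda>x. \<chi> k. det (\<chi> i j. if j = k then v $ i else A x $ i $ j) * inverse (det (A x))"
  show "?u x = u x" if "x \<in> S" for x
    using cramer[of "A x" "u x" v] assms(3) u that by (simp add: field_simps)
  have "Ck_on r (\<lambda>x. if j = k then v $ i else A x $ i $ j) S" for i j k
    using S A by (cases "j = k") (auto intro!: Ck_on_const Ck_on_vec_nth)
  then show "Ck_on r ?u S"
    using assms by (intro Ck_on_vec_lambda Ck_on_mult Ck_on_det Ck_on_inverse)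
qed

section \<open>Smooth maps and the inverse function theorem\<close>

definition C_infinity_on :: "('a::euclidean_space \<Rightarrow> 'b::euclidean_space) \<Rightarrow> 'a set \<Rightarrow> bool" where
  "C_infinity_on f S \<longleftrightarrow> (\<forall>r. Ck_on r f S)"

lemma C_infinity_onD: "C_infinity_on f S \<Longrightarrow> Ck_on r f S"
  by (simp add: C_infinity_on_def)

lemma C_infinity_on_has_derivative:
  "C_infinity_on f S \<Longrightarrow> x \<in> S \<Longrightarrow> (f has_derivative frechet_derivative f (at x)) (at x)"
  using C_infinity_onD[of f S "Suc 0"] Ck_on_Suc_has_derivative by blast

lemma C_infinity_on_continuous_on: "C_infinity_on f S \<Longrightarrow> continuous_on S f"
  using C_infinity_onD Ck_on_imp_continuous_on by blast

lemma C_infinity_on_subset: "C_infinity_on f S \<Longrightarrow> T \<subseteq> S \<Longrightarrow> C_infinity_on f T"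
  by (auto simp: C_infinity_on_def intro: Ck_on_subset)

text \<open>If \<open>g\<close> is \<open>C\<^sup>r\<close>, then its derivative, the inverse of \<open>D f\<close> at \<open>g y\<close>, is \<open>C\<^sup>r\<close> as well by
  Cramer's rule, so \<open>g\<close> is \<open>C\<^sup>r\<^sup>+\<^sup>1\<close>.\<close>

lemma C_infinity_inverse_function:
  fixes f :: "'m::finite rvec \<Rightarrow> 'm rvec"
  assumes f: "C_infinity_on f UNIV" and D: "(f has_derivative id) (at x0)"
  obtains U V g where "open U" "x0 \<in> U" "open V" "f ` U = V" "\<And>x. x \<in> U \<Longrightarrow> g (f x) = x"
    "g ` V = U" "\<And>y. y \<in> V \<Longrightarrow> f (g y) = y" "C_infinity_on g V"
proof -
  let ?D = "\<lambda>x. frechet_derivative f (at x)"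
  have Df: "(f has_derivative ?D x) (at x)" for x
    using C_infinity_on_has_derivative[OF f] by simp
  then have bl: "bounded_linear (?D x)" for x
    by (rule has_derivative_bounded_linear)
  have D0: "?D x0 = id"
    using has_derivative_unique[OF Df D] .
  have D_smooth: "Ck_on r (\<lambda>x. ?D x v) UNIV" for r v
    using C_infinity_onD[OF f, of "Suc r"] by simp
  \<comment> \<open>In finite dimension, continuity of the derivative as an operator follows from
    its continuity on each vector.\<close>
  have *: "continuous_on UNIV (\<lambda>x. Blinfun (?D x))"
    by (rule continuous_on_blinfun_componentwise)
      (use bl D_smooth[of 0] in \<open>simp add: bounded_linear_Blinfun_apply\<close>)
  have app: "blinfun_apply (Blinfun (?D x)) = ?D x" for x
    using bl by (simp add: bounded_linear_Blinfun_apply)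
  obtain U V g g' where U: "open U" "x0 \<in> U" "open V" "homeomorphism U V f g"
    and g': "\<And>y. y \<in> V \<Longrightarrow> (g has_derivative (g' y)) (at y)"
      "\<And>y. y \<in> V \<Longrightarrow> g' y = inv (?D (g y))" "\<And>y. y \<in> V \<Longrightarrow> bij (?D (g y))"
    by (rule inverse_function_theorem[OF open_UNIV _ *, of f x0 "id_blinfun"])
      (use Df D0 in \<open>auto simp: app id_def bounded_linear_Blinfun_apply[OF bounded_linear_ident] intro!: blinfun_eqI\<close>)
  let ?A = "\<lambda>y. matrix (?D (g y))"
  have A: "?A y *v v = ?D (g y) v" for y v
    using bl bounded_linear.linear by (intro matrix_works) (auto simp: linear_matrix_vector_mul_eq)
  have detA: "det (?A y) \<noteq> 0" if "y \<in> V" for y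
    using g'(3)[OF that] bl[of "g y"] bounded_linear.linear
    by (metis bij_is_inj det_nz_iff_inj)
  have "Ck_on r g V" for r
  proof (induction r)
    case 0
    then show ?case using U by (auto simp: homeomorphism_def)
  next
    case (Suc r)
    show ?case
    proof (rule Ck_on_Suc_intro[OF U(3) g'(1)])
      fix v
      have "Ck_on r (\<lambda>y. ?D (g y) w) V" for w
        by (rule Ck_on_compose[OF U(3) open_UNIV D_smooth Suc]) auto
      then have "Ck_on r ?A V"
        unfolding matrix_def by (intro Ck_on_vec_lambda Ck_on_vec_nth U(3))
      then show "Ck_on r (\<lambda>y. g' y v) V"
      proof (rule Ck_on_matrix_solution[OF U(3) _ detA])
        show "?A y *v g' y v = v" if "y \<in> V" for y
          unfolding A g'(2)[OF that] using g'(3)[OF that] by (simp add: bij_is_surj surj_f_inv_f)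
      qed
    qed
  qed
  then show thesis
    using U that[of U V g] by (auto simp: homeomorphism_def C_infinity_on_def)
qed

section \<open>The matrix exponential\<close>

lemma bounded_bilinear_matrix_mult:
  "bounded_bilinear ((**) :: 'n::finite rmat \<Rightarrow> 'n rmat \<Rightarrow> 'n rmat)"
proof -
  have "bilinear ((**) :: 'n rmat \<Rightarrow> 'n rmat \<Rightarrow> 'n rmat)"
    unfolding bilinear_def
    by (auto intro!: linearI simp: vec_eq_iff matrix_matrix_mult_def sum.distrib sum_distrib_left
        algebra_simps)
  then show ?thesis by (simp add: bilinear_conv_bounded_bilinear)
qed

lemmas bounded_linear_matrix_mult_left = bounded_bilinear.bounded_linear_left[OF bounded_bilinear_matrix_mult]
lemmas bounded_linear_matrix_mult_right = bounded_bilinear.bounded_linear_right[OF bounded_bilinear_matrix_mult]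
lemmas Ck_on_matrix_mult = Ck_on_bilinear[OF _ bounded_bilinear_matrix_mult]
lemmas matrix_mult_algebra =
  bounded_bilinear.add_left[OF bounded_bilinear_matrix_mult]
  bounded_bilinear.add_right[OF bounded_bilinear_matrix_mult]
  bounded_bilinear.diff_left[OF bounded_bilinear_matrix_mult]
  bounded_bilinear.diff_right[OF bounded_bilinear_matrix_mult]
  bounded_bilinear.minus_left[OF bounded_bilinear_matrix_mult]
  bounded_bilinear.minus_right[OF bounded_bilinear_matrix_mult]
  bounded_bilinear.scaleR_left[OF bounded_bilinear_matrix_mult]
  bounded_bilinear.scaleR_right[OF bounded_bilinear_matrix_mult]
  bounded_bilinear.zero_left[OF bounded_bilinear_matrix_mult]
  bounded_bilinear.zero_right[OF bounded_bilinear_matrix_mult]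

primrec matrix_power :: "'n::finite rmat \<Rightarrow> nat \<Rightarrow> 'n rmat" where
  "matrix_power A 0 = mat 1"
| "matrix_power A (Suc m) = A ** matrix_power A m"

lemma matrix_power_commute: "matrix_power A m ** A = A ** matrix_power A m"
  by (induction m) (simp_all flip: matrix_mul_assoc)

text \<open>An entry of a product is a sum of \<open>CARD('n)\<close> terms and every entry of
  \<open>A\<close> is at most \<open>norm A\<close>, whence one factor
  \<open>CARD('n) * norm A\<close> for each power.\<close>

lemma matrix_power_component_bound:
  "\<bar>matrix_power (A :: 'n::finite rmat) m $ i $ j\<bar> \<le> (CARD('n) * norm A) ^ m"
proof (induction m arbitrary: i j)
  case 0
  show ?case by (simp add: mat_def)
next
  case (Suc m)
  have A: "\<bar>A $ i $ k\<bar> \<le> norm A" for k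
    using component_le_norm_cart[of "A $ i" k] component_le_norm_cart order_trans
      Finite_Cartesian_Product.norm_nth_le[of A i] by fastforce
  have "\<bar>matrix_power A (Suc m) $ i $ j\<bar> \<le> (\<Sum>k\<in>UNIV. \<bar>A $ i $ k * matrix_power A m $ k $ j\<bar>)"
    by (simp add: matrix_matrix_mult_def sum_abs)
  also have "\<dots> \<le> (\<Sum>k\<in>(UNIV :: 'n set). norm A * (CARD('n) * norm A) ^ m)"
    unfolding abs_mult by (intro sum_mono mult_mono A Suc) auto
  finally show ?case by (simp add: algebra_simps)
qed

text \<open>The entries are real power series in \<open>t\<close>, so convergence and termwise
  differentiation are those of one real variable.\<close>

definition matrix_exp :: "real \<Rightarrow> 'n::finite rmat \<Rightarrow> 'n rmat" where
  "matrix_exp t A = (\<chi> i j. \<Sum>m. matrix_power A m $ i $ j / fact m * t ^ m)"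

lemma summable_matrix_exp: "summable (\<lambda>m. matrix_power A m $ i $ j / fact m * t ^ m)"
  for A :: "'n::finite rmat"
proof (rule summable_comparison_test', rule summable_exp)
  fix m
  show "norm (matrix_power A m $ i $ j / fact m * t ^ m)
      \<le> inverse (fact m) * (CARD('n) * norm A * \<bar>t\<bar>) ^ m"
    using mult_right_mono[OF matrix_power_component_bound, of "\<bar>t\<bar> ^ m / fact m" A m i j]
    by (simp add: abs_mult power_abs power_mult_distrib field_simps)
qed

lemma matrix_exp_0: "matrix_exp 0 A = mat 1"
proof -
  have "(\<Sum>m. matrix_power A m $ i $ j / fact m * 0 ^ m) = mat 1 $ i $ j" for i j
    using powser_zero[of "\<lambda>m. matrix_power A m $ i $ j / fact m"] by simp
  then show ?thesis by (simp add: matrix_exp_def vec_eq_iff)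
qed

text \<open>\<open>A\<close> commutes with its powers, hence with the series. This lets the velocity
  \<open>A ** matrix_exp t A\<close> be read as a right or as a left translate of
  \<open>A\<close>.\<close>

lemma matrix_exp_commute: "A ** matrix_exp t A = matrix_exp t A ** A"
proof -
  have "(\<Sum>k\<in>UNIV. A $ i $ k * (\<Sum>m. matrix_power A m $ k $ j / fact m * t ^ m)) =
      (\<Sum>k\<in>UNIV. (\<Sum>m. matrix_power A m $ i $ k / fact m * t ^ m) * A $ k $ j)" for i j
  proof -
    have "(\<Sum>k\<in>UNIV. A $ i $ k * (\<Sum>m. matrix_power A m $ k $ j / fact m * t ^ m)) =
        (\<Sum>m. (A ** matrix_power A m) $ i $ j / fact m * t ^ m)"
      by (subst suminf_mult[OF summable_matrix_exp, symmetric],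
          subst suminf_sum[OF summable_mult[OF summable_matrix_exp], symmetric])
        (simp add: matrix_matrix_mult_def sum_divide_distrib sum_distrib_right mult.assoc)
    also have "\<dots> = (\<Sum>m. (matrix_power A m ** A) $ i $ j / fact m * t ^ m)"
      by (simp add: matrix_power_commute)
    also have "\<dots> = (\<Sum>k\<in>UNIV. (\<Sum>m. matrix_power A m $ i $ k / fact m * t ^ m) * A $ k $ j)"
      by (subst suminf_mult2[OF summable_matrix_exp],
          subst suminf_sum[OF summable_mult2[OF summable_matrix_exp], symmetric])
        (simp add: matrix_matrix_mult_def sum_divide_distrib sum_distrib_left mult_ac)
    finally show ?thesis .
  qed
  then show ?thesis
    by (simp add: vec_eq_iff matrix_matrix_mult_def[of A] matrix_matrix_mult_def[of _ A] matrix_exp_def)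
qed

lemma matrix_exp_has_vector_derivative:
  "((\<lambda>t. matrix_exp t A) has_vector_derivative A ** matrix_exp t A) (at t)"
proof -
  have "((\<lambda>t. matrix_exp t A $ i $ j) has_field_derivative (A ** matrix_exp t A) $ i $ j) (at t)"
    for i j
  proof -
    let ?c = "\<lambda>i m. matrix_power A m $ i $ j / fact m"
    have "((\<lambda>t. \<Sum>m. ?c i m * t ^ m) has_field_derivative (\<Sum>m. diffs (?c i) m * t ^ m)) (at t)"
      by (intro termdiffs_strong_converges_everywhere summable_matrix_exp)
    \<comment> \<open>The factor m+1 from differentiation cancels against (m+1)!, and one factor
      \<open>A\<close> splits off the power on the left.\<close>
    moreover have "diffs (?c i) m * t ^ m = (\<Sum>k\<in>UNIV. A $ i $ k * (?c k m * t ^ m))" for m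
    proof -
      have "diffs (?c i) m = (A ** matrix_power A m) $ i $ j / fact m"
        by (simp add: diffs_def del: of_nat_Suc)
      then show ?thesis
        by (simp add: matrix_matrix_mult_def sum_divide_distrib sum_distrib_right mult.assoc)
    qed
    moreover have "(\<Sum>m. \<Sum>k\<in>UNIV. A $ i $ k * (?c k m * t ^ m)) =
        (\<Sum>k\<in>UNIV. A $ i $ k * (\<Sum>m. ?c k m * t ^ m))"
      by (subst suminf_sum[OF summable_mult[OF summable_matrix_exp]])
        (simp only: suminf_mult[OF summable_matrix_exp])
    ultimately show ?thesis
      by (simp add: matrix_exp_def matrix_matrix_mult_def)
  qed
  then have *: "((\<lambda>t. matrix_exp t A $ i $ j) has_derivative (\<lambda>h. h * (A ** matrix_exp t A) $ i $ j)) (at t)"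
    for i j
    by (simp add: has_field_derivative_def mult.commute[of _ "(A ** matrix_exp t A) $ i $ j"])
  show ?thesis
    unfolding has_vector_derivative_def
  proof (subst has_derivative_componentwise_within, intro ballI)
    fix b :: "'a rmat" assume "b \<in> Basis"
    then obtain i j where "b = axis i (axis j 1)" by (auto simp: Basis_vec_def)
    then show "((\<lambda>t. matrix_exp t A \<bullet> b) has_derivative (\<lambda>h. (h *\<^sub>R (A ** matrix_exp t A)) \<bullet> b)) (at t)"
      using *[of i j] by (simp add: inner_axis)
  qed
qed

lemma Ck_on_matrix_exp: "open S \<Longrightarrow> Ck_on r (\<lambda>t. matrix_exp t A) S"
proof (induction r)
  case 0
  then show ?case
    using matrix_exp_has_vector_derivative[of A] 
    by (auto intro!: continuous_at_imp_continuous_on has_vector_derivative_continuous)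
next
  case (Suc r)
  show ?case
  proof (rule Ck_on_Suc_intro[OF Suc.prems])
    show "((\<lambda>t. matrix_exp t A) has_derivative (\<lambda>h. h *\<^sub>R (A ** matrix_exp t A))) (at t)" for t
      using matrix_exp_has_vector_derivative by (simp add: has_vector_derivative_def)
    show "Ck_on r (\<lambda>t. h *\<^sub>R (A ** matrix_exp t A)) S" for h
      by (intro Ck_on_scaleR Ck_on_const Ck_on_matrix_mult Suc.prems Suc.IH)
  qed
qed

section \<open>The exterior algebra\<close>

abbreviation axis_list :: "'n::finite list \<Rightarrow> 'n rvec list" where
  "axis_list \<equiv> map (\<lambda>i. axis i 1)"

definition multilinear :: "nat \<Rightarrow> ('n::finite rvec list \<Rightarrow> 'v::real_vector) \<Rightarrow> bool" where
  "multilinear k F \<longleftrightarrow> (\<forall>vs. length vs = k \<longrightarrow> (\<forall>i<k. linear (\<lambda>v. F (vs[i := v]))))"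

text \<open>This is \<open>skew_form\<close> with values in any real vector space, so that
  \<open>wedge\<close> and its composites with linear maps are instances as well.\<close>

definition alternating :: "nat \<Rightarrow> ('n::finite rvec list \<Rightarrow> 'v::real_vector) \<Rightarrow> bool" where
  "alternating k F \<longleftrightarrow> multilinear k F \<and> (\<forall>vs. length vs = k \<longrightarrow>
     (\<forall>i<k. \<forall>j<k. i \<noteq> j \<longrightarrow> F (vs[i := vs ! j, j := vs ! i]) = - F vs))"

lemma skew_form_imp_alternating: "skew_form k \<alpha> \<Longrightarrow> alternating k \<alpha>"
  by (auto simp: skew_form_def alternating_def multilinear_def)

lemma multilinear_Cons:
  assumes "multilinear (Suc k) F"
  shows "multilinear k (\<lambda>vs. F (v # vs))"
proof -
  have "linear (\<lambda>w. F (v # vs[i := w]))" if "length vs = k" "i < k" for vs i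
    using assms[unfolded multilinear_def, rule_format, of "v # vs" "Suc i"] that by simp
  then show ?thesis by (simp add: multilinear_def)
qed

lemma alternating_Cons:
  assumes "alternating (Suc k) F"
  shows "alternating k (\<lambda>vs. F (v # vs))"
proof -
  have "F (v # vs[i := vs ! j, j := vs ! i]) = - F (v # vs)"
    if "length vs = k" "i < k" "j < k" "i \<noteq> j" for vs i j
    using assms[unfolded alternating_def, THEN conjunct2, rule_format, of "v # vs" "Suc i" "Suc j"]
      that by simp
  then show ?thesis
    using assms multilinear_Cons by (auto simp: alternating_def)
qed

lemma alternating_map_linear:
  fixes f :: "'m::finite rvec \<Rightarrow> 'n::finite rvec"
  assumes "alternating k F" "linear f"
  shows "alternating k (\<lambda>vs. F (map f vs))"
  unfolding alternating_def multilinear_def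
proof safe
  fix vs :: "'m rvec list" and i assume *: "k = length vs" "i < length vs"
  have "linear (\<lambda>v. F ((map f vs)[i := v]))"
    using assms(1) * by (simp add: alternating_def multilinear_def)
  from linear_compose[OF assms(2) this] show "linear (\<lambda>v. F (map f (vs[i := v])))"
    by (simp add: o_def map_update)
next
  fix vs :: "'m rvec list" and i j assume *: "k = length vs" "i < length vs" "j < length vs" "i \<noteq> j"
  then show "F (map f (vs[i := vs ! j, j := vs ! i])) = - F (map f vs)"
    using assms(1)[unfolded alternating_def, THEN conjunct2, rule_format, of "map f vs" i j]
    by (simp add: map_update)
qed

text \<open>Induction on the list with \<open>F\<close> arbitrary: fixing a basis vector in the
  first place leaves a multilinear map of the others. The sum runs over all index lists, including
  those with repetitions, which only alternation removes.\<close>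

lemma multilinear_expand:
  fixes vs :: "'n::finite rvec list"
  assumes "multilinear (length vs) F"
  shows "F vs = (\<Sum>is | length is = length vs.
    (\<Prod>i<length vs. vs ! i $ (is ! i)) *\<^sub>R F (axis_list is))"
  using assms
proof (induction vs arbitrary: F)
  case Nil
  then show ?case by simp
next
  case (Cons v us)
  let ?L = "{is :: 'n list. length is = length us}"
  let ?c = "\<lambda>is. \<Prod>i<length us. us ! i $ (is ! i)"
  have v: "F (v # ws) = (\<Sum>i\<in>UNIV. (v $ i) *\<^sub>R F (axis i 1 # ws))" if "length ws = length us" for ws
  proof -
    have "linear (\<lambda>u. F (u # ws))"
      using Cons.prems[unfolded multilinear_def, rule_format, of "v # ws" 0] that by simp
    then have "(\<Sum>i\<in>UNIV. (v $ i) *\<^sub>R F (axis i 1 # ws)) = F ((\<Sum>i\<in>UNIV. (v $ i) *\<^sub>R axis i 1) # ws)"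
      by (simp add: linear_sum[of "\<lambda>u. F (u # ws)"] linear_scale[of "\<lambda>u. F (u # ws)"])
    then show ?thesis
      by (simp add: basis_expansion[of v, unfolded scalar_mult_eq_scaleR])
  qed
  have "F (v # us) = (\<Sum>is\<in>?L. ?c is *\<^sub>R F (v # axis_list is))"
    by (rule Cons.IH) (use Cons.prems multilinear_Cons in auto)
  also have "\<dots> = (\<Sum>is\<in>?L. \<Sum>i\<in>UNIV. (v $ i * ?c is) *\<^sub>R F (axis_list (i # is)))"
    by (simp add: v scaleR_sum_right mult.commute)
  also have "\<dots> = (\<Sum>(i, is)\<in>UNIV \<times> ?L. (v $ i * ?c is) *\<^sub>R F (axis_list (i # is)))"
    by (subst sum.swap) (simp add: sum.cartesian_product)
  also have "\<dots> = (\<Sum>is\<in>(\<lambda>(i, is). i # is) ` (UNIV \<times> ?L).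
      (\<Prod>i<length (v # us). (v # us) ! i $ (is ! i)) *\<^sub>R F (axis_list is))"
    by (subst sum.reindex) (auto simp: inj_on_def prod.lessThan_Suc_shift simp del: prod.lessThan_Suc intro!: sum.cong)
  also have "(\<lambda>(i, is). i # is) ` (UNIV \<times> ?L) = {is. length is = length (v # us)}"
    by (auto simp: length_Suc_conv image_iff)
  finally show ?case .
qed

lemma alternating_repeated:
  assumes "alternating k F" "length vs = k" "i < k" "j < k" "i \<noteq> j" "vs ! i = vs ! j"
  shows "F vs = 0"
proof -
  have "F (vs[i := vs ! j, j := vs ! i]) = - F vs"
    using assms unfolding alternating_def by blast
  moreover have "vs[i := vs ! j, j := vs ! i] = vs"
    using assms(6) by (metis list_update_id)
  ultimately have "(2 :: real) *\<^sub>R F vs = 0"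
    by (metis add.right_inverse scaleR_2)
  then show ?thesis by simp
qed

lemma permute_list_transpose:
  assumes "a < length vs" "b < length vs"
  shows "permute_list (Transposition.transpose a b) vs = vs[a := vs ! b, b := vs ! a]"
  using assms by (intro nth_equalityI)
    (auto simp: permute_list_def nth_list_update Transposition.transpose_def)

lemma permutes_eqI:
  assumes "p permutes S" "q permutes S" "\<And>i. i \<in> S \<Longrightarrow> p i = q i"
  shows "p = q"
  using assms by (metis ext permutes_not_in)

lemma alternating_permute_list:
  assumes "alternating k F" "\<sigma> permutes {..<k}" "length vs = k"
  shows "F (permute_list \<sigma> vs) = of_int (sign \<sigma>) *\<^sub>R F vs"
proof -
  have "\<forall>vs. length vs = k \<longrightarrow> F (permute_list \<sigma> vs) = of_int (sign \<sigma>) *\<^sub>R F vs"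
    using assms(2) finite_lessThan
  proof (induction rule: permutes_induct)
    case id
    then show ?case by (simp add: sign_id)
  next
    case (swap a b p)
    let ?t = "Transposition.transpose a b"
    show ?case
    proof safe
      fix vs :: "'a rvec list" assume k: "k = length vs"
      have "F (permute_list (?t \<circ> p) vs) = F (permute_list p (permute_list ?t vs))"
        using swap k by (simp add: permute_list_compose)
      also have "\<dots> = of_int (sign p) *\<^sub>R F (vs[a := vs ! b, b := vs ! a])"
        using swap k by (simp add: permute_list_transpose)
      also have "F (vs[a := vs ! b, b := vs ! a]) = - F vs"
        using assms(1) swap k unfolding alternating_def by auto
      also have "sign (?t \<circ> p) = - sign p"
        using swap by (subst sign_compose)
          (auto simp: sign_swap_id intro: permutation_swap_id permutes_imp_permutation[of "{..<k}"])
      ultimately show "F (permute_list (?t \<circ> p) vs) = of_int (sign (?t \<circ> p)) *\<^sub>R F vs"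
        by (simp del: o_apply)
    qed
  qed
  then show ?thesis using assms(3) by blast
qed

text \<open>A determinant equals that of its transpose: replacing \<open>p\<close> by its inverse
  moves the permutation from the vectors to the coordinates. In this form the vectors stay in order
  while the index list is permuted, as in \<open>multilinear_expand\<close>.\<close>

lemma wedge_nth:
  "wedge vs $ I = (if card I = length vs
     then \<Sum>p | p permutes {..<length vs}.
            of_int (sign p) * (\<Prod>i<length vs. (vs ! i) $ (sorted_list_of_set I ! p i))
     else 0)"
proof -
  let ?xs = "sorted_list_of_set I"
  have "of_int (sign (inv p)) * (\<Prod>i<length vs. (vs ! inv p i) $ (?xs ! i)) =
      of_int (sign p) * (\<Prod>i<length vs. (vs ! i) $ (?xs ! p i))"
    if "p permutes {..<length vs}" for p
  proof -
    have "sign (inv p) = sign p"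
      using that by (intro sign_inverse permutes_imp_permutation[OF finite_lessThan])
    moreover have "(\<Prod>i<length vs. (vs ! inv p i) $ (?xs ! i)) = (\<Prod>i<length vs. (vs ! i) $ (?xs ! p i))"
      by (subst prod.permute[OF that]) (simp add: permutes_inverses[OF that] o_def)
    ultimately show ?thesis by simp
  qed
  then show ?thesis
    unfolding wedge_def by (simp, subst sum_permutations_inverse) (auto intro: sum.cong)
qed

text \<open>The universal property of the exterior power, in coordinates.\<close>

lemma alternating_expand:
  fixes vs :: "'n::{finite,linorder} rvec list"
  assumes F: "alternating (length vs) F"
  shows "F vs = (\<Sum>I\<in>UNIV. (wedge vs $ I) *\<^sub>R F (axis_list (sorted_list_of_set I)))"
proof -
  let ?k = "length vs"
  let ?g = "\<lambda>is. (\<Prod>i<?k. vs ! i $ (is ! i)) *\<^sub>R F (axis_list is)"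
  let ?D = "{is :: 'n list. length is = ?k \<and> distinct is}"
  have fin: "finite {is :: 'n list. length is = m}" for m
    using finite_lists_length_eq[of "UNIV :: 'n set" m] by simp
  have D: "finite ?D"
    by (rule finite_subset[OF _ fin[of ?k]]) auto
  \<comment> \<open>The repetition-free lists with entries \<open>I\<close> are the rearrangements
    of its sorted list; alternation turns each rearrangement into a sign, and the signed sum is the
    minor of \<open>vs\<close> at \<open>I\<close>.\<close>
  have inner: "(\<Sum>is | is \<in> ?D \<and> set is = I. ?g is) =
      (wedge vs $ I) *\<^sub>R F (axis_list (sorted_list_of_set I))" if I: "card I = ?k" for I
  proof -
    let ?xs = "sorted_list_of_set I"
    have bij: "bij_betw (\<lambda>p. permute_list p ?xs) {p. p permutes {..<?k}} {is. is \<in> ?D \<and> set is = I}"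
      unfolding bij_betw_def
    proof (intro conjI inj_onI equalityI subsetI)
      fix p q assume *: "p \<in> {p. p permutes {..<?k}}" "q \<in> {p. p permutes {..<?k}}"
        and eq: "permute_list p ?xs = permute_list q ?xs"
      have "p i = q i" if "i < ?k" for i
      proof -
        have "?xs ! p i = ?xs ! q i"
          using arg_cong[OF eq, of "\<lambda>l. l ! i"] that I by (simp add: permute_list_def)
        then show ?thesis
          using permutes_in_image[of p "{..<?k}" i] permutes_in_image[of q "{..<?k}" i] * that I
          by (simp add: nth_eq_iff_index_eq)
      qed
      then show "p = q"
        using * by (auto intro!: permutes_eqI)
    next
      fix "is" assume "is \<in> (\<lambda>p. permute_list p ?xs) ` {p. p permutes {..<?k}}"
      then show "is \<in> {is. is \<in> ?D \<and> set is = I}"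
        using I by auto
    next
      fix "is" assume mem: "is \<in> {is. is \<in> ?D \<and> set is = I}"
      then have "mset is = mset ?xs"
        by (intro set_eq_iff_mset_eq_distinct[THEN iffD1]) auto
      then obtain p where "p permutes {..<length ?xs}" "permute_list p ?xs = is"
        by (rule mset_eq_permutation)
      then show "is \<in> (\<lambda>p. permute_list p ?xs) ` {p. p permutes {..<?k}}"
        using I by auto
    qed
    have "(\<Sum>is | is \<in> ?D \<and> set is = I. ?g is) = (\<Sum>p | p permutes {..<?k}. ?g (permute_list p ?xs))"
      by (rule sum.reindex_bij_betw[OF bij, symmetric])
    also have "\<dots> = (\<Sum>p | p permutes {..<?k}.
        (of_int (sign p) * (\<Prod>i<?k. vs ! i $ (?xs ! p i))) *\<^sub>R F (axis_list ?xs))"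
    proof (rule sum.cong[OF refl])
      fix p assume p: "p \<in> {p. p permutes {..<?k}}"
      have "F (axis_list (permute_list p ?xs)) = of_int (sign p) *\<^sub>R F (axis_list ?xs)"
        using alternating_permute_list[OF F, of p "axis_list ?xs"] p I by (simp add: permute_list_map)
      then show "?g (permute_list p ?xs) =
          (of_int (sign p) * (\<Prod>i<?k. vs ! i $ (?xs ! p i))) *\<^sub>R F (axis_list ?xs)"
        using I by (simp add: permute_list_def mult.commute)
    qed
    finally show ?thesis
      using I by (simp add: wedge_nth scaleR_sum_left)
  qed
  have "F vs = (\<Sum>is | length is = ?k. ?g is)"
    using F by (intro multilinear_expand) (simp add: alternating_def)
  also have "\<dots> = (\<Sum>is\<in>?D. ?g is)"
  proof (rule sum.mono_neutral_right[OF fin])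
    show "\<forall>is\<in>{is. length is = ?k} - ?D. ?g is = 0"
    proof
      fix "is" assume "is \<in> {is :: 'n list. length is = ?k} - ?D"
      then obtain i j where "length is = ?k" "i < ?k" "j < ?k" "i \<noteq> j" "is ! i = is ! j"
        by (auto simp: distinct_conv_nth)
      then show "?g is = 0"
        using alternating_repeated[OF F, of "axis_list is" i j] by simp
    qed
  qed auto
  also have "\<dots> = (\<Sum>I | card I = ?k. \<Sum>is | is \<in> ?D \<and> set is = I. ?g is)"
    by (rule sum.group[OF D, symmetric]) (auto simp: distinct_card)
  also have "\<dots> = (\<Sum>I | card I = ?k. (wedge vs $ I) *\<^sub>R F (axis_list (sorted_list_of_set I)))"
    using inner by (intro sum.cong) auto
  also have "\<dots> = (\<Sum>I\<in>UNIV. (wedge vs $ I) *\<^sub>R F (axis_list (sorted_list_of_set I)))"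
    by (rule sum.mono_neutral_left) (auto simp: wedge_nth)
  finally show ?thesis .
qed

lemma alternating_wedge: "alternating k (wedge :: 'n::{finite,linorder} rvec list \<Rightarrow> _)"
  unfolding alternating_def multilinear_def
proof safe
  fix vs :: "'n rvec list" and j assume *: "k = length vs" "j < length vs"
  have prod: "(\<Prod>i<length vs. vs[j := v] ! i $ f i) = v $ f j * (\<Prod>i\<in>{..<length vs} - {j}. vs ! i $ f i)"
    for v and f :: "nat \<Rightarrow> 'n"
    using *(2) by (subst prod.remove[of _ j]) auto
  show "linear (\<lambda>v. wedge (vs[j := v]))"
    by (rule linearI)
      (auto simp: vec_eq_iff wedge_nth prod algebra_simps sum.distrib sum_distrib_left)
next
  fix vs :: "'n rvec list" and a b
  assume *: "k = length vs" "a < length vs" "b < length vs" "a \<noteq> b"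
  let ?k = "length vs" and ?t = "Transposition.transpose a b"
  have t: "?t permutes {..<?k}"
    using * by (simp add: permutes_swap_id)
  have "wedge (permute_list ?t vs) $ I = - wedge vs $ I" for I
  proof (cases "card I = ?k")
    case True
    let ?h = "\<lambda>p. of_int (sign p) * (\<Prod>i<?k. (permute_list ?t vs ! i) $ (sorted_list_of_set I ! p i))"
    \<comment> \<open>Composing with the transposition permutes the summation range; it flips the
      sign of \<open>p\<close> and undoes the swap of the two vectors inside the product.\<close>
    have "(\<Sum>p | p permutes {..<?k}. ?h p) = (\<Sum>p | p permutes {..<?k}. ?h (p \<circ> ?t))"
      by (rule sum.reindex_bij_betw[symmetric]) (rule bij_betw_byWitness[where f' = "\<lambda>p. p \<circ> ?t"],
          use t in \<open>auto intro: permutes_compose simp: comp_assoc\<close>)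
    also have "?h (p \<circ> ?t) = - (of_int (sign p) * (\<Prod>i<?k. (vs ! i) $ (sorted_list_of_set I ! p i)))"
      if p: "p permutes {..<?k}" for p
    proof -
      have "sign (p \<circ> ?t) = - sign p"
        using p * by (subst sign_compose)
          (auto simp: sign_swap_id intro: permutation_swap_id permutes_imp_permutation[of "{..<?k}"])
      moreover have "(\<Prod>i<?k. (permute_list ?t vs ! i) $ (sorted_list_of_set I ! (p \<circ> ?t) i)) =
          (\<Prod>i<?k. (vs ! ?t i) $ (sorted_list_of_set I ! p (?t i)))"
        by (simp add: permute_list_def)
      moreover have "\<dots> = (\<Prod>i<?k. (vs ! i) $ (sorted_list_of_set I ! p i))"
        using prod.permute[OF t, of "\<lambda>i. (vs ! i) $ (sorted_list_of_set I ! p i)"]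
        by (simp add: o_def)
      ultimately show ?thesis by simp
    qed
    then have "(\<Sum>p | p permutes {..<?k}. ?h (p \<circ> ?t)) = - wedge vs $ I"
      using True by (simp add: wedge_nth sum_negf)
    finally show ?thesis
      using True by (simp add: wedge_nth)
  qed (simp add: wedge_nth)
  then show "wedge (vs[a := vs ! b, b := vs ! a]) = - wedge vs"
    using * by (simp add: vec_eq_iff permute_list_transpose)
qed

text \<open>The right-hand side is alternating in \<open>vs\<close>, so it is determined by sorted
  lists of basis vectors, and there it is the definition of \<open>ext_map\<close>.\<close>

lemma ext_map_wedge: "ext_map P (wedge vs) = wedge (map ((*v) P) vs)"
proof -
  have "alternating (length vs) (\<lambda>vs. wedge (map ((*v) P) vs))"
    by (intro alternating_map_linear alternating_wedge) simp
  from alternating_expand[OF this] show ?thesis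
    by (simp add: ext_map_def o_def)
qed

lemma linear_ext_map: "linear (ext_map P)"
  by (rule linearI) (simp_all add: ext_map_def algebra_simps sum.distrib scaleR_sum_right)

text \<open>A term of the Leibniz sum is nonzero only if the two sorted lists match up to
  \<open>p\<close>. Then they have the same elements, so \<open>J = I\<close>, and distinctness
  forces \<open>p = id\<close>.\<close>

lemma wedge_axis_list: "wedge (axis_list (sorted_list_of_set I)) = axis I 1"
  for I :: "'n::{finite,linorder} set"
proof -
  let ?xs = "sorted_list_of_set I"
  have "wedge (axis_list ?xs) $ J = axis I 1 $ J" for J
  proof (cases "card J = card I")
    case True
    let ?ys = "sorted_list_of_set J"
    let ?S = "{p. p permutes {..<card I}}"
    have "(\<Prod>i<card I. (axis (?xs ! i) 1 :: 'n rvec) $ (?ys ! p i)) =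
        (if J = I \<and> p = id then 1 else 0)" if p: "p permutes {..<card I}" for p
    proof (cases "\<forall>i<card I. ?xs ! i = ?ys ! p i")
      case True
      then have eq: "?xs = permute_list p ?ys"
        using \<open>card J = card I\<close> by (intro nth_equalityI) (auto simp: permute_list_def)
      then have "set ?xs = set ?ys"
        using p \<open>card J = card I\<close> by (metis length_sorted_list_of_set set_permute_list)
      then have "J = I" by simp
      moreover have "p i = i" if "i < card I" for i
        using True that permutes_in_image[OF p, of i] \<open>J = I\<close> nth_eq_iff_index_eq[of ?xs i "p i"]
        by simp
      then have "p = id"
        using p by (intro permutes_eqI) (auto simp: permutes_id)
      ultimately show ?thesis using True by simp
    next
      case False
      then obtain i where "i < card I" "?xs ! i \<noteq> ?ys ! p i" by blast
      then have "(\<Prod>i<card I. (axis (?xs ! i) 1 :: 'n rvec) $ (?ys ! p i)) = 0"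
        by (intro prod_zero) (auto simp: axis_def intro!: bexI[of _ i])
      moreover have "\<not> (J = I \<and> p = id)" using False by auto
      ultimately show ?thesis by simp
    qed
    then have "wedge (axis_list ?xs) $ J =
        (\<Sum>p\<in>?S. of_int (sign p) * (if J = I \<and> p = id then 1 else 0))"
      using True by (simp add: wedge_nth)
    also have "\<dots> = (if J = I then 1 else 0)"
      by (cases "J = I")
        (simp_all add: if_distrib finite_permutations sum.delta permutes_id sign_id cong: if_cong)
    finally show ?thesis by (simp add: axis_def)
  qed (auto simp: wedge_nth axis_def)
  then show ?thesis by (simp add: vec_eq_iff)
qed

lemma ext_map_mat_1: "ext_map (mat 1) \<xi> = \<xi>"
  using basis_expansion[of \<xi>]
  by (simp add: ext_map_def wedge_axis_list scalar_mult_eq_scaleR)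

lemma ext_map_mult: "ext_map (P ** Q) \<xi> = ext_map P (ext_map Q \<xi>)"
proof -
  have "ext_map P (ext_map Q \<xi>) = (\<Sum>I\<in>UNIV. (\<xi> $ I) *\<^sub>R
      ext_map P (wedge (map (\<lambda>i. Q *v axis i 1) (sorted_list_of_set I))))"
    unfolding ext_map_def[of Q] by (simp add: linear_sum[OF linear_ext_map] linear_scale[OF linear_ext_map])
  then show ?thesis
    by (simp add: ext_map_wedge ext_map_def[of "P ** Q"] o_def matrix_vector_mul_assoc)
qed

text \<open>The minor of \<open>P\<close> with rows \<open>J\<close> and columns \<open>I\<close> is
  the minor of its transpose with the roles exchanged. Consequently orthogonal matrices act
  orthogonally on the exterior algebra.\<close>

lemma inner_ext_map_left: "ext_map P \<xi> \<bullet> \<eta> = \<xi> \<bullet> ext_map (transpose P) \<eta>"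
proof -
  let ?w = "\<lambda>P I. wedge (map (\<lambda>i. P *v axis i 1) (sorted_list_of_set I))"
  have *: "?w P I $ J = ?w (transpose P) J $ I" for I J
  proof (cases "card I = card J")
    case True
    have "(\<Prod>i<card J. P $ (sorted_list_of_set J ! p i) $ (sorted_list_of_set I ! i)) =
        (\<Prod>i<card J. P $ (sorted_list_of_set J ! i) $ (sorted_list_of_set I ! inv p i))"
      if "p permutes {..<card J}" for p
      using prod.permute[OF that, of "\<lambda>i. P $ (sorted_list_of_set J ! i) $ (sorted_list_of_set I ! inv p i)"]
      by (simp add: o_def permutes_inverses[OF that])
    moreover have "sign (inv p) = sign p" if "p permutes {..<card J}" for p
      using that by (intro sign_inverse permutes_imp_permutation[OF finite_lessThan])
    ultimately show ?thesis
      using True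
      by (simp add: wedge_nth matrix_vector_mult_basis column_def transpose_def)
        (subst (2) sum_permutations_inverse, auto intro!: sum.cong)
  qed (auto simp: wedge_nth)
  have "ext_map P \<xi> \<bullet> \<eta> = (\<Sum>I\<in>UNIV. \<Sum>J\<in>UNIV. \<xi> $ I * \<eta> $ J * ?w P I $ J)"
    by (simp add: ext_map_def inner_sum_left inner_vec_def[of _ \<eta>] sum_distrib_left mult_ac)
      (subst sum.swap, rule refl)
  moreover have "\<xi> \<bullet> ext_map (transpose P) \<eta> =
      (\<Sum>J\<in>UNIV. \<Sum>I\<in>UNIV. \<xi> $ I * \<eta> $ J * ?w (transpose P) J $ I)"
    by (simp add: ext_map_def inner_sum_right inner_vec_def[of \<xi>] sum_distrib_left mult_ac)
  ultimately show ?thesis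
    using * by (subst (asm) (2) sum.swap) simp
qed

lemma inner_ext_map_orthogonal:
  "orthogonal_matrix P \<Longrightarrow> ext_map P \<xi> \<bullet> ext_map P \<eta> = \<xi> \<bullet> \<eta>"
  by (simp add: inner_ext_map_left orthogonal_matrix_def ext_map_mat_1 flip: ext_map_mult)

text \<open>A list of functions replaces a list-valued function: its length is fixed, and each entry
  has values in a Euclidean space, where \<open>Ck_on\<close> makes sense.\<close>

lemma Ck_on_wedge:
  assumes "open S" "\<And>f. f \<in> set fs \<Longrightarrow> Ck_on r f S"
  shows "Ck_on r (\<lambda>x. wedge (map (\<lambda>f. f x) fs)) S"
  unfolding wedge_def
proof (intro Ck_on_vec_lambda assms(1))
  fix I
  have "Ck_on r (\<lambda>x. \<Prod>i<length fs. map (\<lambda>f. f x) fs ! p i $ (sorted_list_of_set I ! i)) S"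
    if "p permutes {..<length fs}" for p
  proof (intro Ck_on_prod Ck_on_vec_nth assms(1))
    fix i assume "i \<in> {..<length fs}"
    then show "Ck_on r (\<lambda>x. map (\<lambda>f. f x) fs ! p i) S"
      using permutes_in_image[OF that, of i] assms(2) by simp
  qed
  then show "Ck_on r (\<lambda>x. if card I = length (map (\<lambda>f. f x) fs)
      then \<Sum>p | p permutes {..<length (map (\<lambda>f. f x) fs)}. of_int (sign p) *
        (\<Prod>i<length (map (\<lambda>f. f x) fs). map (\<lambda>f. f x) fs ! p i $ (sorted_list_of_set I ! i))
      else 0) S"
    by (cases "card I = length fs")
      (auto intro!: Ck_on_const Ck_on_sum Ck_on_mult assms(1))
qed

lemma bounded_linear_matrix_vector_mult_left: "bounded_linear (\<lambda>P. P *v v)"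
  for v :: "'n::finite rvec"
  by (rule linear_conv_bounded_linear[THEN iffD1], rule linearI)
    (simp_all add: vec_eq_iff matrix_vector_mult_def algebra_simps sum.distrib sum_distrib_left)

lemma C_infinity_wedge_image:
  fixes vs :: "'n::{finite,linorder} rvec list"
  shows "C_infinity_on (\<lambda>P. wedge (map ((*v) P) vs)) UNIV"
  unfolding C_infinity_on_def
proof
  fix r
  have "Ck_on r (\<lambda>P. wedge (map (\<lambda>f. f P) (map (\<lambda>v P. P *v v) vs))) UNIV"
    by (rule Ck_on_wedge) (auto intro!: Ck_on_bounded_linear bounded_linear_matrix_vector_mult_left)
  then show "Ck_on r (\<lambda>P. wedge (map ((*v) P) vs)) UNIV"
    by (simp add: o_def)
qed

lemma C_infinity_ext_map: "C_infinity_on (\<lambda>P. ext_map P \<xi>) UNIV"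
  unfolding C_infinity_on_def ext_map_def
proof (intro allI Ck_on_sum Ck_on_scaleR Ck_on_const open_UNIV)
  show "Ck_on r (\<lambda>P. wedge (map (\<lambda>i. P *v axis i 1) (sorted_list_of_set I))) UNIV" for r I
    using C_infinity_onD[OF C_infinity_wedge_image, of r "axis_list (sorted_list_of_set I)"]
    by (simp add: o_def)
qed

text \<open>\<open>alternating_expand\<close> exhibits the form as a fixed linear combination of the
  coordinates of the wedge, so that it is polynomial in \<open>P\<close>.\<close>

lemma C_infinity_skew_form_image:
  fixes vs :: "'n::{finite,linorder} rvec list" and \<alpha> :: "'n rvec list \<Rightarrow> real"
  assumes "skew_form (length vs) \<alpha>"
  shows "C_infinity_on (\<lambda>P. \<alpha> (map ((*v) P) vs)) UNIV"
  unfolding C_infinity_on_def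
proof
  fix r
  have "\<alpha> (map ((*v) P) vs) = (\<Sum>I\<in>UNIV.
      (wedge (map ((*v) P) vs) $ I) *\<^sub>R \<alpha> (axis_list (sorted_list_of_set I)))" for P
    using assms by (intro alternating_expand) (simp add: skew_form_imp_alternating)
  then show "Ck_on r (\<lambda>P. \<alpha> (map ((*v) P) vs)) UNIV"
    by (auto intro!: Ck_on_sum Ck_on_mult Ck_on_const Ck_on_vec_nth
        C_infinity_onD[OF C_infinity_wedge_image])
qed

section \<open>Unit simple vectors and the planes they represent\<close>

lemma linear_wedge_Cons: "linear (\<lambda>v. wedge (v # vs))"
  for vs :: "'n::{finite,linorder} rvec list"
  using alternating_wedge[of "Suc (length vs)"]
  unfolding alternating_def multilinear_def
  by (auto dest!: spec[of _ "0 # vs"] spec[of _ 0])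

lemma orthonormal_list_Cons:
  "orthonormal_list (u # B) \<longleftrightarrow> norm u = 1 \<and> (\<forall>b\<in>set B. u \<bullet> b = 0) \<and> orthonormal_list B"
proof -
  have "orthonormal_list (u # B) \<longleftrightarrow> u \<bullet> u = 1 \<and> (\<forall>j<length B. u \<bullet> B ! j = 0) \<and>
      (\<forall>i<length B. B ! i \<bullet> u = 0) \<and> orthonormal_list B"
    unfolding orthonormal_list_def by (auto simp: All_less_Suc2)
  then show ?thesis
    by (auto simp: inner_commute all_set_conv_all_nth norm_eq_1)
qed

lemma inner_matrix_vector_left: "(P *v x) \<bullet> y = x \<bullet> (transpose P *v y)"
  for P :: "'n::finite rmat"
  by (metis dot_lmul_matrix inner_commute transpose_matrix_vector)

lemma orthonormal_list_map:
  "orthogonal_matrix P \<Longrightarrow> orthonormal_list B \<Longrightarrow> orthonormal_list (map ((*v) P) B)"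
  by (simp add: orthonormal_list_def inner_matrix_vector_left orthogonal_matrix_def matrix_vector_mul_assoc)

lemma wedge_Cons_eq_0:
  assumes "v \<in> span (set B)"
  shows "wedge (v # B) = 0"
proof -
  have "subspace {v. wedge (v # B) = 0}"
    using linear_wedge_Cons linear_subspace_kernel by blast
  moreover have "wedge (B ! i # B) = 0" if "i < length B" for i
    using that alternating_repeated[OF alternating_wedge refl, of 0 "B ! i # B" "Suc i"] by simp
  then have "set B \<subseteq> {v. wedge (v # B) = 0}"
    by (auto simp: in_set_conv_nth)
  ultimately show ?thesis
    using assms span_minimal by blast
qed

lemma orthonormal_list_norm: "orthonormal_list B \<Longrightarrow> b \<in> set B \<Longrightarrow> norm b = 1"
  by (auto simp: orthonormal_list_def in_set_conv_nth norm_eq_1)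

lemma orthonormal_list_distinct: "orthonormal_list B \<Longrightarrow> distinct B"
  by (induction B) (auto simp: orthonormal_list_Cons dest: orthonormal_list_norm)

lemma orthonormal_list_pairwise_orthogonal: "orthonormal_list B \<Longrightarrow> pairwise orthogonal (set B)"
  by (induction B) (auto simp: orthonormal_list_Cons pairwise_insert orthogonal_def inner_commute)

text \<open>Some linear map \<open>f\<close> sends the list to distinct standard basis vectors; the
  induced map sends its wedge to a basis element of the exterior algebra, which is impossible if the
  wedge is zero. Independence bounds the length by the dimension, so enough basis vectors
  exist.\<close>

lemma orthonormal_list_wedge_nonzero:
  fixes C :: "'n::{finite,linorder} rvec list"
  assumes "orthonormal_list C"
  shows "wedge C \<noteq> 0"
proof
  assume 0: "wedge C = 0"
  have "0 \<notin> set C"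
    using assms orthonormal_list_norm by fastforce
  then have "independent (set C)"
    using orthonormal_list_pairwise_orthogonal[OF assms] pairwise_orthogonal_independent by blast
  then have "card (set C) \<le> CARD('n)"
    using independent_bound by fastforce
  then have "length C \<le> card (UNIV :: 'n set)"
    using orthonormal_list_distinct[OF assms] distinct_card by metis
  then obtain I :: "'n set" where I: "card I = length C"
    by (meson obtain_subset_with_card_n)
  let ?xs = "sorted_list_of_set I"
  define f :: "'n rvec \<Rightarrow> 'n rvec" where "f x = (\<Sum>i<length C. (C ! i \<bullet> x) *\<^sub>R axis (?xs ! i) 1)" for x
  have "linear f"
    by (rule linearI) (simp_all add: f_def algebra_simps inner_right_distrib sum.distrib scaleR_sum_right)
  then have f: "(*v) (matrix f) = f"
    by (auto simp: matrix_works linear_matrix_vector_mul_eq)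
  have "f (C ! j) = axis (?xs ! j) 1" if j: "j < length C" for j
  proof -
    have "f (C ! j) = (\<Sum>i<length C. if i = j then axis (?xs ! i) 1 else 0)"
      unfolding f_def using assms j by (intro sum.cong) (auto simp: orthonormal_list_def)
    then show ?thesis using j by simp
  qed
  then have "map f C = axis_list ?xs"
    using I by (intro nth_equalityI) auto
  then have "ext_map (matrix f) (wedge C) = axis I 1"
    by (simp add: ext_map_wedge f wedge_axis_list)
  moreover have "ext_map (matrix f) (wedge C) = 0"
    using 0 linear_0[OF linear_ext_map] by simp
  ultimately show False by simp
qed

text \<open>Both spans are \<open>{v. v \<and> W = 0}\<close>.\<close>

lemma span_orthonormal_wedge_subset:
  fixes B B' :: "'n::{finite,linorder} rvec list"
  assumes B: "orthonormal_list B" and eq: "wedge B = wedge B'"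
    and len: "length B = length B'"
  shows "span (set B') \<subseteq> span (set B)"
proof
  fix v assume v: "v \<in> span (set B')"
  have exp: "wedge (v # vs) = (\<Sum>I\<in>UNIV. (wedge vs $ I) *\<^sub>R wedge (v # axis_list (sorted_list_of_set I)))"
    for vs
    by (rule alternating_expand[OF alternating_Cons[OF alternating_wedge]])
  have vB: "wedge (v # B) = 0"
    using wedge_Cons_eq_0[OF v] by (simp only: exp[of B] exp[of B'] eq)
  define p where "p = (\<Sum>b\<in>set B. (b \<bullet> v) *\<^sub>R b)"
  have p: "p \<in> span (set B)"
    unfolding p_def by (auto intro: span_sum span_scale span_base)
  \<comment> \<open>\<open>p\<close> is the orthogonal projection of \<open>v\<close>. A remaining
    part, normalized, would extend \<open>B\<close> to an orthonormal list, whose wedge is nonzero;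
    yet both \<open>v\<close> and \<open>p\<close> have zero wedge with \<open>B\<close>.\<close>
  have "v = p"
  proof (rule ccontr)
    assume "v \<noteq> p"
    have "(v - p) \<bullet> b = 0" if "b \<in> set B" for b
    proof -
      have "p \<bullet> b = (\<Sum>c\<in>set B. if c = b then b \<bullet> v else 0)"
        unfolding p_def inner_sum_left
        using orthonormal_list_pairwise_orthogonal[OF B] orthonormal_list_norm[OF B] that
        by (intro sum.cong) (auto simp: pairwise_def orthogonal_def norm_eq_1)
      then show ?thesis
        using that by (simp add: inner_diff_left inner_commute[of v])
    qed
    then have "orthonormal_list ((v - p) /\<^sub>R norm (v - p) # B)"
      using B \<open>v \<noteq> p\<close> by (simp add: orthonormal_list_Cons)
    moreover have "wedge ((v - p) /\<^sub>R norm (v - p) # B) = 0"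
      using vB wedge_Cons_eq_0[OF p]
      by (simp add: linear_scale[OF linear_wedge_Cons] linear_diff[OF linear_wedge_Cons])
    ultimately show False
      using orthonormal_list_wedge_nonzero by blast
  qed
  then show "v \<in> span (set B)" using p by simp
qed

text \<open>\<open>plane\<close> collects the spans of all orthonormal lists with the given wedge;
  the point is that they coincide. A nonzero coordinate \<open>I\<close> of the wedge fixes the
  length of such a list as \<open>card I\<close>, and for equal lengths the spans were compared
  above.\<close>

lemma plane_wedge:
  fixes B :: "'n::{finite,linorder} rvec list"
  assumes "orthonormal_list B"
  shows "plane (wedge B) = span (set B)"
proof -
  have "length B' = length B" if "orthonormal_list B'" "wedge B' = wedge B" for B' :: "'n rvec list"
  proof -
    have "wedge B \<noteq> 0" using assms by (rule orthonormal_list_wedge_nonzero)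
    then obtain I where I: "wedge B $ I \<noteq> 0" by (auto simp: vec_eq_iff)
    then have "card I = length B" by (auto simp: wedge_nth split: if_splits)
    moreover have "card I = length B'"
      using I unfolding that(2)[symmetric] by (auto simp: wedge_nth split: if_splits)
    ultimately show ?thesis by simp
  qed
  then have "span (set B') \<subseteq> span (set B)" if "orthonormal_list B'" "wedge B' = wedge B" for B'
    using span_orthonormal_wedge_subset[OF assms, of B'] that by metis
  then show ?thesis
    using assms unfolding plane_def by blast
qed

lemma plane_ext_map:
  assumes P: "orthogonal_matrix P"
  shows "plane (ext_map P W) = (*v) P ` plane W"
proof -
  have sub: "(*v) P ` plane W \<subseteq> plane (ext_map P W)" if P: "orthogonal_matrix P" for P W
  proof clarify
    fix v assume "v \<in> plane W"
    then obtain B where B: "orthonormal_list B" "wedge B = W" "v \<in> span (set B)"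
      by (auto simp: plane_def)
    then have "P *v v \<in> span (set (map ((*v) P) B))"
      by (simp add: linear_span_image)
    moreover have "wedge (map ((*v) P) B) = ext_map P W"
      using B(2) by (simp flip: ext_map_wedge)
    ultimately show "P *v v \<in> plane (ext_map P W)"
      using orthonormal_list_map[OF P B(1)] unfolding plane_def by blast
  qed
  have "(*v) (transpose P) ` plane (ext_map P W) \<subseteq> plane W"
    using sub[of "transpose P" "ext_map P W"] P
    by (simp add: orthogonal_matrix_def ext_map_mat_1 flip: ext_map_mult)
  moreover have "v = P *v (transpose P *v v)" for v
    using P by (simp add: orthogonal_matrix_def matrix_vector_mul_assoc del: transpose_matrix_vector)
  ultimately have "plane (ext_map P W) \<subseteq> (*v) P ` plane W"
    by blast
  then show ?thesis using sub[OF P] by blast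
qed

section \<open>The reflection in a subspace and its conjugation action on so(n)\<close>

lemma plane_reflection_exists:
  fixes S :: "'n::finite rvec set"
  assumes "subspace S"
  obtains R :: "'n rmat" where "R ** R = mat 1" "transpose R = R"
    "\<And>x. x \<in> S \<Longrightarrow> R *v x = x" "\<And>x. x \<in> S\<^sup>\<bottom> \<Longrightarrow> R *v x = - x"
proof -
  obtain B where B: "B \<subseteq> S" "pairwise orthogonal B" "\<And>x. x \<in> B \<Longrightarrow> norm x = 1"
    "independent B" "span B = S"
    using orthonormal_basis_subspace[OF assms] by metis
  then have fin: "finite B"
    by (simp add: independent_imp_finite)
  define p where "p x = (\<Sum>b\<in>B. (b \<bullet> x) *\<^sub>R b)" for x
  define R :: "'n rmat" where "R = 2 *\<^sub>R (\<chi> i j. \<Sum>b\<in>B. b $ i * b $ j) - mat 1"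
  have R: "R *v x = 2 *\<^sub>R p x - x" for x
  proof -
    have "(\<chi> i j. \<Sum>b\<in>B. b $ i * b $ j) *v x = p x"
      unfolding p_def
      by (simp add: vec_eq_iff matrix_vector_mult_def sum_distrib_right inner_vec_def)
        (subst sum.swap, simp add: mult_ac)
    then show ?thesis
      by (simp add: R_def matrix_vector_mult_diff_rdistrib scaleR_matrix_vector_assoc[symmetric])
  qed
  have p_in: "p x \<in> S" for x
    unfolding p_def using B(5) by (metis (no_types, lifting) span_base span_scale span_sum)
  have p_id: "p x = x" if "x \<in> S" for x
    unfolding p_def
    using orthonormal_basis_expand[OF B(2) B(3) _ fin, of x] that B(5) by (simp add: inner_commute)
  have fixS: "R *v x = x" if "x \<in> S" for x
    using p_id[OF that] by (simp add: R scaleR_2)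
  have "R *v (R *v x) = x" for x
    unfolding R[of x] matrix_vector_mult_diff_distrib matrix_vector_mult_scaleR fixS[OF p_in]
    by (simp add: R)
  then have "R ** R = mat 1"
    by (simp add: matrix_eq flip: matrix_vector_mul_assoc)
  moreover have "transpose R = R"
    by (simp add: R_def transpose_def vec_eq_iff mat_def mult.commute)
  moreover have "R *v x = - x" if "x \<in> S\<^sup>\<bottom>" for x
  proof -
    have "p x = 0"
      unfolding p_def using that B(1) by (auto simp: orthogonal_comp_def orthogonal_def intro!: sum.neutral)
    then show ?thesis by (simp add: R)
  qed
  ultimately show thesis
    using that fixS by blast
qed

lemma matrix_vector_mult_minus: "(- A) *v x = - (A *v x)" "A *v (- x) = - (A *v x)"
  for A :: "'n::finite rmat"
  by (simp_all add: vec_eq_iff matrix_vector_mult_def sum_negf)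

text \<open>For symmetric \<open>R\<close>, conjugation carries the bivector of \<open>w\<close> and
  \<open>v\<close> to that of \<open>R *v w\<close> and \<open>R *v v\<close>.\<close>

lemma reflection_conj_wedge2:
  fixes R :: "'n::finite rmat"
  assumes "transpose R = R" "R *v w = w" "R *v v = - v"
  shows "R ** wedge2 w v ** R = - wedge2 w v"
proof -
  have w2: "wedge2 w v *v x = (v \<bullet> x) *\<^sub>R w - (w \<bullet> x) *\<^sub>R v" for x w v :: "'n rvec"
    by (simp add: vec_eq_iff wedge2_def matrix_vector_mult_def inner_vec_def sum_distrib_right
        sum_distrib_left algebra_simps sum_subtractf)
  have inner: "y \<bullet> (R *v x) = (R *v y) \<bullet> x" for x y
    using assms(1) by (simp add: inner_matrix_vector_left)
  show ?thesis
    by (simp add: matrix_eq matrix_vector_mult_minus w2 inner assms algebra_simps flip: matrix_vector_mul_assoc)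
qed

lemma reflection_conj_mixed_part:
  fixes R :: "'n::finite rmat"
  assumes "transpose R = R" "\<And>x. x \<in> S \<Longrightarrow> R *v x = x" "\<And>x. x \<in> S\<^sup>\<bottom> \<Longrightarrow> R *v x = - x"
    and "X \<in> mixed_part S"
  shows "R ** X ** R = - X"
proof -
  have "linear (\<lambda>X. R ** X ** R + X)"
    by (rule linearI) (simp_all add: matrix_mult_algebra algebra_simps)
  then have "subspace {X. R ** X ** R + X = 0}"
    by (rule linear_subspace_kernel)
  moreover have "{wedge2 w v |w v. w \<in> S \<and> v \<in> S\<^sup>\<bottom>} \<subseteq> {X. R ** X ** R + X = 0}"
    using assms reflection_conj_wedge2 by fastforce
  ultimately have "mixed_part S \<subseteq> {X. R ** X ** R + X = 0}"
    unfolding mixed_part_def by (intro span_minimal)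
  then show ?thesis
    using assms(4) by (auto simp: eq_neg_iff_add_eq_0)
qed

text \<open>A skew matrix preserving \<open>S\<close> preserves its orthogonal complement too, so it
  is block diagonal and commutes with the signs that define \<open>R\<close>.\<close>

lemma reflection_conj_skew:
  fixes R X :: "'n::finite rmat"
  assumes S: "subspace S" and skew: "transpose X = - X" and XS: "\<And>x. x \<in> S \<Longrightarrow> X *v x \<in> S"
    and fixS: "\<And>x. x \<in> S \<Longrightarrow> R *v x = x" and neg: "\<And>x. x \<in> S\<^sup>\<bottom> \<Longrightarrow> R *v x = - x"
  shows "R ** X ** R = X"
proof -
  have Xperp: "X *v x \<in> S\<^sup>\<bottom>" if "x \<in> S\<^sup>\<bottom>" for x
  proof -
    have "y \<bullet> (X *v x) = 0" if "y \<in> S" for y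
    proof -
      have "(X *v y) \<bullet> x = 0"
        using XS[OF that] \<open>x \<in> S\<^sup>\<bottom>\<close> by (auto simp: orthogonal_comp_def orthogonal_def)
      then show ?thesis by (simp add: inner_matrix_vector_left skew matrix_vector_mult_minus)
    qed
    then show ?thesis by (auto simp: orthogonal_comp_def orthogonal_def)
  qed
  have "(R ** X ** R) *v x = X *v x" for x
  proof -
    obtain a b where ab: "a \<in> S" "\<And>w. w \<in> S \<Longrightarrow> orthogonal b w" "x = a + b"
      using orthogonal_subspace_decomp_exists[of S x] span_eq_iff[THEN iffD2, OF S] by metis
    then have b: "b \<in> S\<^sup>\<bottom>" by (auto simp: orthogonal_comp_def orthogonal_commute)
    show ?thesis
      using ab(1) b fixS[OF XS[OF ab(1)]] neg[OF Xperp[OF b]]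
      by (simp add: ab(3) fixS neg matrix_vector_mult_minus algebra_simps flip: matrix_vector_mul_assoc)
  qed
  then show ?thesis by (simp add: matrix_eq)
qed

section \<open>Stabilizers of functions on matrices\<close>

lemma smooth_on_C_infinity:
  "C_infinity_on F T \<Longrightarrow> open T \<Longrightarrow> S \<subseteq> T \<Longrightarrow> (\<And>x. x \<in> S \<Longrightarrow> F x = f x) \<Longrightarrow> smooth_on S f"
  unfolding smooth_on_def C_infinity_on_def by blast

section \<open>The trace form and orthogonal matrices\<close>

lemma inner_matrix_mult_left: "(A ** B) \<bullet> C = B \<bullet> (transpose A ** C)"
  for A B C :: "'n::finite rmat"
proof -
  have "(A ** B) \<bullet> C = (\<Sum>i\<in>UNIV. \<Sum>j\<in>UNIV. \<Sum>k\<in>UNIV. A $ i $ k * B $ k $ j * C $ i $ j)"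
    by (simp add: inner_vec_def matrix_matrix_mult_def sum_distrib_right)
  also have "\<dots> = (\<Sum>i\<in>UNIV. \<Sum>k\<in>UNIV. \<Sum>j\<in>UNIV. A $ i $ k * B $ k $ j * C $ i $ j)"
    by (rule sum.cong[OF refl], rule sum.swap)
  also have "\<dots> = (\<Sum>k\<in>UNIV. \<Sum>i\<in>UNIV. \<Sum>j\<in>UNIV. A $ i $ k * B $ k $ j * C $ i $ j)"
    by (rule sum.swap)
  also have "\<dots> = (\<Sum>k\<in>UNIV. \<Sum>j\<in>UNIV. \<Sum>i\<in>UNIV. A $ i $ k * B $ k $ j * C $ i $ j)"
    by (rule sum.cong[OF refl], rule sum.swap)
  also have "\<dots> = B \<bullet> (transpose A ** C)"
    by (simp add: inner_vec_def matrix_matrix_mult_def transpose_def sum_distrib_left mult_ac)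
  finally show ?thesis .
qed

lemma inner_transpose: "transpose A \<bullet> transpose B = A \<bullet> B"
  for A B :: "'n::finite rmat"
  unfolding inner_vec_def transpose_def by (simp, rule sum.swap)

lemma inner_matrix_mult_right: "(B ** A) \<bullet> C = B \<bullet> (C ** transpose A)"
  for A B C :: "'n::finite rmat"
proof -
  have "(B ** A) \<bullet> C = (transpose A ** transpose B) \<bullet> transpose C"
    by (subst inner_transpose[symmetric]) (simp only: matrix_transpose_mul)
  also have "\<dots> = transpose B \<bullet> transpose (C ** transpose A)"
    by (simp only: inner_matrix_mult_left matrix_transpose_mul)
  finally show ?thesis by (simp only: inner_transpose)
qed

lemma orthogonal_matrix_mult_transpose:
  assumes "orthogonal_matrix P"
  shows "transpose P ** P = mat 1" "P ** transpose P = mat 1"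
    "transpose P ** (P ** A) = A" "P ** (transpose P ** A) = A"
    "A ** transpose P ** P = A" "A ** P ** transpose P = A"
  using assms by (simp_all add: orthogonal_matrix_def matrix_mul_assoc)
    (simp_all add: orthogonal_matrix_def flip: matrix_mul_assoc)

lemma norm_orthogonal_matrix_le:
  assumes "orthogonal_matrix (P :: 'n::finite rmat)"
  shows "norm P \<le> CARD('n)"
proof -
  have "P $ i \<bullet> P $ i = (P ** transpose P) $ i $ i" for i
    by (simp add: inner_vec_def matrix_matrix_mult_def transpose_def)
  then have "norm (P $ i) = 1" for i
    using assms by (simp add: orthogonal_matrix_def mat_def norm_eq_1)
  then show ?thesis
    using L2_set_le_sum[of UNIV "\<lambda>i. norm (P $ i)"]
    by (simp add: norm_vec_def)
qed

lemma bounded_linear_transpose: "bounded_linear (transpose :: 'n::finite rmat \<Rightarrow> 'n rmat)"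
  by (rule linear_conv_bounded_linear[THEN iffD1], rule linearI)
    (simp_all add: transpose_def vec_eq_iff)

lemma skew_if_orthogonal_curve:
  fixes X :: "'n::finite rmat"
  assumes "(\<gamma> has_vector_derivative X) (at 0)" "\<gamma> 0 = mat 1" "\<And>t::real. orthogonal_matrix (\<gamma> t)"
  shows "transpose X = - X"
proof -
  have "((\<lambda>t. transpose (\<gamma> t) ** \<gamma> t) has_vector_derivative
      transpose (\<gamma> 0) ** X + transpose X ** \<gamma> 0) (at 0)"
    using bounded_bilinear.has_vector_derivative[OF bounded_bilinear_matrix_mult
        bounded_linear.has_vector_derivative[OF bounded_linear_transpose assms(1)] assms(1)] .
  moreover have "((\<lambda>t. transpose (\<gamma> t) ** \<gamma> t) has_vector_derivative 0) (at 0)"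
    using assms(3) by (simp add: orthogonal_matrix_def)
  ultimately have "X + transpose X = 0"
    using vector_derivative_unique_at assms(2) by force
  then show ?thesis by (simp add: eq_neg_iff_add_eq_0 add.commute)
qed

lemma has_vector_derivative_compose:
  assumes "(\<gamma> has_vector_derivative v) (at t)" "(f has_derivative D) (at (\<gamma> t))"
  shows "((\<lambda>t. f (\<gamma> t)) has_vector_derivative D v) (at t)"
  using has_derivative_compose[OF assms[unfolded has_vector_derivative_def]]
  by (simp add: has_vector_derivative_def linear_scale[OF has_derivative_linear[OF assms(2)]])

text \<open>Coordinates of the second kind. The parameter \<open>z\<close> is a matrix entering only
  through its inner products with \<open>Xs\<close>; its component orthogonal to \<open>Xs\<close>
  is free to parametrize transverse directions.\<close>

definition exp_prod :: "'n::finite rmat list \<Rightarrow> 'n rmat \<Rightarrow> 'n rmat" where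
  "exp_prod Xs z = foldr (\<lambda>X P. matrix_exp (z \<bullet> X) X ** P) Xs (mat 1)"

lemma exp_prod_simps: "exp_prod [] z = mat 1"
  "exp_prod (X # Xs) z = matrix_exp (z \<bullet> X) X ** exp_prod Xs z"
  by (simp_all add: exp_prod_def)

lemma exp_prod_append: "exp_prod (Xs @ Ys) z = exp_prod Xs z ** exp_prod Ys z"
  by (induction Xs) (simp_all add: exp_prod_simps matrix_mul_assoc)

lemma exp_prod_cong:
  "(\<And>X. X \<in> set Xs \<Longrightarrow> z \<bullet> X = z' \<bullet> X) \<Longrightarrow> exp_prod Xs z = exp_prod Xs z'"
  by (induction Xs) (simp_all add: exp_prod_simps)

lemma exp_prod_0: "exp_prod Xs 0 = mat 1"
  by (induction Xs) (simp_all add: exp_prod_simps matrix_exp_0)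

lemma C_infinity_exp_prod: "C_infinity_on (exp_prod Xs) UNIV"
  unfolding C_infinity_on_def
proof
  fix r
  show "Ck_on r (exp_prod Xs) UNIV"
  proof (induction Xs)
    case Nil
    show ?case
      using Ck_on_const[OF open_UNIV, of r "mat 1 :: 'a rmat"] by (simp add: exp_prod_simps[abs_def])
  next
    case (Cons X Xs)
    have "Ck_on r (\<lambda>z. matrix_exp (z \<bullet> X) X) UNIV"
      by (rule Ck_on_compose[OF _ open_UNIV Ck_on_matrix_exp])
        (auto intro!: Ck_on_inner Ck_on_const Ck_on_ident)
    from Ck_on_matrix_mult[OF open_UNIV this Cons] show ?case
      by (simp add: exp_prod_simps[abs_def])
  qed
qed

text \<open>At \<open>0\<close> all factors are the identity, so the product rule just adds up their
  derivatives. For orthonormal \<open>Xs\<close> the result is the orthogonal projection onto their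
  span.\<close>

lemma exp_prod_has_derivative_0:
  "(exp_prod Xs has_derivative (\<lambda>z. \<Sum>X\<leftarrow>Xs. (z \<bullet> X) *\<^sub>R X)) (at 0)"
proof (induction Xs)
  case Nil
  have "exp_prod [] = (\<lambda>z. mat 1 :: 'a rmat)"
    by (auto simp: exp_prod_simps)
  then show ?case by simp
next
  case (Cons X Xs)
  have "((\<lambda>t. matrix_exp t X) has_derivative (\<lambda>h. h *\<^sub>R X)) (at ((0 :: 'a rmat) \<bullet> X))"
    using matrix_exp_has_vector_derivative[of X 0] by (simp add: has_vector_derivative_def matrix_exp_0)
  moreover have "((\<lambda>z :: 'a rmat. z \<bullet> X) has_derivative (\<lambda>z. z \<bullet> X)) (at 0)"
    by (auto intro!: derivative_eq_intros)
  ultimately have "((\<lambda>z. matrix_exp (z \<bullet> X) X) has_derivative (\<lambda>z. (z \<bullet> X) *\<^sub>R X)) (at 0)"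
    by (rule has_derivative_compose[rotated])
  from bounded_bilinear.FDERIV[OF bounded_bilinear_matrix_mult this Cons]
  have "((\<lambda>z. matrix_exp (z \<bullet> X) X ** exp_prod Xs z) has_derivative
      (\<lambda>z. (\<Sum>X\<leftarrow>Xs. (z \<bullet> X) *\<^sub>R X) + (z \<bullet> X) *\<^sub>R X)) (at 0)"
    by (simp add: matrix_exp_0 exp_prod_0)
  then show ?case by (simp add: exp_prod_simps[abs_def] add.commute)
qed

text \<open>Closure under right translation turns the common level set through \<open>mat 1\<close>
  into a group and lets derivatives be compared at different points. Orthogonality makes the group
  compact, with transposes as inverses.\<close>

locale matrix_stabilizer =
  fixes \<Phi> :: "('n::finite rmat \<Rightarrow> real) set"
  assumes differentiable: "\<phi> \<in> \<Phi> \<Longrightarrow> \<phi> differentiable (at P)"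
    and translate: "\<phi> \<in> \<Phi> \<Longrightarrow> (\<lambda>P. \<phi> (P ** Q)) \<in> \<Phi>"
    and orthogonal: "(\<And>\<phi>. \<phi> \<in> \<Phi> \<Longrightarrow> \<phi> P = \<phi> (mat 1)) \<Longrightarrow> orthogonal_matrix P"
begin

definition "grp = {P. \<forall>\<phi>\<in>\<Phi>. \<phi> P = \<phi> (mat 1)}"

text \<open>The solutions of the linearized equations at \<open>mat 1\<close>. For a general level
  set they may exceed the tangent vectors; here each of them integrates to a one-parameter
  subgroup.\<close>

definition "alg = {X. \<forall>\<phi>\<in>\<Phi>. frechet_derivative \<phi> (at (mat 1)) X = 0}"

lemma has_derivative: "\<phi> \<in> \<Phi> \<Longrightarrow> (\<phi> has_derivative frechet_derivative \<phi> (at P)) (at P)"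
  using differentiable frechet_derivative_works by blast

lemma grp_orthogonal: "P \<in> grp \<Longrightarrow> orthogonal_matrix P"
  unfolding grp_def by (auto intro: orthogonal)

lemma grp_one: "mat 1 \<in> grp"
  by (simp add: grp_def)

text \<open>Membership of \<open>P\<close> is applied to the translated function, whose value at
  \<open>mat 1\<close> is that of the original function at \<open>Q\<close>.\<close>

lemma grp_mult:
  assumes "P \<in> grp" "Q \<in> grp"
  shows "P ** Q \<in> grp"
proof -
  have "\<phi> (P ** Q) = \<phi> (mat 1)" if "\<phi> \<in> \<Phi>" for \<phi>
  proof -
    have "\<phi> (P ** Q) = \<phi> (mat 1 ** Q)"
      using assms(1) translate[OF that, of Q] unfolding grp_def by fastforce
    then show ?thesis
      using assms(2) that by (simp add: grp_def)
  qed
  then show ?thesis by (simp add: grp_def)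
qed

lemma grp_transpose:
  assumes "P \<in> grp"
  shows "transpose P \<in> grp"
proof -
  have "\<phi> (transpose P) = \<phi> (mat 1)" if "\<phi> \<in> \<Phi>" for \<phi>
  proof -
    have "\<phi> (P ** transpose P) = \<phi> (mat 1 ** transpose P)"
      using assms translate[OF that, of "transpose P"] unfolding grp_def by fastforce
    then show ?thesis
      using orthogonal_matrix_mult_transpose(2)[OF grp_orthogonal[OF assms]] by simp
  qed
  then show ?thesis by (simp add: grp_def)
qed

lemma compact_grp: "compact grp"
proof -
  have "closed {P. \<phi> P = \<phi> (mat 1)}" if "\<phi> \<in> \<Phi>" for \<phi>
  proof (rule closed_Collect_eq)
    show "continuous_on UNIV \<phi>"
      using differentiable[OF that] by (intro continuous_at_imp_continuous_on ballI differentiable_imp_continuous_within)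
  qed auto
  then have "closed (\<Inter>\<phi>\<in>\<Phi>. {P. \<phi> P = \<phi> (mat 1)})"
    by (intro closed_INT) blast
  then have "closed grp"
    by (simp add: grp_def Collect_ball_eq)
  moreover have "bounded grp"
    using norm_orthogonal_matrix_le grp_orthogonal by (auto simp: bounded_iff)
  ultimately show ?thesis by (simp add: compact_eq_bounded_closed)
qed

lemma subspace_alg: "subspace alg"
proof -
  have "linear (frechet_derivative \<phi> (at (mat 1)))" if "\<phi> \<in> \<Phi>" for \<phi>
    using has_derivative[OF that] has_derivative_linear by blast
  then show ?thesis
    by (auto simp: subspace_def alg_def linear_0 linear_add linear_scale)
qed

text \<open>Chain rule for a translated function at \<open>mat 1\<close>. As \<open>Q\<close> is any
  matrix, the right-invariant vector field of \<open>X\<close> is annihilated everywhere, so its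
  integral curves can be treated before they are known to stay in the group.\<close>

lemma frechet_derivative_right_translate:
  assumes "\<phi> \<in> \<Phi>" "X \<in> alg"
  shows "frechet_derivative \<phi> (at Q) (X ** Q) = 0"
proof -
  have "((\<lambda>P. P ** Q) has_derivative (\<lambda>X. X ** Q)) (at (mat 1))"
    by (rule bounded_linear_imp_has_derivative[OF bounded_linear_matrix_mult_left])
  moreover have "(\<phi> has_derivative frechet_derivative \<phi> (at Q)) (at (mat 1 ** Q))"
    using has_derivative[OF assms(1), of Q] by simp
  ultimately have "((\<lambda>P. \<phi> (P ** Q)) has_derivative (\<lambda>X. frechet_derivative \<phi> (at Q) (X ** Q))) (at (mat 1))"
    by (rule has_derivative_compose)
  then have "frechet_derivative (\<lambda>P. \<phi> (P ** Q)) (at (mat 1)) X = frechet_derivative \<phi> (at Q) (X ** Q)"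
    using frechet_derivative_at by metis
  then show ?thesis
    using assms translate unfolding alg_def by auto
qed

text \<open>Every defining function is constant along an integral curve of a right-invariant field.
  Stating this for curves rather than for \<open>matrix_exp\<close> also covers conjugates of
  exponentials.\<close>

lemma curve_in_grp:
  assumes "X \<in> alg" "\<gamma> 0 = mat 1" "\<And>t. (\<gamma> has_vector_derivative X ** \<gamma> t) (at t)"
  shows "\<gamma> t \<in> grp"
proof -
  have "\<phi> (\<gamma> t) = \<phi> (mat 1)" if "\<phi> \<in> \<Phi>" for \<phi>
  proof -
    have "((\<lambda>t. \<phi> (\<gamma> t)) has_vector_derivative frechet_derivative \<phi> (at (\<gamma> t)) (X ** \<gamma> t)) (at t)" for t
      by (rule has_vector_derivative_compose[OF assms(3) has_derivative[OF that]])
    then have "((\<lambda>t. \<phi> (\<gamma> t)) has_field_derivative 0) (at t)" for t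
      using frechet_derivative_right_translate[OF that assms(1)]
      by (simp add: has_real_derivative_iff_has_vector_derivative)
    then show ?thesis
      using DERIV_isconst_all[of "\<lambda>t. \<phi> (\<gamma> t)" t 0] assms(2) by simp
  qed
  then show ?thesis by (simp add: grp_def)
qed

lemma matrix_exp_in_grp: "X \<in> alg \<Longrightarrow> matrix_exp t X \<in> grp"
  by (rule curve_in_grp[OF _ matrix_exp_0 matrix_exp_has_vector_derivative])

lemma exp_prod_in_grp: "set Xs \<subseteq> alg \<Longrightarrow> exp_prod Xs z \<in> grp"
  by (induction Xs) (auto simp: exp_prod_simps grp_one intro!: grp_mult matrix_exp_in_grp)

lemma derivative_in_alg:
  assumes "(\<gamma> has_vector_derivative X) (at 0)" "\<gamma> 0 = mat 1" "\<epsilon> > 0" "\<And>t::real. \<bar>t\<bar> < \<epsilon> \<Longrightarrow> \<gamma> t \<in> grp"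
  shows "X \<in> alg"
proof -
  have "frechet_derivative \<phi> (at (mat 1)) X = 0" if "\<phi> \<in> \<Phi>" for \<phi>
  proof -
    have 1: "((\<lambda>t. \<phi> (\<gamma> t)) has_vector_derivative frechet_derivative \<phi> (at (mat 1)) X) (at 0)"
      using has_vector_derivative_compose[OF assms(1) has_derivative[OF that]] assms(2) by simp
    have "((\<lambda>t. \<phi> (\<gamma> t)) has_vector_derivative 0) (at 0)"
    proof (rule has_vector_derivative_transform_within_open[OF has_vector_derivative_const])
      show "\<phi> (mat 1) = \<phi> (\<gamma> t)" if "t \<in> {-\<epsilon><..<\<epsilon>}" for t
      proof -
        have "\<gamma> t \<in> grp"
          using that by (intro assms(4)) auto
        then show ?thesis using \<open>\<phi> \<in> \<Phi>\<close> unfolding grp_def by force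
      qed
    qed (use assms(3) in auto)
    with 1 show ?thesis
      using vector_derivative_unique_at by blast
  qed
  then show ?thesis by (simp add: alg_def)
qed

lemma alg_skew: "X \<in> alg \<Longrightarrow> transpose X = - X"
  using skew_if_orthogonal_curve[of "\<lambda>t. matrix_exp t X" X] matrix_exp_has_vector_derivative[of X 0]
    matrix_exp_in_grp grp_orthogonal by (simp add: matrix_exp_0)

lemma tangent_space_grp:
  assumes P: "P \<in> grp"
  shows "tangent_space grp P = (**) P ` alg"
proof (intro equalityI subsetI)
  fix A assume "A \<in> tangent_space grp P"
  then obtain \<epsilon> \<gamma> where \<gamma>: "\<epsilon> > 0" "\<gamma> ` {-\<epsilon><..<\<epsilon>} \<subseteq> grp" "\<gamma> 0 = P"
    "(\<gamma> has_vector_derivative A) (at (0::real))"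
    by (auto simp: tangent_space_def)
  have "transpose P ** A \<in> alg"
  proof (rule derivative_in_alg[OF _ _ \<gamma>(1)])
    show "((\<lambda>t. transpose P ** \<gamma> t) has_vector_derivative transpose P ** A) (at 0)"
      by (rule bounded_linear.has_vector_derivative[OF bounded_linear_matrix_mult_right \<gamma>(4)])
    show "transpose P ** \<gamma> 0 = mat 1"
      using \<gamma>(3) orthogonal_matrix_mult_transpose(1)[OF grp_orthogonal[OF P]] by simp
    show "transpose P ** \<gamma> t \<in> grp" if "\<bar>t\<bar> < \<epsilon>" for t
      using \<gamma>(2) that by (intro grp_mult grp_transpose P) (auto simp: abs_less_iff)
  qed
  then show "A \<in> (**) P ` alg"
    using orthogonal_matrix_mult_transpose(4)[OF grp_orthogonal[OF P], of A] by (metis imageI)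
next
  fix A assume "A \<in> (**) P ` alg"
  then obtain X where X: "X \<in> alg" "A = P ** X" by auto
  let ?\<gamma> = "\<lambda>t. P ** matrix_exp t X"
  have "(?\<gamma> has_vector_derivative A) (at 0)"
    using bounded_linear.has_vector_derivative[OF bounded_linear_matrix_mult_right
        matrix_exp_has_vector_derivative[of X 0]] X by (simp add: matrix_exp_0)
  moreover have "C_infinity_on ?\<gamma> UNIV"
    unfolding C_infinity_on_def by (intro allI Ck_on_matrix_mult Ck_on_const Ck_on_matrix_exp open_UNIV)
  then have "smooth_on {-1<..<1} ?\<gamma>"
    by (rule smooth_on_C_infinity) auto
  moreover have "?\<gamma> ` {-1<..<1} \<subseteq> grp" "?\<gamma> 0 = P"
    using P X matrix_exp_in_grp grp_mult by (auto simp: matrix_exp_0)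
  ultimately show "A \<in> tangent_space grp P"
    unfolding tangent_space_def by (intro CollectI exI[of _ 1] conjI exI[of _ ?\<gamma>]) auto
qed

text \<open>Otherwise a sequence of counterexamples \<open>Y m\<close> tends to \<open>0\<close>. A
  limit \<open>l\<close> of their unit directions is orthogonal to \<open>alg\<close>, and
  differentiating the defining equations along the sequence puts \<open>l\<close> into
  \<open>alg\<close>; so \<open>l\<close> is orthogonal to itself, although it is a unit
  vector.\<close>

lemma complement_isolated:
  obtains \<epsilon> where "\<epsilon> > 0"
    "\<And>Y. norm Y < \<epsilon> \<Longrightarrow> (\<And>X. X \<in> alg \<Longrightarrow> Y \<bullet> X = 0) \<Longrightarrow> mat 1 + Y \<in> grp \<Longrightarrow> Y = 0"
proof (rule ccontr)
  assume not: "\<not> thesis"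
  have "\<exists>Y. norm Y < 1 / Suc m \<and> (\<forall>X\<in>alg. Y \<bullet> X = 0) \<and> mat 1 + Y \<in> grp \<and> Y \<noteq> 0" for m
    using that[of "1 / Suc m"] not by fastforce
  then obtain Y where Y: "norm (Y m) < 1 / Suc m" "\<And>X. X \<in> alg \<Longrightarrow> Y m \<bullet> X = 0"
    "mat 1 + Y m \<in> grp" "Y m \<noteq> 0" for m
    by metis
  have Y0: "Y \<longlonglongrightarrow> 0"
    using Y(1) less_imp_le by (intro LIMSEQ_norm_0) fastforce
  define u where "u m = Y m /\<^sub>R norm (Y m)" for m
  have "u m \<in> sphere 0 1" for m
    using Y(4) by (simp add: u_def)
  then obtain l s where l: "l \<in> sphere 0 1" "strict_mono s" "(u \<circ> s) \<longlonglongrightarrow> l"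
    using compact_sphere[of "0 :: 'n rmat" 1] unfolding compact_def by meson
  have perp: "l \<bullet> X = 0" if "X \<in> alg" for X
  proof -
    have "(\<lambda>m. (u \<circ> s) m \<bullet> X) \<longlonglongrightarrow> l \<bullet> X"
      by (rule tendsto_inner[OF l(3) tendsto_const])
    moreover have "(u \<circ> s) m \<bullet> X = 0" for m
      using Y(2)[OF that] by (simp add: u_def)
    ultimately show ?thesis
      by (simp add: LIMSEQ_const_iff)
  qed
  have "l \<in> alg"
    unfolding alg_def
  proof safe
    fix \<phi> assume \<phi>: "\<phi> \<in> \<Phi>"
    let ?D = "frechet_derivative \<phi> (at (mat 1))"
    have D: "(\<phi> has_derivative ?D) (at (mat 1))" by (rule has_derivative[OF \<phi>])
    then have bl: "bounded_linear ?D" by (rule has_derivative_bounded_linear)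
    have "((\<lambda>h. norm (\<phi> (mat 1 + h) - \<phi> (mat 1) - ?D h) / norm h) \<longlongrightarrow> 0) (at 0)"
      using D by (simp add: has_derivative_at)
    moreover have "filterlim (\<lambda>m. Y (s m)) (at 0) sequentially"
      using LIMSEQ_subseq_LIMSEQ[OF Y0 l(2)] Y(4) by (simp add: filterlim_at o_def)
    ultimately have "(\<lambda>m. norm (\<phi> (mat 1 + Y (s m)) - \<phi> (mat 1) - ?D (Y (s m))) / norm (Y (s m))) \<longlonglongrightarrow> 0"
      by (rule filterlim_compose)
    \<comment> \<open>On the group the increment of \<phi> vanishes, so the normalized remainder of
      the first-order expansion is exactly the derivative in the direction of
      \<open>Y (s m)\<close>.\<close>
    moreover have "norm (\<phi> (mat 1 + Y (s m)) - \<phi> (mat 1) - ?D (Y (s m))) / norm (Y (s m)) =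
        \<bar>?D ((u \<circ> s) m)\<bar>" for m
    proof -
      have "\<phi> (mat 1 + Y (s m)) = \<phi> (mat 1)"
        using Y(3)[of "s m"] \<phi> unfolding grp_def by blast
      then show ?thesis
        using Y(4)[of "s m"]
        by (simp add: u_def linear_scale[OF bounded_linear.linear[OF bl]] abs_mult field_simps)
    qed
    ultimately have "(\<lambda>m. \<bar>?D ((u \<circ> s) m)\<bar>) \<longlonglongrightarrow> 0" by simp
    then have "(\<lambda>m. ?D ((u \<circ> s) m)) \<longlonglongrightarrow> 0"
      by (simp add: tendsto_rabs_zero_iff)
    moreover have "(\<lambda>m. ?D ((u \<circ> s) m)) \<longlonglongrightarrow> ?D l"
      by (rule bounded_linear.tendsto[OF bl l(3)])
    ultimately show "?D l = 0"
      using LIMSEQ_unique by blast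
  qed
  then have "l \<bullet> l = 0" by (rule perp)
  with l(1) show False by simp
qed

text \<open>The map \<open>z \<mapsto> exp (z\<^sub>1 X\<^sub>1) \<dots> exp (z\<^sub>m X\<^sub>m) (1 + z\<^sup>\<bottom>)\<close> is open at \<open>0\<close>, and \<open>z\<^sup>\<bottom> = 0\<close> as soon as its
  value is in the group and \<open>z\<close> is small.\<close>

lemma grp_near_one:
  assumes Xs: "distinct Xs" "pairwise orthogonal (set Xs)" "\<And>X. X \<in> set Xs \<Longrightarrow> norm X = 1"
    "span (set Xs) = alg" and "\<delta> > 0"
  obtains e where "e > 0" "\<And>P. P \<in> grp \<Longrightarrow> dist P (mat 1) < e \<Longrightarrow> \<exists>z. norm z < \<delta> \<and> P = exp_prod Xs z"
proof -
  obtain \<epsilon> where \<epsilon>: "\<epsilon> > 0"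
    "\<And>Y. norm Y < \<epsilon> \<Longrightarrow> (\<And>X. X \<in> alg \<Longrightarrow> Y \<bullet> X = 0) \<Longrightarrow> mat 1 + Y \<in> grp \<Longrightarrow> Y = 0"
    using complement_isolated by metis
  define p where "p z = (\<Sum>X\<in>set Xs. (z \<bullet> X) *\<^sub>R X)" for z :: "'n rmat"
  have lin_p: "linear p"
    by (rule linearI) (simp_all add: p_def algebra_simps sum.distrib scaleR_sum_right)
  then have bl_p: "bounded_linear p" by (simp add: linear_conv_bounded_linear)
  have p_perp: "(z - p z) \<bullet> X = 0" if "X \<in> alg" for z X
  proof -
    have "(z - p z) \<bullet> Y = 0" if "Y \<in> set Xs" for Y
    proof -
      have "p z \<bullet> Y = (\<Sum>X\<in>set Xs. if X = Y then z \<bullet> Y else 0)"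
        unfolding p_def inner_sum_left using Xs(2,3) that
        by (intro sum.cong) (auto simp: pairwise_def orthogonal_def norm_eq_1)
      then show ?thesis using that by (simp add: inner_diff_left)
    qed
    moreover have "subspace {Y. (z - p z) \<bullet> Y = 0}"
      by (auto simp: subspace_def inner_right_distrib)
    ultimately have "span (set Xs) \<subseteq> {Y. (z - p z) \<bullet> Y = 0}"
      by (intro span_minimal) auto
    then show ?thesis using that Xs(4) by auto
  qed
  define F where "F z = exp_prod Xs z ** (mat 1 + (z - p z))" for z
  have "isCont (\<lambda>z. norm (z - p z)) 0"
    using bl_p by (intro continuous_intros linear_continuous_at)
  then obtain \<delta>' where \<delta>': "\<delta>' > 0" "\<And>z. norm z < \<delta>' \<Longrightarrow> norm (z - p z) < \<epsilon>"
    unfolding continuous_at_eps_delta using \<open>\<epsilon> > 0\<close> linear_0[OF lin_p] by fastforce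
  let ?T = "ball 0 (min \<delta> \<delta>')"
  have contF: "continuous_on UNIV F"
    unfolding F_def
    by (intro bounded_bilinear.continuous_on[OF bounded_bilinear_matrix_mult] continuous_intros
        C_infinity_on_continuous_on[OF C_infinity_exp_prod] linear_continuous_on bl_p)
  have "((\<lambda>z. mat 1 + (z - p z)) has_derivative (\<lambda>z. z - p z)) (at 0)"
    by (auto intro!: derivative_eq_intros bounded_linear_imp_has_derivative bl_p)
  note bounded_bilinear.FDERIV[OF bounded_bilinear_matrix_mult exp_prod_has_derivative_0[of Xs] this]
  moreover have "(\<Sum>X\<leftarrow>Xs. (z \<bullet> X) *\<^sub>R X) = p z" for z
    using Xs(1) by (simp add: p_def sum_list_distinct_conv_sum_set)
  ultimately have derF: "(F has_derivative id) (at 0)"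
    by (simp add: F_def[abs_def] exp_prod_0 linear_0[OF lin_p] id_def)
  \<comment> \<open>Continuity of \<open>F\<close> and an invertible derivative at \<open>0\<close>
    already make the image of a small ball a neighbourhood of \<open>F 0\<close>.\<close>
  have "F 0 \<in> interior (F ` ?T)"
    by (rule sussmann_open_mapping[OF open_UNIV contF _ derF, of id])
      (use \<delta>' \<open>\<delta> > 0\<close> in \<open>auto simp: id_def interior_open\<close>)
  then have "mat 1 \<in> interior (F ` ?T)"
    by (simp add: F_def exp_prod_0 linear_0[OF lin_p])
  then obtain e where e: "e > 0" "ball (mat 1) e \<subseteq> F ` ?T"
    by (auto simp: mem_interior)
  show thesis
  proof (rule that[OF e(1)])
    fix P assume P: "P \<in> grp" "dist P (mat 1) < e"
    then obtain z where z: "norm z < \<delta>" "norm z < \<delta>'" "P = F z"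
      using subsetD[OF e(2), of P] by (auto simp: dist_commute)
    have E: "exp_prod Xs z \<in> grp"
      using Xs(4) by (intro exp_prod_in_grp) (metis span_superset)
    \<comment> \<open>Dividing by the exponential factor leaves a group element that differs from
      \<open>mat 1\<close> by something orthogonal to \<open>alg\<close>.\<close>
    have "mat 1 + (z - p z) = transpose (exp_prod Xs z) ** P"
      using orthogonal_matrix_mult_transpose(3)[OF grp_orthogonal[OF E]] by (simp add: z(3) F_def)
    then have "mat 1 + (z - p z) \<in> grp"
      using E P(1) grp_mult grp_transpose by metis
    then have "z - p z = 0"
      using \<epsilon>(2)[OF \<delta>'(2)[OF z(2)] p_perp] by blast
    then show "\<exists>z. norm z < \<delta> \<and> P = exp_prod Xs z"
      using z by (auto simp: F_def)
  qed
qed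

lemma orthonormal_basis_list:
  assumes "subspace (S :: 'n rmat set)"
  obtains Xs where "distinct Xs" "pairwise orthogonal (set Xs)"
    "\<And>X. X \<in> set Xs \<Longrightarrow> norm X = 1" "span (set Xs) = S"
proof -
  obtain B where B: "pairwise orthogonal B" "\<And>x. x \<in> B \<Longrightarrow> norm x = 1" "independent B" "span B = S"
    using orthonormal_basis_subspace[OF assms] by metis
  then obtain Xs where "set Xs = B" "distinct Xs"
    using finite_distinct_list independent_imp_finite by metis
  then show thesis using that B by metis
qed

section \<open>From the Lie algebra to a connected group\<close>

lemma connected_grp_induct:
  assumes conn: "connected grp" and K: "K \<subseteq> grp" "mat 1 \<in> K"
    and mult: "\<And>P Q. P \<in> K \<Longrightarrow> Q \<in> K \<Longrightarrow> P ** Q \<in> K"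
    and inv: "\<And>P. P \<in> K \<Longrightarrow> transpose P \<in> K"
    and near: "e > 0" "\<And>P. P \<in> grp \<Longrightarrow> dist P (mat 1) < e \<Longrightarrow> P \<in> K"
  shows "K = grp"
proof -
  \<comment> \<open>For orthogonal \<open>P\<close> this is the ball around \<open>mat 1\<close>
    translated to \<open>P\<close>. A point of \<open>grp\<close> and the group elements in its
    translate lie in the same coset of the subgroup \<open>K\<close>, so both \<open>K\<close> and
    its complement are relatively open.\<close>
  define N where "N P = {Q. dist (transpose P ** Q) (mat 1) < e}" for P :: "'n rmat"
  have open_N: "open (N P)" for P
  proof -
    have "continuous_on UNIV (\<lambda>Q :: 'n rmat. transpose P ** Q)"
      by (rule linear_continuous_on[OF bounded_linear_matrix_mult_right])
    then show ?thesis
      unfolding N_def by (intro open_Collect_less continuous_on_dist continuous_on_const)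
  qed
  have self: "P \<in> N P" if "P \<in> grp" for P
    using orthogonal_matrix_mult_transpose(1)[OF grp_orthogonal[OF that]] near(1) by (simp add: N_def)
  have near': "transpose P ** Q \<in> K" if "Q \<in> N P" "P \<in> grp" "Q \<in> grp" for P Q
    using that by (intro near(2) grp_mult grp_transpose) (auto simp: N_def)
  have in_K: "Q \<in> K" if "Q \<in> N P" "P \<in> K" "Q \<in> grp" for P Q
    using mult[OF that(2) near'[OF that(1) _ that(3)]] that(2) K(1)
      orthogonal_matrix_mult_transpose(4)[OF grp_orthogonal, of P Q] by auto
  have out_K: "P \<in> K" if "Q \<in> N P" "P \<in> grp" "Q \<in> K" for P Q
  proof -
    have Q: "Q \<in> grp" using that(3) K(1) by auto
    have "P = Q ** transpose (transpose P ** Q)"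
      using orthogonal_matrix_mult_transpose(4)[OF grp_orthogonal[OF Q]]
      by (simp add: matrix_transpose_mul)
    then show ?thesis
      using mult[OF that(3) inv[OF near'[OF that(1,2) Q]]] by simp
  qed
  have "K = grp \<inter> (\<Union>P\<in>K. N P)"
    using in_K self K(1) by blast
  then have "openin (top_of_set grp) K"
    using open_N openin_open by (metis open_UN)
  moreover have "grp - K = grp \<inter> (\<Union>P\<in>grp - K. N P)"
    using out_K self by blast
  then have "openin (top_of_set grp) (grp - K)"
    using open_N openin_open by (metis open_UN)
  then have "closedin (top_of_set grp) K"
    using K(1) by (simp add: closedin_def)
  ultimately show ?thesis
    using conn K(2) unfolding connected_clopen by blast
qed

text \<open>The group elements whose conjugate by \<open>R\<close> stays in \<open>grp\<close> form
  a subgroup. It contains all exponentials, since conjugating one gives an integral curve for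
  \<open>R ** X ** R\<close>; their products fill a neighbourhood of \<open>mat 1\<close>.\<close>

lemma conj_in_grp:
  assumes conn: "connected grp" and R: "R ** R = mat 1" "transpose R = R"
    and alg: "\<And>X. X \<in> alg \<Longrightarrow> R ** X ** R \<in> alg" and "P \<in> grp"
  shows "R ** P ** R \<in> grp"
proof -
  have RR: "R ** (R ** A) = A" for A
    using R(1) by (simp add: matrix_mul_assoc)
  let ?K = "{P \<in> grp. R ** P ** R \<in> grp}"
  have mult: "P ** Q \<in> ?K" if "P \<in> ?K" "Q \<in> ?K" for P Q
  proof -
    have "R ** (P ** Q) ** R = (R ** P ** R) ** (R ** Q ** R)"
      by (simp add: RR flip: matrix_mul_assoc)
    then show ?thesis using that grp_mult by simp
  qed
  have one: "mat 1 \<in> ?K"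
    using R by (simp add: grp_one)
  have exp: "matrix_exp t X \<in> ?K" if "X \<in> alg" for t X
  proof -
    have "R ** matrix_exp t X ** R \<in> grp"
    proof (rule curve_in_grp[OF alg[OF that], of "\<lambda>t. R ** matrix_exp t X ** R"])
      show "((\<lambda>t. R ** matrix_exp t X ** R) has_vector_derivative
          R ** X ** R ** (R ** matrix_exp t X ** R)) (at t)" for t
      proof -
        have "R ** X ** R ** (R ** matrix_exp t X ** R) = R ** (X ** matrix_exp t X) ** R"
          by (simp add: RR flip: matrix_mul_assoc)
        then show ?thesis
          using bounded_linear.has_vector_derivative[OF bounded_linear_matrix_mult_left[of R]
              bounded_linear.has_vector_derivative[OF bounded_linear_matrix_mult_right[of R]
                matrix_exp_has_vector_derivative[of X t]]] by simp
      qed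
    qed (simp add: matrix_exp_0 R)
    then show ?thesis using that matrix_exp_in_grp by simp
  qed
  obtain Xs where Xs: "distinct Xs" "pairwise orthogonal (set Xs)"
    "\<And>X. X \<in> set Xs \<Longrightarrow> norm X = 1" "span (set Xs) = alg"
    using orthonormal_basis_list[OF subspace_alg] by metis
  obtain e where e: "e > 0"
    "\<And>P. P \<in> grp \<Longrightarrow> dist P (mat 1) < e \<Longrightarrow> \<exists>z. norm z < 1 \<and> P = exp_prod Xs z"
    by (rule grp_near_one[OF Xs, of 1]) auto
  have "exp_prod Xs z \<in> ?K" for z
  proof -
    have *: "set Ys \<subseteq> alg \<Longrightarrow> exp_prod Ys z \<in> ?K" for Ys
    proof (induction Ys)
      case Nil
      show ?case using one by (simp add: exp_prod_simps)
    next
      case (Cons Y Ys)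
      then show ?case using mult[OF exp] by (simp add: exp_prod_simps)
    qed
    have "set Xs \<subseteq> alg" using Xs(4) span_superset by blast
    then show ?thesis by (rule *)
  qed
  then have near: "P \<in> ?K" if "P \<in> grp" "dist P (mat 1) < e" for P
    using e(2)[OF that] by blast
  have "?K = grp"
  proof (rule connected_grp_induct[OF conn _ one mult _ e(1) near])
    show "transpose P \<in> ?K" if "P \<in> ?K" for P
    proof -
      have "R ** transpose P ** R = transpose (R ** P ** R)"
        by (simp add: matrix_transpose_mul R matrix_mul_assoc)
      then show ?thesis using that grp_transpose by simp
    qed
  qed auto
  then show ?thesis using assms(5) by blast
qed

end

section \<open>Orbits of orthogonal stabilizers\<close>

lemma frechet_derivative_eqI: "(f has_derivative D) (at x) \<Longrightarrow> frechet_derivative f (at x) = D"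
  using frechet_derivative_at by metis

lemma C_infinity_bounded_linear: "bounded_linear L \<Longrightarrow> C_infinity_on L UNIV"
  by (simp add: C_infinity_on_def Ck_on_bounded_linear)

lemma orthonormal_coordinates:
  fixes Xs :: "'a::euclidean_space list"
  assumes "distinct Xs" "pairwise orthogonal (set Xs)" "\<And>X. X \<in> set Xs \<Longrightarrow> norm X = 1"
  shows "z \<in> span (set Xs) \<Longrightarrow> (\<Sum>X\<leftarrow>Xs. (z \<bullet> X) *\<^sub>R X) = z"
    and "Y \<in> set Xs \<Longrightarrow> (\<Sum>X\<leftarrow>Xs. (z \<bullet> X) *\<^sub>R X) \<bullet> Y = z \<bullet> Y"
    and "(\<Sum>X\<leftarrow>Xs. (z \<bullet> X) *\<^sub>R X) \<in> span (set Xs)"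
proof -
  have sum: "(\<Sum>X\<leftarrow>Xs. (z \<bullet> X) *\<^sub>R X) = (\<Sum>X\<in>set Xs. (z \<bullet> X) *\<^sub>R X)"
    using assms(1) by (simp add: sum_list_distinct_conv_sum_set)
  show "z \<in> span (set Xs) \<Longrightarrow> (\<Sum>X\<leftarrow>Xs. (z \<bullet> X) *\<^sub>R X) = z"
    unfolding sum by (rule orthonormal_basis_expand) (use assms in auto)
  show "(\<Sum>X\<leftarrow>Xs. (z \<bullet> X) *\<^sub>R X) \<in> span (set Xs)"
    unfolding sum by (intro span_sum span_scale span_base)
  assume Y: "Y \<in> set Xs"
  have "(\<Sum>X\<in>set Xs. (z \<bullet> X) *\<^sub>R X) \<bullet> Y = (\<Sum>X\<in>set Xs. if X = Y then z \<bullet> Y else 0)"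
    unfolding inner_sum_left using assms(2,3) Y
    by (intro sum.cong) (auto simp: pairwise_def orthogonal_def norm_eq_1)
  then show "(\<Sum>X\<leftarrow>Xs. (z \<bullet> X) *\<^sub>R X) \<bullet> Y = z \<bullet> Y"
    unfolding sum using Y by simp
qed

lemma inner_conj: "(Q ** X ** transpose Q) \<bullet> Y = X \<bullet> (transpose Q ** Y ** Q)"
  for Q X Y :: "'n::finite rmat"
proof -
  have "(Q ** X ** transpose Q) \<bullet> Y = (Q ** X) \<bullet> (Y ** Q)"
    by (subst inner_matrix_mult_right) simp
  then show ?thesis
    by (simp add: inner_matrix_mult_left matrix_mul_assoc)
qed

text \<open>\<open>\<rho>\<close> will be \<open>ext_map\<close>. It is defined on all matrices, so
  that the orbit map can be differentiated in the matrix space and a reflection outside the group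
  can act too.\<close>

locale orthogonal_orbit = matrix_stabilizer \<Phi> for \<Phi> :: "('n::finite rmat \<Rightarrow> real) set" +
  fixes \<rho> :: "'n rmat \<Rightarrow> 'm::finite rvec \<Rightarrow> 'm rvec" and W :: "'m rvec"
  assumes linear_rep: "linear (\<rho> P)"
    and rep_mult: "\<rho> (P ** Q) v = \<rho> P (\<rho> Q v)"
    and rep_one: "\<rho> (mat 1) v = v"
    and smooth_rep: "C_infinity_on (\<lambda>P. \<rho> P v) UNIV"
begin

definition "orbit = (\<lambda>P. \<rho> P W) ` grp"

definition "dorbit = frechet_derivative (\<lambda>P. \<rho> P W) (at (mat 1))"

definition "isotropy_alg = {X \<in> alg. dorbit X = 0}"

text \<open>The trace form and \<open>so_inner\<close> define the same orthogonality; the factor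
  between them reappears as the division by 2 in \<open>orbit_metric_eq\<close>.\<close>

definition "horizontal = {X \<in> alg. \<forall>Y\<in>isotropy_alg. X \<bullet> Y = 0}"

definition "orbit_metric = submersion_metric grp biinvariant_metric (\<lambda>P. \<rho> P W)"

lemma bounded_linear_rep: "bounded_linear (\<rho> P)"
  using linear_rep linear_conv_bounded_linear by blast

lemma rep_transpose:
  assumes "orthogonal_matrix P"
  shows "\<rho> (transpose P) (\<rho> P v) = v" "\<rho> P (\<rho> (transpose P) v) = v"
  using assms by (simp_all add: orthogonal_matrix_mult_transpose rep_one flip: rep_mult)

lemma Ck_on_rep:
  assumes S: "open S" and \<sigma>: "Ck_on r \<sigma> S" and v: "Ck_on r v S"
  shows "Ck_on r (\<lambda>x. \<rho> (\<sigma> x) (v x)) S"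
proof -
  have "\<rho> (\<sigma> x) (v x) = (\<Sum>b\<in>Basis. (v x \<bullet> b) *\<^sub>R \<rho> (\<sigma> x) b)" for x
    by (subst euclidean_representation[symmetric, of "v x"])
      (simp add: linear_sum[OF linear_rep] linear_scale[OF linear_rep])
  moreover have "Ck_on r (\<lambda>x. \<rho> (\<sigma> x) b) S" for b
    by (rule Ck_on_compose[OF S open_UNIV C_infinity_onD[OF smooth_rep] \<sigma>]) auto
  then have "Ck_on r (\<lambda>x. \<Sum>b\<in>Basis. (v x \<bullet> b) *\<^sub>R \<rho> (\<sigma> x) b) S"
    using v S by (intro Ck_on_sum Ck_on_scaleR Ck_on_inner Ck_on_const)
  ultimately show ?thesis by simp
qed

section \<open>The infinitesimal action and its kernel\<close>

lemma orbit_map_has_derivative_one: "((\<lambda>P. \<rho> P W) has_derivative dorbit) (at (mat 1))"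
  unfolding dorbit_def using C_infinity_on_has_derivative[OF smooth_rep] by blast

lemma linear_dorbit: "linear dorbit"
  using orbit_map_has_derivative_one has_derivative_linear by blast

lemma bounded_linear_dorbit: "bounded_linear dorbit"
  using linear_dorbit linear_conv_bounded_linear by blast

text \<open>By equivariance the orbit map is left translation by \<open>transpose P\<close>, then
  the orbit map, then \<open>\<rho> P\<close>; this carries the differential at \<open>mat 1\<close>
  to \<open>P\<close>.\<close>

lemma orbit_map_has_derivative:
  assumes "orthogonal_matrix P"
  shows "((\<lambda>P. \<rho> P W) has_derivative (\<lambda>A. \<rho> P (dorbit (transpose P ** A)))) (at P)"
proof -
  have "((\<lambda>P. \<rho> P W) has_derivative dorbit) (at (transpose P ** P))"
    using orbit_map_has_derivative_one assms by (simp add: orthogonal_matrix_def)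
  from has_derivative_compose[OF bounded_linear_imp_has_derivative[OF
        bounded_linear_matrix_mult_right[of "transpose P"]] this]
  have "((\<lambda>Q. \<rho> (transpose P ** Q) W) has_derivative (\<lambda>A. dorbit (transpose P ** A))) (at P)" .
  from bounded_linear.has_derivative[OF bounded_linear_rep[of P] this]
  show ?thesis
    using rep_transpose(2)[OF assms] by (simp add: rep_mult)
qed

lemma subspace_isotropy_alg: "subspace isotropy_alg"
  using subspace_alg linear_dorbit unfolding isotropy_alg_def subspace_def
  by (auto simp: linear_0 linear_add linear_scale)

lemma subspace_horizontal: "subspace horizontal"
  using subspace_alg unfolding horizontal_def subspace_def by (auto simp: inner_left_distrib)

lemma horizontal_alg: "X \<in> horizontal \<Longrightarrow> X \<in> alg"
  by (simp add: horizontal_def)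

lemma horizontal_part:
  assumes "X \<in> alg"
  obtains Y where "Y \<in> horizontal" "X - Y \<in> isotropy_alg" "dorbit X = dorbit Y"
proof -
  obtain a b where ab: "a \<in> span isotropy_alg" "\<And>w. w \<in> span isotropy_alg \<Longrightarrow> orthogonal b w" "X = a + b"
    using orthogonal_subspace_decomp_exists[of isotropy_alg X] by metis
  then have a: "a \<in> isotropy_alg"
    using subspace_isotropy_alg span_eq_iff by blast
  have "b = X - a" using ab(3) by simp
  then have "b \<in> alg"
    using a assms subspace_alg subspace_diff by (auto simp: isotropy_alg_def)
  then have "b \<in> horizontal"
    using ab(2) by (auto simp: horizontal_def orthogonal_def span_base)
  moreover have "dorbit X = dorbit b"
    using a by (simp add: ab(3) linear_add[OF linear_dorbit] isotropy_alg_def)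
  ultimately show thesis
    using that[of b] a ab(3) by simp
qed

lemma horizontal_isotropy_eq_0:
  assumes "X \<in> horizontal" "dorbit X = 0"
  shows "X = 0"
proof -
  have "X \<in> isotropy_alg"
    using assms by (simp add: horizontal_def isotropy_alg_def)
  then have "X \<bullet> X = 0"
    using assms(1) unfolding horizontal_def by blast
  then show ?thesis by simp
qed

lemma dorbit_inj: "X \<in> horizontal \<Longrightarrow> Y \<in> horizontal \<Longrightarrow> dorbit X = dorbit Y \<Longrightarrow> X = Y"
  using horizontal_isotropy_eq_0[of "X - Y"] subspace_diff[OF subspace_horizontal]
  by (simp add: linear_diff[OF linear_dorbit])

lemma matrix_exp_fixes:
  assumes "X \<in> isotropy_alg"
  shows "\<rho> (matrix_exp t X) W = W"
proof -
  have X: "X \<in> alg" "dorbit X = 0"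
    using assms by (auto simp: isotropy_alg_def)
  have "((\<lambda>t. \<rho> (matrix_exp t X) W) has_vector_derivative 0) (at t)" for t
  proof -
    let ?E = "matrix_exp t X"
    have E: "orthogonal_matrix ?E" using X matrix_exp_in_grp grp_orthogonal by blast
    \<comment> \<open>The velocity of the exponential, translated back to \<open>mat 1\<close> from
      the left, is still \<open>X\<close>; hence the orbit curve has velocity
      \<open>\<rho> ?E (dorbit X)\<close>, which is zero.\<close>
    have "transpose ?E ** (X ** ?E) = X"
      using orthogonal_matrix_mult_transpose(3)[OF E] by (simp add: matrix_exp_commute)
    then show ?thesis
      using has_vector_derivative_compose[OF matrix_exp_has_vector_derivative
          orbit_map_has_derivative[OF E]] X linear_0[OF linear_rep] by simp
  qed
  then have "((\<lambda>t. \<rho> (matrix_exp t X) W) has_derivative (\<lambda>h. 0)) (at t within UNIV)" for t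
    by (simp add: has_vector_derivative_def)
  then obtain c where "\<And>t. \<rho> (matrix_exp t X) W = c"
    using has_derivative_zero_constant[OF convex_UNIV] by (metis UNIV_I)
  moreover have "\<rho> (matrix_exp 0 X) W = W"
    by (simp add: matrix_exp_0 rep_one)
  ultimately show ?thesis by metis
qed

lemma exp_prod_fixes: "set Xs \<subseteq> isotropy_alg \<Longrightarrow> \<rho> (exp_prod Xs z) W = W"
  by (induction Xs) (auto simp: exp_prod_simps rep_one rep_mult matrix_exp_fixes)

lemma lie_algebra_isotropy: "lie_algebra {P \<in> grp. \<rho> P W = W} = isotropy_alg"
proof (intro equalityI subsetI)
  fix X assume "X \<in> lie_algebra {P \<in> grp. \<rho> P W = W}"
  then obtain \<epsilon> \<gamma> where \<gamma>: "\<epsilon> > 0" "\<gamma> ` {-\<epsilon><..<\<epsilon>} \<subseteq> {P \<in> grp. \<rho> P W = W}" "\<gamma> 0 = mat 1"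
    "(\<gamma> has_vector_derivative X) (at (0::real))"
    by (auto simp: tangent_space_def lie_algebra_def)
  have "X \<in> alg"
    using \<gamma>(2) by (intro derivative_in_alg[OF \<gamma>(4,3,1)]) (auto simp: image_subset_iff abs_less_iff)
  moreover have "((\<lambda>t. \<rho> (\<gamma> t) W) has_vector_derivative dorbit X) (at 0)"
    by (rule has_vector_derivative_compose[OF \<gamma>(4)]) (simp add: \<gamma>(3) orbit_map_has_derivative_one)
  moreover have "((\<lambda>t. \<rho> (\<gamma> t) W) has_vector_derivative 0) (at 0)"
  proof (rule has_vector_derivative_transform_within_open[OF has_vector_derivative_const])
    show "W = \<rho> (\<gamma> t) W" if "t \<in> {-\<epsilon><..<\<epsilon>}" for t
      using \<gamma>(2) that by force
  qed (use \<gamma>(1) in auto)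
  ultimately show "X \<in> isotropy_alg"
    using vector_derivative_unique_at by (force simp: isotropy_alg_def)
next
  fix X assume X: "X \<in> isotropy_alg"
  let ?\<gamma> = "\<lambda>t. matrix_exp t X"
  have "C_infinity_on ?\<gamma> UNIV"
    unfolding C_infinity_on_def by (intro allI Ck_on_matrix_exp open_UNIV)
  then have "smooth_on {-1<..<1} ?\<gamma>"
    by (rule smooth_on_C_infinity) auto
  moreover have "(?\<gamma> has_vector_derivative X) (at 0)"
    using matrix_exp_has_vector_derivative[of X 0] by (simp add: matrix_exp_0)
  moreover have "?\<gamma> ` {-1<..<1} \<subseteq> {P \<in> grp. \<rho> P W = W}"
    using X matrix_exp_in_grp matrix_exp_fixes by (auto simp: isotropy_alg_def)
  ultimately show "X \<in> lie_algebra {P \<in> grp. \<rho> P W = W}"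
    unfolding tangent_space_def lie_algebra_def
    by (intro CollectI exI[of _ 1] conjI exI[of _ ?\<gamma>]) (auto simp: matrix_exp_0)
qed

text \<open>These matrices act on the orbit although they may lie outside the group. The set
  contains both the reflection and the stabilizer of \<open>W\<close>, so the same facts give
  isometries and the independence of the metric from representatives. Asking for both conjugations
  makes it closed under transposition.\<close>

definition "fixing_normalizer = {Q. orthogonal_matrix Q \<and> \<rho> Q W = W \<and>
   (\<forall>P\<in>grp. Q ** P ** transpose Q \<in> grp \<and> transpose Q ** P ** Q \<in> grp)}"

lemma fixing_normalizer_transpose:
  assumes "Q \<in> fixing_normalizer"
  shows "transpose Q \<in> fixing_normalizer"
  using assms rep_transpose(1)[of Q W] unfolding fixing_normalizer_def
  by (auto simp: orthogonal_matrix_def)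

lemma fixing_normalizer_grp: "P \<in> grp \<Longrightarrow> \<rho> P W = W \<Longrightarrow> P \<in> fixing_normalizer"
  unfolding fixing_normalizer_def by (auto intro: grp_mult grp_transpose grp_orthogonal)

text \<open>As \<open>Q\<close> fixes \<open>W\<close>, conjugating a group element by
  \<open>Q\<close> amounts to applying \<open>\<rho> Q\<close> on the orbit; the second claim is the
  derivative of this identity at \<open>mat 1\<close>.\<close>

lemma fixing_normalizer_conj:
  assumes Q: "Q \<in> fixing_normalizer"
  shows "X \<in> alg \<Longrightarrow> Q ** X ** transpose Q \<in> alg"
    and "dorbit (Q ** X ** transpose Q) = \<rho> Q (dorbit X)"
proof -
  let ?c = "\<lambda>X. Q ** X ** transpose Q"
  have Q': "orthogonal_matrix Q" "\<rho> Q W = W" "\<And>P. P \<in> grp \<Longrightarrow> ?c P \<in> grp"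
    using Q by (auto simp: fixing_normalizer_def)
  have c1: "?c (mat 1) = mat 1"
    using Q'(1) by (simp add: orthogonal_matrix_def)
  have bl: "bounded_linear ?c"
    by (rule bounded_linear_compose[OF bounded_linear_matrix_mult_left bounded_linear_matrix_mult_right])
  show "?c X \<in> alg" if "X \<in> alg"
  proof (rule derivative_in_alg[where \<epsilon> = 1])
    show "((\<lambda>t. ?c (matrix_exp t X)) has_vector_derivative ?c X) (at 0)"
      using bounded_linear.has_vector_derivative[OF bl matrix_exp_has_vector_derivative[of X 0]]
      by (simp add: matrix_exp_0)
    show "?c (matrix_exp t X) \<in> grp" for t
      using Q'(3) matrix_exp_in_grp that by blast
  qed (use c1 in \<open>simp_all add: matrix_exp_0\<close>)
  have "((\<lambda>P. \<rho> (?c P) W) has_derivative (\<lambda>X. dorbit (?c X))) (at (mat 1))"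
    by (rule has_derivative_compose[OF bounded_linear_imp_has_derivative[OF bl]])
      (unfold c1, rule orbit_map_has_derivative_one)
  moreover have "\<rho> (?c P) W = \<rho> Q (\<rho> P W)" for P
    using rep_transpose(1)[OF Q'(1), of W] Q'(2) by (simp add: rep_mult)
  moreover have "((\<lambda>P. \<rho> Q (\<rho> P W)) has_derivative (\<lambda>X. \<rho> Q (dorbit X))) (at (mat 1))"
    by (rule bounded_linear.has_derivative[OF bounded_linear_rep orbit_map_has_derivative_one])
  ultimately have "(\<lambda>X. dorbit (?c X)) = (\<lambda>X. \<rho> Q (dorbit X))"
    using has_derivative_unique by (metis (no_types, lifting) ext)
  then show "dorbit (?c X) = \<rho> Q (dorbit X)" by metis
qed

lemma fixing_normalizer_horizontal:
  assumes Q: "Q \<in> fixing_normalizer" and X: "X \<in> horizontal"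
  shows "Q ** X ** transpose Q \<in> horizontal"
proof -
  have orth: "orthogonal_matrix Q" using Q by (simp add: fixing_normalizer_def)
  have "(Q ** X ** transpose Q) \<bullet> Y = 0" if "Y \<in> isotropy_alg" for Y
  proof -
    have "transpose Q ** Y ** Q \<in> isotropy_alg"
      using that fixing_normalizer_conj[OF fixing_normalizer_transpose[OF Q], of Y]
      by (simp add: isotropy_alg_def linear_0[OF linear_rep])
    then show ?thesis
      using X by (simp add: inner_conj horizontal_def)
  qed
  then show ?thesis
    using fixing_normalizer_conj(1)[OF Q] X by (simp add: horizontal_def)
qed

lemma fixing_normalizer_inner:
  assumes "Q \<in> fixing_normalizer"
  shows "(Q ** X ** transpose Q) \<bullet> (Q ** Y ** transpose Q) = X \<bullet> Y"
proof -
  have orth: "orthogonal_matrix Q" using assms by (simp add: fixing_normalizer_def)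
  show ?thesis
    by (simp add: inner_conj matrix_mul_assoc orthogonal_matrix_mult_transpose[OF orth])
qed

section \<open>The submersion metric on the orbit\<close>

lemma horizontal_space_grp:
  assumes P: "P \<in> grp"
  shows "horizontal_space grp biinvariant_metric (\<lambda>P. \<rho> P W) P = (**) P ` horizontal"
proof -
  have orth: "orthogonal_matrix P" by (rule grp_orthogonal[OF P])
  have D: "frechet_derivative (\<lambda>P. \<rho> P W) (at P) (P ** Y) = \<rho> P (dorbit Y)" for Y
    by (simp add: frechet_derivative_eqI[OF orbit_map_has_derivative[OF orth]]
        orthogonal_matrix_mult_transpose[OF orth])
  have 0: "\<rho> P v = 0 \<longleftrightarrow> v = 0" for v
    using rep_transpose(1)[OF orth, of v] linear_0[OF linear_rep] by metis
  have g: "biinvariant_metric P (P ** X) (P ** Y) = X \<bullet> Y / 2" for X Y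
    by (simp add: biinvariant_metric_def so_inner_def orthogonal_matrix_mult_transpose[OF orth])
  show ?thesis
    unfolding horizontal_space_def tangent_space_grp[OF P]
    by (auto simp: D 0 g horizontal_def isotropy_alg_def)
qed

text \<open>The definite description needs uniqueness: another representative of the point is
  \<open>P ** ?h\<close> with \<open>?h\<close> fixing \<open>W\<close>, and conjugation by
  \<open>?h\<close> carries its horizontal lifts to those at \<open>P\<close>, preserving the trace
  form.\<close>

lemma orbit_metric_eq:
  assumes P: "P \<in> grp" and X: "X \<in> horizontal" and Y: "Y \<in> horizontal"
  shows "orbit_metric (\<rho> P W) (\<rho> P (dorbit X)) (\<rho> P (dorbit Y)) = X \<bullet> Y / 2"
  unfolding orbit_metric_def submersion_metric_def
proof (rule the_equality)
  have D: "frechet_derivative (\<lambda>P. \<rho> P W) (at P) (P ** Y) = \<rho> P (dorbit Y)"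
    and g: "biinvariant_metric P (P ** X) (P ** Y) = X \<bullet> Y / 2" if "P \<in> grp" for P X Y
    using grp_orthogonal[OF that]
    by (simp_all add: biinvariant_metric_def so_inner_def orthogonal_matrix_mult_transpose
        frechet_derivative_eqI[OF orbit_map_has_derivative])
  show "\<exists>Pa\<in>grp. \<rho> Pa W = \<rho> P W \<and>
     (\<exists>A\<in>horizontal_space grp biinvariant_metric (\<lambda>P. \<rho> P W) Pa.
      \<exists>B\<in>horizontal_space grp biinvariant_metric (\<lambda>P. \<rho> P W) Pa.
        frechet_derivative (\<lambda>P. \<rho> P W) (at Pa) A = \<rho> P (dorbit X) \<and>
        frechet_derivative (\<lambda>P. \<rho> P W) (at Pa) B = \<rho> P (dorbit Y) \<and>
        X \<bullet> Y / 2 = biinvariant_metric Pa A B)"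
    using P X Y D[OF P] g[OF P]
    by (intro bexI[of _ P] conjI refl bexI[of _ "P ** X"] bexI[of _ "P ** Y"])
      (auto simp: horizontal_space_grp[OF P])
  fix c
  assume "\<exists>Pa\<in>grp. \<rho> Pa W = \<rho> P W \<and>
     (\<exists>A\<in>horizontal_space grp biinvariant_metric (\<lambda>P. \<rho> P W) Pa.
      \<exists>B\<in>horizontal_space grp biinvariant_metric (\<lambda>P. \<rho> P W) Pa.
        frechet_derivative (\<lambda>P. \<rho> P W) (at Pa) A = \<rho> P (dorbit X) \<and>
        frechet_derivative (\<lambda>P. \<rho> P W) (at Pa) B = \<rho> P (dorbit Y) \<and>
        c = biinvariant_metric Pa A B)"
  then obtain P' X' Y' where *: "P' \<in> grp" "\<rho> P' W = \<rho> P W" "X' \<in> horizontal" "Y' \<in> horizontal"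
    "\<rho> P' (dorbit X') = \<rho> P (dorbit X)" "\<rho> P' (dorbit Y') = \<rho> P (dorbit Y)" "c = X' \<bullet> Y' / 2"
    by (auto simp: horizontal_space_grp D g)
  let ?h = "transpose P ** P'"
  have h: "?h \<in> fixing_normalizer"
    using P *(1,2) rep_transpose(1)[OF grp_orthogonal[OF P]]
    by (intro fixing_normalizer_grp grp_mult grp_transpose) (simp_all add: rep_mult)
  have conj: "?h ** Z' ** transpose ?h = Z"
    if "Z' \<in> horizontal" "Z \<in> horizontal" "\<rho> P' (dorbit Z') = \<rho> P (dorbit Z)" for Z' Z
    using that fixing_normalizer_horizontal[OF h] fixing_normalizer_conj(2)[OF h]
      rep_transpose(1)[OF grp_orthogonal[OF P]]
    by (intro dorbit_inj) (simp_all add: rep_mult)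
  show "c = X \<bullet> Y / 2"
    using fixing_normalizer_inner[OF h, of X' Y'] conj[OF *(3) X *(5)] conj[OF *(4) Y *(6)] *(7)
    by simp
qed

text \<open>Near \<open>W\<close> the orbit is parametrized by the products \<open>exp (z\<^sub>1 X\<^sub>1) \<dots> exp (z\<^sub>m X\<^sub>m)\<close> with \<open>X\<^sub>i\<close> an
  orthonormal basis of the horizontal space. The parameters live in the tangent space of the orbit.\<close>

lemma local_slice:
  obtains \<sigma> \<psi> g O1 and E V :: "'m rvec set" where "open O1" "W \<in> O1" "C_infinity_on \<sigma> O1" "\<And>q. \<sigma> q \<in> grp"
    "\<And>q. q \<in> orbit \<inter> O1 \<Longrightarrow> \<rho> (\<sigma> q) W = q" "subspace E" "dim E = dim (dorbit ` horizontal)"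
    "openin (top_of_set E) V" "C_infinity_on \<psi> UNIV" "C_infinity_on g O1" "\<psi> ` V = orbit \<inter> O1"
    "\<And>x. x \<in> V \<Longrightarrow> g (\<psi> x) = x"
proof -
  obtain Xs where Xs: "distinct Xs" "pairwise orthogonal (set Xs)"
    "\<And>X. X \<in> set Xs \<Longrightarrow> norm X = 1" "span (set Xs) = horizontal"
    using orthonormal_basis_list[OF subspace_horizontal] by metis
  obtain Zs where Zs: "distinct Zs" "pairwise orthogonal (set Zs)"
    "\<And>X. X \<in> set Zs \<Longrightarrow> norm X = 1" "span (set Zs) = isotropy_alg"
    using orthonormal_basis_list[OF subspace_isotropy_alg] by metis
  have Xs_sub: "set Xs \<subseteq> horizontal" and Zs_sub: "set Zs \<subseteq> isotropy_alg"
    using Xs(4) Zs(4) span_superset by blast+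
  have XZ: "X \<bullet> Z = 0" if "X \<in> set Xs" "Z \<in> set Zs" for X Z
    using that Xs_sub Zs_sub by (auto simp: horizontal_def)
  have "span (set (Xs @ Zs)) = alg"
  proof
    show "span (set (Xs @ Zs)) \<subseteq> alg"
      using Xs_sub Zs_sub by (intro span_minimal subspace_alg) (auto simp: horizontal_def isotropy_alg_def)
    show "alg \<subseteq> span (set (Xs @ Zs))"
    proof
      fix X assume "X \<in> alg"
      then obtain Y where Y: "Y \<in> horizontal" "X - Y \<in> isotropy_alg"
        by (rule horizontal_part)
      have "Y \<in> span (set (Xs @ Zs))" "X - Y \<in> span (set (Xs @ Zs))"
        using Y Xs(4) Zs(4) span_mono[of "set Xs" "set (Xs @ Zs)"] span_mono[of "set Zs" "set (Xs @ Zs)"]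
        by auto
      then show "X \<in> span (set (Xs @ Zs))"
        using span_add by fastforce
    qed
  qed
  moreover have "distinct (Xs @ Zs)"
  proof -
    have "set Xs \<inter> set Zs = {}"
      using XZ Xs(3) by (fastforce simp: norm_eq_1)
    then show ?thesis using Xs(1) Zs(1) by simp
  qed
  moreover have "pairwise orthogonal (set (Xs @ Zs))"
    using Xs(2) Zs(2) XZ by (auto simp: pairwise_def orthogonal_def) (metis XZ inner_commute)
  moreover have "norm X = 1" if "X \<in> set (Xs @ Zs)" for X
    using that Xs(3) Zs(3) by auto
  ultimately have near: "\<exists>e>0. \<forall>P\<in>grp. dist P (mat 1) < e \<longrightarrow> (\<exists>z. norm z < \<delta> \<and> P = exp_prod (Xs @ Zs) z)"
    if "\<delta> > 0" for \<delta>
    using grp_near_one[of "Xs @ Zs" \<delta>] that by metis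
  define E where "E = dorbit ` horizontal"
  have subE: "subspace E"
    unfolding E_def by (rule linear_subspace_image[OF linear_dorbit subspace_horizontal])
  obtain l where l: "range l \<subseteq> horizontal" "linear l" "\<And>X. X \<in> horizontal \<Longrightarrow> l (dorbit X) = X"
    using linear_inj_on_left_inverse[OF linear_dorbit, of "set Xs"] dorbit_inj
    unfolding Xs(4) inj_on_def by blast
  have bl: "bounded_linear l" using l(2) linear_conv_bounded_linear by blast
  \<comment> \<open>The correction \<open>x - dorbit (l x)\<close> vanishes on \<open>E\<close>,
    where only the parametrization of the orbit remains. Off \<open>E\<close> it supplies the
    missing directions, so the derivative at \<open>0\<close> is the identity and the inverse
    function theorem applies in the ambient space.\<close>
  define \<psi> where "\<psi> x = \<rho> (exp_prod Xs (l x)) W + (x - dorbit (l x))" for x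
  have exp_l: "Ck_on r (\<lambda>x. exp_prod Xs (l x)) UNIV" for r
    by (rule Ck_on_compose[OF open_UNIV open_UNIV C_infinity_onD[OF C_infinity_exp_prod]
          Ck_on_bounded_linear[OF open_UNIV bl]]) auto
  have "Ck_on r \<psi> UNIV" for r
  proof -
    have "bounded_linear (\<lambda>x. x - dorbit (l x))"
      by (intro bounded_linear_sub bounded_linear_ident
          bounded_linear_compose[OF bounded_linear_dorbit bl])
    then show ?thesis
      unfolding \<psi>_def[abs_def]
      by (intro Ck_on_add Ck_on_rep exp_l Ck_on_const Ck_on_bounded_linear open_UNIV)
  qed
  then have \<psi>_smooth: "C_infinity_on \<psi> UNIV"
    by (simp add: C_infinity_on_def)
  have l0: "l 0 = 0" using l(2) linear_0 by blast
  have "((\<lambda>x. exp_prod Xs (l x)) has_derivative (\<lambda>x. \<Sum>X\<leftarrow>Xs. (l x \<bullet> X) *\<^sub>R X)) (at 0)"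
    by (rule has_derivative_compose[OF bounded_linear_imp_has_derivative[OF bl]])
      (simp add: l0 exp_prod_has_derivative_0)
  moreover have "(\<Sum>X\<leftarrow>Xs. (l x \<bullet> X) *\<^sub>R X) = l x" for x
    using l(1) by (intro orthonormal_coordinates Xs(1-3)) (auto simp: Xs(4))
  ultimately have "((\<lambda>x. exp_prod Xs (l x)) has_derivative l) (at 0)"
    by simp
  from has_derivative_compose[OF this, of "\<lambda>P. \<rho> P W" dorbit]
  have "((\<lambda>x. \<rho> (exp_prod Xs (l x)) W) has_derivative (\<lambda>x. dorbit (l x))) (at 0)"
    using orbit_map_has_derivative_one by (simp add: l0 exp_prod_0)
  moreover have "((\<lambda>x. x - dorbit (l x)) has_derivative (\<lambda>x. x - dorbit (l x))) (at 0)"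
    by (intro bounded_linear_imp_has_derivative bounded_linear_sub bounded_linear_ident
        bounded_linear_compose[OF bounded_linear_dorbit bl])
  ultimately have "(\<psi> has_derivative (\<lambda>x. dorbit (l x) + (x - dorbit (l x)))) (at 0)"
    unfolding \<psi>_def[abs_def] by (rule has_derivative_add)
  then have "(\<psi> has_derivative id) (at 0)"
    by (simp add: id_def)
  then obtain U V' g where U: "open U" "0 \<in> U" "open V'" "\<psi> ` U = V'"
    "\<And>x. x \<in> U \<Longrightarrow> g (\<psi> x) = x" "C_infinity_on g V'"
    using C_infinity_inverse_function[OF \<psi>_smooth] by metis
  have \<psi>0: "\<psi> 0 = W"
    by (simp add: \<psi>_def l0 exp_prod_0 rep_one linear_0[OF linear_dorbit])
  have \<psi>E: "\<psi> x = \<rho> (exp_prod Xs (l x)) W" if "x \<in> E" for x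
    using that l(3) by (auto simp: \<psi>_def E_def)
  have exp_grp: "exp_prod Xs z \<in> grp" for z
    using Xs_sub horizontal_alg by (intro exp_prod_in_grp) auto
  \<comment> \<open>The projection onto the horizontal space keeps all inner products with
    \<open>Xs\<close>, so any \<open>z\<close> may be traded for a horizontal one, that is, for a
    point \<open>dorbit (p z)\<close> of \<open>E\<close>.\<close>
  define p where "p z = (\<Sum>X\<leftarrow>Xs. (z \<bullet> X) *\<^sub>R X)" for z
  have p: "p z \<in> horizontal" "exp_prod Xs (p z) = exp_prod Xs z" for z
    using orthonormal_coordinates(2,3)[OF Xs(1-3)] Xs(4)
    by (auto simp: p_def intro: exp_prod_cong)
  have "linear p"
    using Xs(1) by (intro linearI)
      (simp_all add: p_def sum_list_distinct_conv_sum_set algebra_simps sum.distrib scaleR_sum_right)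
  then have lin: "linear (\<lambda>z. dorbit (p z))"
    using linear_compose[OF _ linear_dorbit] by (simp add: o_def)
  have "open ((\<lambda>z. dorbit (p z)) -` U)" "0 \<in> (\<lambda>z. dorbit (p z)) -` U"
    using lin linear_0[OF lin] U(2) open_vimage[OF U(1) linear_continuous_on]
    by (auto simp: linear_conv_bounded_linear)
  then obtain \<delta> where "\<delta> > 0" "ball 0 \<delta> \<subseteq> (\<lambda>z. dorbit (p z)) -` U"
    using openE by blast
  then have \<delta>: "\<delta> > 0" "\<And>z. norm z < \<delta> \<Longrightarrow> dorbit (p z) \<in> U"
    by auto
  obtain e where e: "e > 0"
    "\<And>P. P \<in> grp \<Longrightarrow> dist P (mat 1) < e \<Longrightarrow> \<exists>z. norm z < \<delta> \<and> P = exp_prod (Xs @ Zs) z"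
    using near[OF \<delta>(1)] by blast
  \<comment> \<open>A group element near \<open>mat 1\<close> is a product of exponentials with the
    isotropy factors on the right; these fix \<open>W\<close> and drop out.\<close>
  have hit: "\<exists>x\<in>E \<inter> U. \<psi> x = \<rho> P W" if P: "P \<in> grp" "dist P (mat 1) < e" for P
  proof -
    obtain z where z: "norm z < \<delta>" "P = exp_prod (Xs @ Zs) z"
      using e(2)[OF P] by blast
    have "\<psi> (dorbit (p z)) = \<rho> (exp_prod Xs z) W"
      using p l(3) \<psi>E[of "dorbit (p z)"] by (simp add: E_def)
    also have "\<dots> = \<rho> P W"
      by (simp add: z(2) exp_prod_append rep_mult exp_prod_fixes[OF Zs_sub])
    finally show ?thesis
      using p(1) \<delta>(2)[OF z(1)] by (auto simp: E_def)
  qed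
  \<comment> \<open>The group elements away from the stabilizer of \<open>W\<close>. This set is
    compact, so its orbit points form a closed set avoiding \<open>W\<close>; after removing it,
    every remaining orbit point comes from an element near the stabilizer and is reached by
    \<open>\<psi>\<close>. This is what makes the orbit embedded.\<close>
  define K where "K = grp - (\<Union>h\<in>{h \<in> grp. \<rho> h W = W}. {P. dist (P ** transpose h) (mat 1) < e})"
  have "open {P. dist (P ** transpose h) (mat 1) < e}" for h :: "'n rmat"
  proof -
    have "continuous_on UNIV (\<lambda>P :: 'n rmat. P ** transpose h)"
      by (rule linear_continuous_on[OF bounded_linear_matrix_mult_left])
    then show ?thesis
      by (intro open_Collect_less continuous_on_dist continuous_on_const)
  qed
  then have "compact K"
    unfolding K_def by (intro compact_diff compact_grp open_UN) auto
  then have closed: "closed ((\<lambda>P. \<rho> P W) ` K)"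
    using C_infinity_on_continuous_on[OF smooth_rep] continuous_on_subset
    by (intro compact_imp_closed compact_continuous_image) blast+
  have WK: "W \<notin> (\<lambda>P. \<rho> P W) ` K"
  proof
    assume "W \<in> (\<lambda>P. \<rho> P W) ` K"
    then obtain P where P: "P \<in> grp" "\<rho> P W = W" "P \<in> K" by (auto simp: K_def)
    then have "dist (P ** transpose P) (mat 1) \<ge> e" by (force simp: K_def)
    then show False
      using e(1) grp_orthogonal[OF P(1)] by (simp add: orthogonal_matrix_def)
  qed
  define O1 where "O1 = V' - (\<lambda>P. \<rho> P W) ` K"
  have O1: "open O1" "W \<in> O1" "O1 \<subseteq> V'"
    using U WK closed \<psi>0 by (auto simp: O1_def open_Diff)
  define V where "V = {x \<in> E \<inter> U. \<psi> x \<in> O1}"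
  have "openin (top_of_set E) V"
  proof -
    have "open (\<psi> -` O1)"
      using C_infinity_on_continuous_on[OF \<psi>_smooth] O1(1) open_vimage by blast
    moreover have "V = E \<inter> (U \<inter> \<psi> -` O1)" by (auto simp: V_def)
    ultimately show ?thesis using U(1) by (simp add: openin_open_Int open_Int)
  qed
  moreover have image: "\<psi> ` V = orbit \<inter> O1"
  proof
    show "\<psi> ` V \<subseteq> orbit \<inter> O1"
      using \<psi>E exp_grp by (auto simp: V_def orbit_def)
    show "orbit \<inter> O1 \<subseteq> \<psi> ` V"
    proof
      fix q assume q: "q \<in> orbit \<inter> O1"
      then obtain P where P: "P \<in> grp" "q = \<rho> P W" by (auto simp: orbit_def)
      then have "P \<notin> K" using q by (auto simp: O1_def)
      then obtain h where h: "h \<in> grp" "\<rho> h W = W" "dist (P ** transpose h) (mat 1) < e"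
        using P(1) by (auto simp: K_def)
      have "P ** transpose h \<in> grp"
        using P(1) h(1) grp_mult grp_transpose by blast
      then obtain x where x: "x \<in> E \<inter> U" "\<psi> x = \<rho> (P ** transpose h) W"
        using hit h(3) by blast
      moreover have "\<rho> (P ** transpose h) W = q"
        using rep_transpose(1)[OF grp_orthogonal[OF h(1)], of W] h(2) P(2) by (simp add: rep_mult)
      ultimately show "q \<in> \<psi> ` V"
        using q by (auto simp: V_def)
    qed
  qed
  moreover have gV: "g (\<psi> x) = x" if "x \<in> V" for x
    using U(5) that by (simp add: V_def)
  moreover have g: "C_infinity_on g O1"
    by (rule C_infinity_on_subset[OF U(6) O1(3)])
  \<comment> \<open>The section inverts the chart by \<open>g\<close>, lifts by \<open>l\<close> and
    exponentiates. Products of exponentials are in the group for any argument, so its values are in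
    \<open>grp\<close> even off the orbit.\<close>
  moreover have "C_infinity_on (\<lambda>q. exp_prod Xs (l (g q))) O1"
    unfolding C_infinity_on_def
    by (intro allI Ck_on_compose[OF O1(1) open_UNIV exp_l C_infinity_onD[OF g]]) auto
  moreover have "\<rho> (exp_prod Xs (l (g q))) W = q" if "q \<in> orbit \<inter> O1" for q
  proof -
    obtain x where x: "x \<in> V" "q = \<psi> x"
      using \<open>q \<in> orbit \<inter> O1\<close> unfolding image[symmetric] by blast
    then have "g q = x" "x \<in> E"
      using gV by (simp_all add: V_def)
    then show ?thesis
      using \<psi>E x(2) by simp
  qed
  ultimately show thesis
    using that[of O1 "\<lambda>q. exp_prod Xs (l (g q))" E V \<psi> g] O1 exp_grp subE \<psi>_smooth
    unfolding E_def by blast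
qed

section \<open>Manifold structure and tangent spaces of the orbit\<close>

lemma rep_in_orbit:
  assumes "P \<in> grp" "q \<in> orbit"
  shows "\<rho> P q \<in> orbit"
proof -
  obtain Q where "Q \<in> grp" "q = \<rho> Q W"
    using assms(2) by (auto simp: orbit_def)
  then have "\<rho> P q = \<rho> (P ** Q) W" "P ** Q \<in> grp"
    using assms(1) grp_mult by (simp_all add: rep_mult)
  then show ?thesis by (auto simp: orbit_def)
qed

lemma smooth_manifold_orbit: "smooth_manifold (dim (dorbit ` horizontal)) orbit"
proof -
  obtain \<sigma> \<psi> g O1 and E V :: "'m rvec set" where *: "open O1" "W \<in> O1" "C_infinity_on \<sigma> O1" "\<And>q. \<sigma> q \<in> grp"
    "\<And>q. q \<in> orbit \<inter> O1 \<Longrightarrow> \<rho> (\<sigma> q) W = q" "subspace E" "dim E = dim (dorbit ` horizontal)"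
    "openin (top_of_set E) V" "C_infinity_on \<psi> UNIV" "C_infinity_on g O1" "\<psi> ` V = orbit \<inter> O1"
    "\<And>x. x \<in> V \<Longrightarrow> g (\<psi> x) = x"
    by (rule local_slice) (rule that)
  note sl = *(1,2) *(6-12)
  show ?thesis
    unfolding smooth_manifold_def
  proof
    fix q assume "q \<in> orbit"
    then obtain P where P: "P \<in> grp" "q = \<rho> P W" by (auto simp: orbit_def)
    note rt = rep_transpose[OF grp_orthogonal[OF P(1)]]
    define O2 where "O2 = \<rho> (transpose P) -` O1"
    have cont: "continuous_on UNIV (\<rho> Q)" for Q
      by (rule linear_continuous_on[OF bounded_linear_rep])
    have O2: "open O2"
      unfolding O2_def by (rule open_vimage[OF sl(1) cont])
    let ?U = "orbit \<inter> O2" and ?\<phi> = "\<lambda>x. \<rho> P (\<psi> x)"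
    have image: "?\<phi> ` V = ?U"
    proof -
      have "?\<phi> ` V = \<rho> P ` (orbit \<inter> O1)"
        using sl(8) by (metis image_image)
      also have "\<dots> = ?U"
      proof (intro equalityI subsetI)
        fix y assume "y \<in> ?U"
        then show "y \<in> \<rho> P ` (orbit \<inter> O1)"
          using rep_in_orbit[OF grp_transpose[OF P(1)], of y] rt(2)[of y]
          by (intro image_eqI[of _ _ "\<rho> (transpose P) y"]) (auto simp: O2_def)
      qed (use rep_in_orbit[OF P(1)] rt in \<open>auto simp: O2_def\<close>)
      finally show ?thesis .
    qed
    have inv: "g (\<rho> (transpose P) (?\<phi> x)) = x" if "x \<in> V" for x
      using sl(9)[OF that] by (simp add: rt)
    have bij: "bij_betw ?\<phi> V ?U"
      unfolding bij_betw_def using image inv by (metis inj_on_inverseI)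
    have "C_infinity_on ?\<phi> UNIV"
      unfolding C_infinity_on_def
      by (intro allI Ck_on_linear_compose[OF open_UNIV bounded_linear_rep] C_infinity_onD[OF sl(6)])
    then have "smooth_on V ?\<phi>"
      by (rule smooth_on_C_infinity) auto
    moreover have "C_infinity_on (\<lambda>y. g (\<rho> (transpose P) y)) O2"
      unfolding C_infinity_on_def
      by (intro allI Ck_on_compose[OF O2 sl(1) C_infinity_onD[OF sl(7)]]
          Ck_on_bounded_linear[OF O2 bounded_linear_rep]) (auto simp: O2_def)
    then have "smooth_on ?U (inv_into V ?\<phi>)"
    proof (rule smooth_on_C_infinity[OF _ O2])
      fix y assume "y \<in> ?U"
      then obtain x where "x \<in> V" "y = ?\<phi> x" using image by blast
      then show "g (\<rho> (transpose P) y) = inv_into V ?\<phi> y"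
        using inv[of x] inv_into_f_f[OF bij_betw_imp_inj_on[OF bij], of x] by simp
    qed auto
    ultimately have "diffeomorphism V ?U ?\<phi>"
      using bij by (simp add: diffeomorphism_def)
    moreover have "q \<in> ?U"
      using \<open>q \<in> orbit\<close> sl(2) by (simp add: O2_def P(2) rt)
    ultimately show "\<exists>U E V \<phi>. openin (top_of_set orbit) U \<and> q \<in> U \<and> subspace (E :: 'm rvec set) \<and>
        dim E = dim (dorbit ` horizontal) \<and> openin (top_of_set E) V \<and> diffeomorphism V U \<phi>"
      using sl(3-5) O2 by (intro exI[of _ ?U] exI[of _ E] exI[of _ V] exI[of _ ?\<phi>])
        (auto simp: openin_open_Int)
  qed
qed

lemma local_section:
  assumes "q0 \<in> orbit"
  obtains \<sigma> O1 where "open O1" "q0 \<in> O1" "C_infinity_on \<sigma> O1" "\<And>q. \<sigma> q \<in> grp"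
    "\<And>q. q \<in> orbit \<inter> O1 \<Longrightarrow> \<rho> (\<sigma> q) W = q"
proof -
  obtain \<sigma> \<psi> g O1 and E V :: "'m rvec set" where sl: "open O1" "W \<in> O1" "C_infinity_on \<sigma> O1" "\<And>q. \<sigma> q \<in> grp"
    "\<And>q. q \<in> orbit \<inter> O1 \<Longrightarrow> \<rho> (\<sigma> q) W = q" "subspace E" "dim E = dim (dorbit ` horizontal)"
    "openin (top_of_set E) V" "C_infinity_on \<psi> UNIV" "C_infinity_on g O1" "\<psi> ` V = orbit \<inter> O1"
    "\<And>x. x \<in> V \<Longrightarrow> g (\<psi> x) = x"
    by (rule local_slice) (rule that)
  obtain P where P: "P \<in> grp" "q0 = \<rho> P W" using assms by (auto simp: orbit_def)
  note rt = rep_transpose[OF grp_orthogonal[OF P(1)]]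
  define O2 where "O2 = \<rho> (transpose P) -` O1"
  have O2: "open O2"
    unfolding O2_def by (rule open_vimage[OF sl(1) linear_continuous_on[OF bounded_linear_rep]])
  show thesis
  proof (rule that[OF O2, of "\<lambda>q. P ** \<sigma> (\<rho> (transpose P) q)"])
    show "q0 \<in> O2"
      using sl(2) by (simp add: O2_def P(2) rt)
    have "Ck_on r (\<lambda>q. \<sigma> (\<rho> (transpose P) q)) O2" for r
      by (rule Ck_on_compose[OF O2 sl(1) C_infinity_onD[OF sl(3)]
            Ck_on_bounded_linear[OF O2 bounded_linear_rep]]) (auto simp: O2_def)
    then show "C_infinity_on (\<lambda>q. P ** \<sigma> (\<rho> (transpose P) q)) O2"
      unfolding C_infinity_on_def by (intro allI Ck_on_matrix_mult Ck_on_const O2)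
    show "P ** \<sigma> (\<rho> (transpose P) q) \<in> grp" for q
      by (intro grp_mult P sl(4))
    show "\<rho> (P ** \<sigma> (\<rho> (transpose P) q)) W = q" if "q \<in> orbit \<inter> O2" for q
      using sl(5)[of "\<rho> (transpose P) q"] rep_in_orbit[OF grp_transpose[OF P(1)], of q] that
      by (simp add: rep_mult O2_def rt)
  qed
qed

text \<open>A curve in the orbit lifts through a local section to a curve in the group, whose
  velocity comes from \<open>alg\<close>; its isotropy part is invisible on the orbit. Conversely
  exponentials realize every horizontal direction.\<close>

lemma tangent_space_orbit:
  assumes P: "P \<in> grp"
  shows "tangent_space orbit (\<rho> P W) = (\<lambda>X. \<rho> P (dorbit X)) ` horizontal"
proof (intro equalityI subsetI)
  note orth = grp_orthogonal[OF P]
  fix u assume "u \<in> tangent_space orbit (\<rho> P W)"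
  then obtain \<epsilon> \<gamma> where \<gamma>: "\<epsilon> > 0" "\<gamma> ` {-\<epsilon><..<\<epsilon>} \<subseteq> orbit" "\<gamma> 0 = \<rho> P W"
    "(\<gamma> has_vector_derivative u) (at (0::real))"
    by (auto simp: tangent_space_def)
  have "\<rho> P W \<in> orbit" using P by (auto simp: orbit_def)
  then obtain \<sigma> O1 where sec: "open O1" "\<rho> P W \<in> O1" "C_infinity_on \<sigma> O1" "\<And>q. \<sigma> q \<in> grp"
    "\<And>q. q \<in> orbit \<inter> O1 \<Longrightarrow> \<rho> (\<sigma> q) W = q"
    by (rule local_section) (rule that)
  let ?P = "\<sigma> (\<rho> P W)"
  have P': "?P \<in> grp" "orthogonal_matrix ?P" "\<rho> ?P W = \<rho> P W"
    using sec grp_orthogonal \<open>\<rho> P W \<in> orbit\<close> by auto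
  have "\<gamma> \<midarrow>0\<rightarrow> \<rho> P W"
    using has_vector_derivative_continuous[OF \<gamma>(4)] \<gamma>(3) by (simp add: continuous_at)
  then have "\<forall>\<^sub>F t in at 0. \<gamma> t \<in> O1"
    using sec(1,2) by (rule topological_tendstoD)
  then obtain \<delta> where \<delta>: "\<delta> > 0" "\<And>t. t \<noteq> 0 \<Longrightarrow> \<bar>t\<bar> < \<delta> \<Longrightarrow> \<gamma> t \<in> O1"
    unfolding eventually_at by (auto simp: dist_real_def)
  define S where "S = {- min \<epsilon> \<delta><..<min \<epsilon> \<delta>}"
  have S: "open S" "0 \<in> S" "\<And>t. t \<in> S \<Longrightarrow> \<gamma> t \<in> orbit \<inter> O1"
  proof -
    show "open S" "0 \<in> S" using \<gamma>(1) \<delta>(1) by (auto simp: S_def)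
    fix t assume "t \<in> S"
    then show "\<gamma> t \<in> orbit \<inter> O1"
      using \<gamma>(2,3) \<delta>(2)[of t] sec(2) \<open>\<rho> P W \<in> orbit\<close> by (cases "t = 0") (auto simp: S_def image_subset_iff)
  qed
  obtain D where D: "(\<sigma> has_derivative D) (at (\<rho> P W))"
    using C_infinity_on_has_derivative[OF sec(3,2)] by blast
  have \<sigma>\<gamma>: "((\<lambda>t. \<sigma> (\<gamma> t)) has_vector_derivative D u) (at 0)"
    by (rule has_vector_derivative_compose[OF \<gamma>(4)]) (simp add: \<gamma>(3) D)
  have X: "transpose ?P ** D u \<in> alg"
  proof (rule derivative_in_alg)
    show "((\<lambda>t. transpose ?P ** \<sigma> (\<gamma> t)) has_vector_derivative transpose ?P ** D u) (at 0)"
      by (rule bounded_linear.has_vector_derivative[OF bounded_linear_matrix_mult_right \<sigma>\<gamma>])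
    show "transpose ?P ** \<sigma> (\<gamma> 0) = mat 1"
      using P'(2) by (simp add: \<gamma>(3) orthogonal_matrix_def)
    show "transpose ?P ** \<sigma> (\<gamma> t) \<in> grp" for t
      by (intro grp_mult grp_transpose sec(4))
  qed (rule zero_less_one)
  have "((\<lambda>t. \<rho> (\<sigma> (\<gamma> t)) W) has_vector_derivative \<rho> ?P (dorbit (transpose ?P ** D u))) (at 0)"
    by (rule has_vector_derivative_compose[OF \<sigma>\<gamma>])
      (simp add: \<gamma>(3) orbit_map_has_derivative[OF P'(2)])
  then have "(\<gamma> has_vector_derivative \<rho> ?P (dorbit (transpose ?P ** D u))) (at 0)"
    by (rule has_vector_derivative_transform_within_open[OF _ S(1,2)]) (rule sec(5)[OF S(3)])
  then have u: "u = \<rho> ?P (dorbit (transpose ?P ** D u))"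
    using \<gamma>(4) vector_derivative_unique_at by blast
  \<comment> \<open>The section need not pass through \<open>P\<close>; conjugation by this element
    of the stabilizer transports the velocity from its value \<open>?P\<close> to
    \<open>P\<close>.\<close>
  let ?h = "transpose P ** ?P"
  have h: "?h \<in> fixing_normalizer"
    using P P' rep_transpose(1)[OF orth]
    by (intro fixing_normalizer_grp grp_mult grp_transpose) (simp_all add: rep_mult)
  let ?Y = "?h ** (transpose ?P ** D u) ** transpose ?h"
  have "?Y \<in> alg" by (rule fixing_normalizer_conj(1)[OF h X])
  then obtain Y where Y: "Y \<in> horizontal" "dorbit ?Y = dorbit Y"
    using horizontal_part by metis
  have "\<rho> P (dorbit Y) = \<rho> P (\<rho> ?h (dorbit (transpose ?P ** D u)))"
    using Y(2) fixing_normalizer_conj(2)[OF h] by simp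
  also have "\<dots> = u"
    using u by (simp add: rep_mult rep_transpose[OF orth])
  finally show "u \<in> (\<lambda>X. \<rho> P (dorbit X)) ` horizontal"
    using Y(1) by blast
next
  fix u assume "u \<in> (\<lambda>X. \<rho> P (dorbit X)) ` horizontal"
  then obtain X where X: "X \<in> horizontal" "u = \<rho> P (dorbit X)" by blast
  let ?\<gamma> = "\<lambda>t. \<rho> P (\<rho> (matrix_exp t X) W)"
  have "C_infinity_on ?\<gamma> UNIV"
    unfolding C_infinity_on_def by (intro allI Ck_on_rep Ck_on_const Ck_on_matrix_exp open_UNIV)
  then have "smooth_on {-1<..<1} ?\<gamma>"
    by (rule smooth_on_C_infinity) auto
  moreover have "((\<lambda>t. matrix_exp t X) has_vector_derivative X) (at 0)"
    using matrix_exp_has_vector_derivative[of X 0] by (simp add: matrix_exp_0)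
  then have "((\<lambda>t. \<rho> (matrix_exp t X) W) has_vector_derivative dorbit X) (at 0)"
    by (rule has_vector_derivative_compose) (simp add: matrix_exp_0 orbit_map_has_derivative_one)
  then have "(?\<gamma> has_vector_derivative u) (at 0)"
    unfolding X(2) by (rule bounded_linear.has_vector_derivative[OF bounded_linear_rep])
  moreover have "?\<gamma> ` {-1<..<1} \<subseteq> orbit"
    using X(1) P rep_in_orbit matrix_exp_in_grp horizontal_alg by (auto simp: orbit_def)
  ultimately show "u \<in> tangent_space orbit (\<rho> P W)"
    unfolding tangent_space_def
    by (intro CollectI exI[of _ 1] conjI exI[of _ ?\<gamma>]) (auto simp: matrix_exp_0 rep_one)
qed

text \<open>A local section moves tangent vectors back to \<open>W\<close> smoothly, and there a
  fixed linear map \<open>l\<close> gives the horizontal lift. The resulting formula makes sense off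
  the orbit for the local extensions of the two fields.\<close>

lemma orbit_metric_smooth:
  assumes X: "smooth_on orbit X" "\<And>p. p \<in> orbit \<Longrightarrow> X p \<in> tangent_space orbit p"
    and Y: "smooth_on orbit Y" "\<And>p. p \<in> orbit \<Longrightarrow> Y p \<in> tangent_space orbit p"
  shows "smooth_on orbit (\<lambda>p. orbit_metric p (X p) (Y p))"
  unfolding smooth_on_def
proof
  fix q0 assume q0: "q0 \<in> orbit"
  obtain \<sigma> O1 where sec: "open O1" "q0 \<in> O1" "C_infinity_on \<sigma> O1" "\<And>q. \<sigma> q \<in> grp"
    "\<And>q. q \<in> orbit \<inter> O1 \<Longrightarrow> \<rho> (\<sigma> q) W = q"
    by (rule local_section[OF q0]) (rule that)
  from X(1)[unfolded smooth_on_def, rule_format, OF q0]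
  obtain TX FX where FX: "open TX" "q0 \<in> TX" "\<And>r. Ck_on r FX TX" "\<And>y. y \<in> orbit \<inter> TX \<Longrightarrow> FX y = X y"
    by blast
  from Y(1)[unfolded smooth_on_def, rule_format, OF q0]
  obtain TY FY where FY: "open TY" "q0 \<in> TY" "\<And>r. Ck_on r FY TY" "\<And>y. y \<in> orbit \<inter> TY \<Longrightarrow> FY y = Y y"
    by blast
  have "inj_on dorbit (span horizontal)"
    unfolding span_eq_iff[THEN iffD2, OF subspace_horizontal] using dorbit_inj
    by (rule inj_onI)
  from linear_inj_on_left_inverse[OF linear_dorbit this]
  obtain l where l: "linear l" "\<And>X. X \<in> horizontal \<Longrightarrow> l (dorbit X) = X"
    using span_base by blast
  have bl: "bounded_linear l" using l(1) linear_conv_bounded_linear by blast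
  let ?T = "O1 \<inter> TX \<inter> TY"
  have T: "open ?T" using sec(1) FX(1) FY(1) by auto
  define F where "F q = l (\<rho> (transpose (\<sigma> q)) (FX q)) \<bullet> l (\<rho> (transpose (\<sigma> q)) (FY q)) / 2" for q
  have "Ck_on r F ?T" for r
  proof -
    have \<sigma>: "Ck_on r (\<lambda>q. transpose (\<sigma> q)) ?T"
      by (rule Ck_on_linear_compose[OF T bounded_linear_transpose])
        (rule Ck_on_subset[OF C_infinity_onD[OF sec(3)]], auto)
    have "Ck_on r FX ?T" "Ck_on r FY ?T"
      by (rule Ck_on_subset[OF FX(3)], force) (rule Ck_on_subset[OF FY(3)], force)
    then have "Ck_on r (\<lambda>q. (l (\<rho> (transpose (\<sigma> q)) (FX q)) \<bullet> l (\<rho> (transpose (\<sigma> q)) (FY q))) * (1 / 2)) ?T"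
      using \<sigma> by (intro Ck_on_mult Ck_on_inner Ck_on_const Ck_on_linear_compose[OF T bl] Ck_on_rep T)
    then show ?thesis by (simp add: F_def[abs_def])
  qed
  moreover have "F q = orbit_metric q (X q) (Y q)" if q: "q \<in> orbit \<inter> ?T" for q
  proof -
    let ?P = "\<sigma> q"
    have P: "?P \<in> grp" "\<rho> ?P W = q" using sec(4,5) q by auto
    obtain A B where AB: "A \<in> horizontal" "X q = \<rho> ?P (dorbit A)" "B \<in> horizontal" "Y q = \<rho> ?P (dorbit B)"
      using X(2)[of q] Y(2)[of q] tangent_space_orbit[OF P(1)] P(2) q by auto
    have "orbit_metric q (X q) (Y q) = A \<bullet> B / 2"
      using orbit_metric_eq[OF P(1) AB(1,3)] by (simp add: P(2) AB)
    moreover have "F q = A \<bullet> B / 2"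
      using q AB l(2) by (simp add: F_def FX(4) FY(4) rep_transpose[OF grp_orthogonal[OF P(1)]])
    ultimately show ?thesis by simp
  qed
  ultimately show "\<exists>T F. open T \<and> q0 \<in> T \<and> (\<forall>r. Ck_on r F T) \<and>
      (\<forall>y\<in>orbit \<inter> T. F y = orbit_metric y (X y) (Y y))"
    using T sec(2) FX(2) FY(2) by (intro exI[of _ ?T] exI[of _ F]) auto
qed

section \<open>The Riemannian orbit and its symmetries\<close>

lemma orbit_tangent_cases:
  assumes "p \<in> orbit"
  obtains P where "P \<in> grp" "p = \<rho> P W" "tangent_space orbit p = (\<lambda>X. \<rho> P (dorbit X)) ` horizontal"
  using assms tangent_space_orbit unfolding orbit_def by blast

lemma riemannian_manifold_orbit: "riemannian_manifold orbit orbit_metric"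
  unfolding riemannian_manifold_def riemannian_metric_def
proof (intro conjI exI[of _ "dim (dorbit ` horizontal)"] smooth_manifold_orbit ballI allI impI)
  fix p u v assume p: "p \<in> orbit" and uv: "u \<in> tangent_space orbit p" "v \<in> tangent_space orbit p"
  obtain P where P: "P \<in> grp" "p = \<rho> P W" "tangent_space orbit p = (\<lambda>X. \<rho> P (dorbit X)) ` horizontal"
    by (rule orbit_tangent_cases[OF p])
  then show "orbit_metric p u v = orbit_metric p v u"
    using uv by (auto simp: orbit_metric_eq inner_commute)
  fix w a b assume w: "w \<in> tangent_space orbit p"
  from uv w obtain X Y Z where *: "X \<in> horizontal" "Y \<in> horizontal" "Z \<in> horizontal"
    "u = \<rho> P (dorbit X)" "v = \<rho> P (dorbit Y)" "w = \<rho> P (dorbit Z)"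
    unfolding P(3) by blast
  have "a *\<^sub>R X + b *\<^sub>R Y \<in> horizontal"
    using * subspace_horizontal by (simp add: subspace_add subspace_scale)
  moreover have "a *\<^sub>R u + b *\<^sub>R v = \<rho> P (dorbit (a *\<^sub>R X + b *\<^sub>R Y))"
    by (simp add: * linear_add linear_scale linear_dorbit linear_rep)
  ultimately have "orbit_metric p (a *\<^sub>R u + b *\<^sub>R v) w = (a *\<^sub>R X + b *\<^sub>R Y) \<bullet> Z / 2"
    using orbit_metric_eq[OF P(1)] *(3,6) P(2) by simp
  then show "orbit_metric p (a *\<^sub>R u + b *\<^sub>R v) w = a * orbit_metric p u w + b * orbit_metric p v w"
    unfolding P(2) *(4-6) orbit_metric_eq[OF P(1) *(1,3)] orbit_metric_eq[OF P(1) *(2,3)]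
    by (simp add: inner_left_distrib add_divide_distrib)
next
  fix p u assume p: "p \<in> orbit" and u: "u \<in> tangent_space orbit p" "u \<noteq> 0"
  obtain P where P: "P \<in> grp" "p = \<rho> P W" "tangent_space orbit p = (\<lambda>X. \<rho> P (dorbit X)) ` horizontal"
    by (rule orbit_tangent_cases[OF p])
  then obtain X where X: "X \<in> horizontal" "u = \<rho> P (dorbit X)" using u by blast
  then have "X \<noteq> 0"
    using u(2) linear_0[OF linear_rep] linear_0[OF linear_dorbit] by auto
  then show "orbit_metric p u u > 0"
    unfolding P(2) X(2) orbit_metric_eq[OF P(1) X(1) X(1)] by simp
qed (use orbit_metric_smooth in blast)

text \<open>Since \<open>R\<close> fixes \<open>W\<close>, the map sends the orbit point of
  \<open>P\<close> to that of \<open>P0 ** (R ** P ** transpose R)\<close>, while horizontal lifts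
  are conjugated by \<open>R\<close>, which preserves their inner products.\<close>

lemma rep_isometry:
  assumes P0: "P0 \<in> grp" and R: "R \<in> fixing_normalizer"
  shows "riemannian_isometry orbit orbit_metric orbit orbit_metric (\<rho> (P0 ** R))"
proof -
  have R': "orthogonal_matrix R" "\<rho> R W = W" "\<And>P. P \<in> grp \<Longrightarrow> R ** P ** transpose R \<in> grp"
    "\<And>P. P \<in> grp \<Longrightarrow> transpose R ** P ** R \<in> grp" "\<rho> (transpose R) W = W"
    using R fixing_normalizer_transpose[OF R] by (auto simp: fixing_normalizer_def)
  let ?Q = "P0 ** R"
  have orth: "orthogonal_matrix ?Q"
    using grp_orthogonal[OF P0] R'(1) by (rule orthogonal_matrix_mul)
  note rt = rep_transpose[OF orth]
  have act: "\<rho> ?Q (\<rho> P v) = \<rho> (P0 ** (R ** P ** transpose R)) (\<rho> R v)" for P v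
    by (simp add: rep_mult rep_transpose[OF R'(1)])
  have fwd: "\<rho> ?Q p \<in> orbit" if "p \<in> orbit" for p
    using that grp_mult[OF P0 R'(3)] by (auto simp: orbit_def act R'(2))
  have bwd: "\<rho> (transpose ?Q) p \<in> orbit" if "p \<in> orbit" for p
  proof -
    obtain P where P: "P \<in> grp" "p = \<rho> P W"
      using \<open>p \<in> orbit\<close> by (auto simp: orbit_def)
    have "\<rho> (transpose R ** (transpose P0 ** P) ** R) W = \<rho> (transpose ?Q) p"
      by (simp add: P(2) rep_mult R'(2) matrix_transpose_mul)
    then show ?thesis
      using R'(4)[OF grp_mult[OF grp_transpose[OF P0] P(1)]] by (metis orbit_def imageI)
  qed
  have bij: "bij_betw (\<rho> ?Q) orbit orbit"
    by (rule bij_betw_byWitness[where f' = "\<rho> (transpose ?Q)"]) (use fwd bwd rt in auto)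
  have sm: "smooth_on orbit (\<rho> Q)" for Q
    by (rule smooth_on_C_infinity[OF C_infinity_bounded_linear[OF bounded_linear_rep]]) auto
  have "smooth_on orbit (inv_into orbit (\<rho> ?Q))"
  proof (rule smooth_on_C_infinity[OF C_infinity_bounded_linear[OF bounded_linear_rep]])
    show "\<rho> (transpose ?Q) y = inv_into orbit (\<rho> ?Q) y" if "y \<in> orbit" for y
      using bij bwd[OF that] rt(2) by (metis bij_betw_def inv_into_f_eq)
  qed auto
  then have "diffeomorphism orbit orbit (\<rho> ?Q)"
    using bij sm by (simp add: diffeomorphism_def)
  moreover have "orbit_metric (\<rho> ?Q p) (\<rho> ?Q u) (\<rho> ?Q v) = orbit_metric p u v"
    if p: "p \<in> orbit" and uv: "u \<in> tangent_space orbit p" "v \<in> tangent_space orbit p" for p u v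
  proof -
    obtain P where P: "P \<in> grp" "p = \<rho> P W" "tangent_space orbit p = (\<lambda>X. \<rho> P (dorbit X)) ` horizontal"
      by (rule orbit_tangent_cases[OF p])
    from uv obtain X Y where *: "X \<in> horizontal" "Y \<in> horizontal" "u = \<rho> P (dorbit X)" "v = \<rho> P (dorbit Y)"
      unfolding P(3) by blast
    have "P0 ** (R ** P ** transpose R) \<in> grp"
      by (intro grp_mult P0 R'(3) P(1))
    from orbit_metric_eq[OF this fixing_normalizer_horizontal[OF R *(1)]
        fixing_normalizer_horizontal[OF R *(2)]]
    show ?thesis
      using orbit_metric_eq[OF P(1) *(1,2)]
      by (simp add: act R'(2) P(2) * fixing_normalizer_conj(2)[OF R] fixing_normalizer_inner[OF R])
  qed
  ultimately show ?thesis
    unfolding riemannian_isometry_def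
    by (intro conjI ballI exI[of _ "\<rho> ?Q"]) (auto intro: bounded_linear_imp_has_derivative bounded_linear_rep)
qed

theorem orbit_symmetric:
  assumes conn: "connected grp" and R: "R \<in> fixing_normalizer"
    and anti: "\<And>X. X \<in> horizontal \<Longrightarrow> R ** X ** transpose R = - X"
  shows "symmetric_space orbit orbit_metric"
  unfolding symmetric_space_def
proof (intro conjI riemannian_manifold_orbit ballI)
  show "connected orbit"
    unfolding orbit_def
    using connected_continuous_image[OF _ conn] C_infinity_on_continuous_on[OF smooth_rep]
      continuous_on_subset by blast
  fix p assume p: "p \<in> orbit"
  obtain P where P: "P \<in> grp" "p = \<rho> P W" "tangent_space orbit p = (\<lambda>X. \<rho> P (dorbit X)) ` horizontal"
    by (rule orbit_tangent_cases[OF p])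
  have R': "orthogonal_matrix R" "\<rho> R W = W" "\<And>P. P \<in> grp \<Longrightarrow> R ** P ** transpose R \<in> grp"
    using R by (auto simp: fixing_normalizer_def)
  \<comment> \<open>The reflection at \<open>\<rho> P W\<close> is that at \<open>W\<close>
    conjugated by \<open>P\<close>. Factoring it as a group element times \<open>R\<close> gives the
    shape required by \<open>rep_isometry\<close>.\<close>
  let ?P0 = "P ** (R ** transpose P ** transpose R)"
  have P0: "?P0 \<in> grp"
    by (intro grp_mult P(1) R'(3) grp_transpose)
  have act: "\<rho> (?P0 ** R) (\<rho> P v) = \<rho> P (\<rho> R v)" for v
    by (simp add: rep_mult rep_transpose[OF R'(1)] rep_transpose[OF grp_orthogonal[OF P(1)]])
  have neg: "\<rho> (?P0 ** R) u = - u" if "u \<in> tangent_space orbit p" for u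
  proof -
    obtain X where X: "X \<in> horizontal" "u = \<rho> P (dorbit X)"
      using \<open>u \<in> tangent_space orbit p\<close> unfolding P(3) by blast
    have "\<rho> R (dorbit X) = - dorbit X"
      using fixing_normalizer_conj(2)[OF R, of X] anti[OF X(1)] by (simp add: linear_neg[OF linear_dorbit])
    then show ?thesis
      unfolding X(2) act by (simp add: linear_neg[OF linear_rep])
  qed
  have "point_reflection orbit orbit_metric p (\<rho> (?P0 ** R))"
    unfolding point_reflection_def
    using rep_isometry[OF P0 R] neg act[of W] R'(2)
    by (auto simp: P(2) intro!: exI[of _ "\<rho> (?P0 ** R)"] bounded_linear_imp_has_derivative bounded_linear_rep)
  then show "\<exists>f. point_reflection orbit orbit_metric p f" by blast
qed

end

section \<open>The calibrated Grassmannian\<close>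

lemma vector_derivative_in_subspace:
  fixes S :: "'a::euclidean_space set"
  assumes S: "subspace S" and \<gamma>: "(\<gamma> has_vector_derivative v) (at t)" "\<And>s. \<gamma> s \<in> S"
  shows "v \<in> S"
proof -
  have "y \<bullet> v = 0" if "y \<in> S\<^sup>\<bottom>" for y
  proof -
    have "((\<lambda>t. y \<bullet> \<gamma> t) has_vector_derivative y \<bullet> v) (at t)"
      by (rule bounded_linear.has_vector_derivative[OF bounded_linear_inner_right \<gamma>(1)])
    moreover have "y \<bullet> \<gamma> s = 0" for s
      using that \<gamma>(2)[of s] by (simp add: orthogonal_comp_def orthogonal_def inner_commute[of y])
    then have "((\<lambda>t. y \<bullet> \<gamma> t) has_vector_derivative 0) (at t)"
      by simp
    ultimately show ?thesis
      by (rule vector_derivative_unique_at)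
  qed
  then have "v \<in> S\<^sup>\<bottom>\<^sup>\<bottom>"
    by (simp add: orthogonal_comp_def orthogonal_def)
  then show ?thesis by (simp add: orthogonal_comp_self[OF S])
qed

text \<open>Right translation by \<open>Q\<close> multiplies the determinant by \<open>det Q\<close>
  and changes the vector arguments; admitting all multiples \<open>c\<close> and all arguments makes
  the family closed under it.\<close>

definition stabilizer_functions ::
    "nat \<Rightarrow> (nat \<Rightarrow> nat) \<Rightarrow> (nat \<Rightarrow> 'n::finite rvec list \<Rightarrow> real) \<Rightarrow> ('n rmat \<Rightarrow> real) set" where
  "stabilizer_functions N d \<alpha> = {\<lambda>P. c * det P | c. True} \<union> {\<lambda>P. (P *v u) \<bullet> (P *v v) | u v. True} \<union>
     {\<lambda>P. \<alpha> j (map ((*v) P) vs) | j vs. j \<le> N \<and> length vs = d j}"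

lemma stabilizer_functions_eq_iff:
  "(\<forall>\<phi>\<in>stabilizer_functions N d \<alpha>. \<phi> P = \<phi> (mat 1)) \<longleftrightarrow> P \<in> form_stabilizer N d \<alpha>"
proof -
  let ?F = "stabilizer_functions N d \<alpha>"
  have mem: "(\<lambda>P. 1 * det P) \<in> ?F" "(\<lambda>P. (P *v u) \<bullet> (P *v v)) \<in> ?F"
    "j \<le> N \<Longrightarrow> length vs = d j \<Longrightarrow> (\<lambda>P. \<alpha> j (map ((*v) P) vs)) \<in> ?F" for u v j vs
    unfolding stabilizer_functions_def by blast+
  have orth: "orthogonal_matrix P \<longleftrightarrow> (\<forall>u v. (P *v u) \<bullet> (P *v v) = u \<bullet> v)"
    using orthogonal_transformation_matrix[of "(*v) P"]
    by (simp add: orthogonal_transformation_def)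
  show ?thesis
  proof
    assume *: "\<forall>\<phi>\<in>?F. \<phi> P = \<phi> (mat 1)"
    have "det P = 1" "(P *v u) \<bullet> (P *v v) = u \<bullet> v"
      "j \<le> N \<Longrightarrow> length vs = d j \<Longrightarrow> \<alpha> j (map ((*v) P) vs) = \<alpha> j vs" for u v j vs
      using bspec[OF * mem(1)] bspec[OF * mem(2)[of u v]] bspec[OF * mem(3)[of j vs]]
      by (simp_all add: map_idI)
    then show "P \<in> form_stabilizer N d \<alpha>"
      by (simp add: form_stabilizer_def rotation_matrix_def orth)
  next
    assume "P \<in> form_stabilizer N d \<alpha>"
    then show "\<forall>\<phi>\<in>?F. \<phi> P = \<phi> (mat 1)"
      by (auto simp: form_stabilizer_def rotation_matrix_def orth stabilizer_functions_def map_idI)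
  qed
qed

lemma stabilizer_functions_matrix_stabilizer:
  fixes \<alpha> :: "nat \<Rightarrow> 'n::{finite,linorder} rvec list \<Rightarrow> real"
  assumes forms: "\<And>j. j \<le> N \<Longrightarrow> skew_form (d j) (\<alpha> j)"
  shows "matrix_stabilizer (stabilizer_functions N d \<alpha>)"
proof
  fix \<phi> and P Q :: "'n rmat" assume "\<phi> \<in> stabilizer_functions N d \<alpha>"
  then consider (det) c where "\<phi> = (\<lambda>P. c * det P)" | (inner) u v where "\<phi> = (\<lambda>P. (P *v u) \<bullet> (P *v v))"
    | (form) j vs where "\<phi> = (\<lambda>P. \<alpha> j (map ((*v) P) vs))" "j \<le> N" "length vs = d j"
    by (auto simp: stabilizer_functions_def)
  then show "\<phi> differentiable (at P)"
  proof cases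
    case det
    have "Ck_on (Suc 0) \<phi> UNIV"
      unfolding det by (intro Ck_on_mult Ck_on_const Ck_on_det Ck_on_ident open_UNIV)
    then show ?thesis by simp
  next
    case inner
    have "Ck_on (Suc 0) \<phi> UNIV"
      unfolding inner
      by (intro Ck_on_inner open_UNIV Ck_on_bounded_linear bounded_linear_matrix_vector_mult_left)
    then show ?thesis by simp
  next
    case form
    then have "C_infinity_on \<phi> UNIV"
      using C_infinity_skew_form_image[of vs "\<alpha> j"] forms by simp
    then show ?thesis
      using C_infinity_on_has_derivative[of \<phi> UNIV P] by (auto simp: differentiable_def)
  qed
next
  fix \<phi> and Q :: "'n rmat" assume "\<phi> \<in> stabilizer_functions N d \<alpha>"
  then consider (det) c where "\<phi> = (\<lambda>P. c * det P)" | (inner) u v where "\<phi> = (\<lambda>P. (P *v u) \<bullet> (P *v v))"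
    | (form) j vs where "\<phi> = (\<lambda>P. \<alpha> j (map ((*v) P) vs))" "j \<le> N" "length vs = d j"
    by (auto simp: stabilizer_functions_def)
  then show "(\<lambda>P. \<phi> (P ** Q)) \<in> stabilizer_functions N d \<alpha>"
  proof cases
    case det
    then have "(\<lambda>P. \<phi> (P ** Q)) = (\<lambda>P. (c * det Q) * det P)"
      by (simp add: det_mul mult_ac)
    then show ?thesis unfolding stabilizer_functions_def by blast
  next
    case inner
    then have "(\<lambda>P. \<phi> (P ** Q)) = (\<lambda>P. (P *v (Q *v u)) \<bullet> (P *v (Q *v v)))"
      by (simp add: matrix_vector_mul_assoc)
    then show ?thesis unfolding stabilizer_functions_def by blast
  next
    case form
    then have "(\<lambda>P. \<phi> (P ** Q)) = (\<lambda>P. \<alpha> j (map ((*v) P) (map ((*v) Q) vs)))"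
      by (simp add: o_def matrix_vector_mul_assoc)
    moreover have "length (map ((*v) Q) vs) = d j" using form by simp
    ultimately show ?thesis unfolding stabilizer_functions_def using form(2) by blast
  qed
next
  fix P :: "'n rmat"
  assume "\<And>\<phi>. \<phi> \<in> stabilizer_functions N d \<alpha> \<Longrightarrow> \<phi> P = \<phi> (mat 1)"
  then have "P \<in> form_stabilizer N d \<alpha>"
    using stabilizer_functions_eq_iff by blast
  then show "orthogonal_matrix P"
    by (simp add: form_stabilizer_def rotation_matrix_def)
qed

lemma ext_map_calibrated_Grassmannian:
  assumes W: "W \<in> calibrated_Grassmannian k \<alpha>" and P: "orthogonal_matrix P"
    and inv: "\<And>vs. length vs = k \<Longrightarrow> \<alpha> (map ((*v) P) vs) = \<alpha> vs"
  shows "ext_map P W \<in> calibrated_Grassmannian k \<alpha>"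
proof -
  obtain B where B: "length B = k" "orthonormal_list B" "W = wedge B"
    using W by (auto simp: calibrated_Grassmannian_def oriented_planes_def)
  have "ext_map P W \<in> oriented_planes k"
    unfolding oriented_planes_def B(3) ext_map_wedge
    using B orthonormal_list_map[OF P B(2)] by (intro CollectI exI[of _ "map ((*v) P) B"]) simp
  moreover have "\<alpha> vs = vol (ext_map P W) vs"
    if vs: "length vs = k" "set vs \<subseteq> plane (ext_map P W)" for vs
  proof -
    have "\<exists>us. length us = k \<and> set us \<subseteq> plane W \<and> map ((*v) P) us = vs"
    proof (intro exI[of _ "map ((*v) (transpose P)) vs"] conjI)
      show "set (map ((*v) (transpose P)) vs) \<subseteq> plane W"
        using vs(2) P unfolding plane_ext_map[OF P]
        by (auto simp: orthogonal_matrix_def matrix_vector_mul_assoc simp del: transpose_matrix_vector)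
      show "map ((*v) P) (map ((*v) (transpose P)) vs) = vs"
        using P by (simp add: orthogonal_matrix_def matrix_vector_mul_assoc o_def map_idI
            del: transpose_matrix_vector)
    qed (use vs in simp)
    then obtain us where us: "length us = k" "set us \<subseteq> plane W" "map ((*v) P) us = vs"
      by blast
    have "\<alpha> us = vol W us"
      using W us by (auto simp: calibrated_Grassmannian_def calibrated_def)
    then show ?thesis
      using inv[OF us(1)] inner_ext_map_orthogonal[OF P, of W "wedge us"] us(3)
      by (simp add: vol_def ext_map_wedge)
  qed
  ultimately show ?thesis
    by (simp add: calibrated_Grassmannian_def calibrated_def)
qed

theorem proposition2p16:
  fixes \<alpha> :: "nat \<Rightarrow> 'n::{finite,linorder} rvec list \<Rightarrow> real"
    and d :: "nat \<Rightarrow> nat" and N k :: nat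
    and G :: "'n rmat set" and Gr :: "'n multivector set" and W :: "'n multivector"
  assumes k: "d 0 = k" "1 \<le> k" "k \<le> CARD('n) - 1"
    and forms: "\<And>j. j \<le> N \<Longrightarrow> skew_form (d j) (\<alpha> j)"
    and calibration: "calibration k (\<alpha> 0)"
    and Gr: "Gr = calibrated_Grassmannian k (\<alpha> 0)"
    and G: "G = form_stabilizer N d \<alpha>"
    and transitive: "\<And>U V. U \<in> Gr \<Longrightarrow> V \<in> Gr \<Longrightarrow> \<exists>P\<in>G. ext_map P U = V"
    and W: "W \<in> Gr"
    and compliant: "compliant G W"
    and connected: "connected G"
  shows "locally_symmetric_space Gr (homogeneous_metric G W) \<and>
    (simply_connected Gr \<longrightarrow> symmetric_space Gr (homogeneous_metric G W))"
proof -
  interpret matrix_stabilizer "stabilizer_functions N d \<alpha>"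
    by (rule stabilizer_functions_matrix_stabilizer[OF forms])
  interpret orthogonal_orbit "stabilizer_functions N d \<alpha>" ext_map W
    by (rule orthogonal_orbit.intro[OF matrix_stabilizer_axioms orthogonal_orbit_axioms.intro])
      (rule linear_ext_map ext_map_mult ext_map_mat_1 C_infinity_ext_map)+
  have grp: "grp = G"
    by (simp add: grp_def G stabilizer_functions_eq_iff)
  have "ext_map P W \<in> Gr" if P: "P \<in> G" for P
    unfolding Gr
  proof (rule ext_map_calibrated_Grassmannian)
    show "W \<in> calibrated_Grassmannian k (\<alpha> 0)" using W Gr by simp
    show "orthogonal_matrix P" using P grp_orthogonal by (simp add: grp)
    show "\<alpha> 0 (map ((*v) P) vs) = \<alpha> 0 vs" if "length vs = k" for vs
      using P that k(1) by (simp add: G form_stabilizer_def)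
  qed
  then have orbit: "orbit = Gr"
    using transitive[OF W] unfolding orbit_def grp by (auto simp: image_iff)
  have metric: "orbit_metric = homogeneous_metric G W"
    by (simp add: orbit_metric_def homogeneous_metric_def grp)
  have alg: "lie_algebra G = alg"
    using tangent_space_grp[OF grp_one] by (simp add: lie_algebra_def grp image_def)
  have iso: "lie_algebra (plane_stabilizer G W) = isotropy_alg"
    using lie_algebra_isotropy by (simp add: plane_stabilizer_def grp)
  \<comment> \<open>This is compliance itself, rewritten with the algebraic descriptions of the two
    Lie algebras; the factor in \<open>so_inner\<close> does not affect orthogonality.\<close>
  have horizontal: "horizontal = alg \<inter> mixed_part (plane W)"
    using compliant unfolding compliant_def alg iso by (simp add: so_inner_def horizontal_def)
  obtain B where B: "orthonormal_list B" "W = wedge B"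
    using W by (auto simp: Gr calibrated_Grassmannian_def oriented_planes_def)
  have plane: "plane W = span (set B)"
    unfolding B(2) by (rule plane_wedge[OF B(1)])
  have sub: "subspace (plane W)"
    unfolding plane by (rule subspace_span)
  obtain R :: "'n rmat" where R: "R ** R = mat 1" "transpose R = R"
    "\<And>x. x \<in> plane W \<Longrightarrow> R *v x = x" "\<And>x. x \<in> (plane W)\<^sup>\<bottom> \<Longrightarrow> R *v x = - x"
    by (rule plane_reflection_exists[OF sub]) (rule that)
  have anti: "R ** X ** R = - X" if "X \<in> horizontal" for X
    using that reflection_conj_mixed_part[OF R(2-4)] by (simp add: horizontal)
  have comm: "R ** X ** R = X" if X: "X \<in> isotropy_alg" for X
  proof (rule reflection_conj_skew[OF sub _ _ R(3,4)])
    have "X \<in> alg" using X by (simp add: isotropy_alg_def)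
    then show "transpose X = - X" by (rule alg_skew)
    fix x assume x: "x \<in> plane W"
    show "X *v x \<in> plane W"
    \<comment> \<open>Exponentials of \<open>X\<close> fix the multivector \<open>W\<close>, hence
      map its plane to itself; differentiating at \<open>0\<close> keeps the image in the
      plane.\<close>
    proof (rule vector_derivative_in_subspace[OF sub])
      show "((\<lambda>t. matrix_exp t X *v x) has_vector_derivative X *v x) (at 0)"
        using bounded_linear.has_vector_derivative[OF bounded_linear_matrix_vector_mult_left
            matrix_exp_has_vector_derivative[of X 0]] by (simp add: matrix_exp_0)
      show "matrix_exp t X *v x \<in> plane W" for t
        using plane_ext_map[OF grp_orthogonal[OF matrix_exp_in_grp[OF \<open>X \<in> alg\<close>]], of t W]
          matrix_exp_fixes[OF X] x by auto
    qed
  qed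
  have "R ** X ** R \<in> alg" if "X \<in> alg" for X
  proof -
    \<comment> \<open>Splitting \<open>X\<close> into isotropy and horizontal parts, conjugation by
      \<open>R\<close> fixes the one and negates the other, so the result is again in
      \<open>alg\<close>.\<close>
    obtain Y where Y: "Y \<in> horizontal" "X - Y \<in> isotropy_alg"
      by (rule horizontal_part[OF \<open>X \<in> alg\<close>]) (rule that)
    have "R ** X ** R = R ** (X - Y) ** R + R ** Y ** R"
      by (simp add: matrix_mult_algebra)
    also have "\<dots> = (X - Y) - Y"
      by (simp add: anti[OF Y(1)] comm[OF Y(2)])
    finally have eq: "R ** X ** R = (X - Y) - Y" .
    show ?thesis
      unfolding eq by (intro subspace_diff subspace_alg that horizontal_alg Y(1))
  qed
  then have conj: "R ** P ** R \<in> grp" if "P \<in> grp" for P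
    using conj_in_grp[OF _ R(1,2)] connected that grp by simp
  \<comment> \<open>\<open>R\<close> fixes each vector of an oriented basis of the plane, so it
    fixes \<open>W\<close> with its orientation, whatever its determinant.\<close>
  have "map ((*v) R) B = B"
    using R(3) span_base[of _ "set B"] plane by (intro map_idI) auto
  then have "ext_map R W = W"
    by (simp add: B(2) ext_map_wedge)
  then have "R \<in> fixing_normalizer"
    using R(1,2) conj by (simp add: fixing_normalizer_def orthogonal_matrix_def)
  then have sym: "symmetric_space Gr (homogeneous_metric G W)"
    using orbit_symmetric[of R] anti R(2) connected unfolding orbit metric grp by simp
  moreover have "locally_symmetric_space Gr (homogeneous_metric G W)"
    using sym unfolding locally_symmetric_space_def symmetric_space_def
    by (metis openin_subtopology_self)
  ultimately show ?thesis by blast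
qed

end
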